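(* Let $(E,\mathcal E,\mu)$ be a probability space and $T:E\to E$ a bijective bimeasurable transformation preserving $\mu$. Let $(X_i)_{i\ge1}$ be i.i.d. $\mathbb Z$-valued random variables on a probability space $(\Omega,\mathcal A,\mathbb P)$, let $S_0=0$ and $S_n=\sum_{i=1}^nX_i$ for $n\ge1$, and assume the random walk $(S_n)_{n\ge0}$ is transient, with Green function $G(0,x)=\sum_{k=0}^{+\infty}\mathbb P(S_k=x)<\infty$, $x\in\mathbb Z$. Let $f\in\mathbb L^2(\mu)$ be real-valued with $\mathbb E_\mu(f)=0$. Assume that the sequence $\xi=(f\circ T^x)_{x\in\mathbb Z}$, viewed as a sequence of random variables on $(E,\mathcal E,\mu)$, satisfies: there is a function $g:(0,\infty)\to[0,\infty)$ such that $\theta_2^{\xi}(n)\le g(n)$ for all integers $n\ge1$, the map $x\mapsto x^{3/2}g(x)$ is non-increasing, and there exists $\varepsilon\in(0,1)$ with $\sum_{i=0}^\infty2^{3i/2}g(2^{i\varepsilon})<\infty$. Assume also that $$\sigma^2(f)=2\sum_{x\in\mathbb Z}G(0,x)\,\mathbb E_\mu(f\cdot f\circ T^x)-\mathbb E_\mu(f^2)$$ is finite and positive. Then, for $\mathbb P$-almost every $\omega\in\Omega$, the random variables (on $(E,\mathcal E,\mu)$) $$\frac1{\sqrt n}\sum_{k=0}^nf\circ T^{S_k(\omega)}$$ converge in distribution, as $n\to+\infty$, to $\mathcal N(0,\sigma^2(f))$.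
   Context: $\mathbb E_\mu$ denotes expectation with respect to $\mu$. The dependence coefficient $\theta_2^\xi(n)$ of a sequence $\xi=(\xi_i)_{i\in\mathbb Z}$ of square integrable real random variables is defined as follows. On $\mathbb R^m$ let $d_1(x,y)=\sum_{i=1}^m|x_i-y_i|$. Let $\tilde\Lambda$ be the set of all functions $f:\mathbb R^m\to\mathbb R$ (for some $m\ge1$) that are Lipschitz with respect to $d_1$ with Lipschitz constant at most $1$. For a square integrable $\mathbb R^m$-valued random variable $Y$ and a $\sigma$-algebra $\mathcal M$, set $$\theta_2(\mathcal M,Y)=\sup\{\|\mathbb E(f(Y)\mid\mathcal M)-\mathbb E(f(Y))\|_2:\ f\in\tilde\Lambda,\ f \text{ defined on } \mathbb R^m\}.$$ With $\mathcal M_i=\sigma(\xi_j,\ j\le i)$, $i\in\mathbb Z$, set for $k\in\mathbb N^*\cup\{\infty\}$ $$\theta_{k,2}^\xi(n)=\sup_{1\le l\le k,\ l<\infty}\frac1l\sup\{\theta_2(\mathcal M_p,(\xi_{j_1},\dots,\xi_{j_l})):\ p\in\mathbb Z,\ p+n\le j_1<\dots<j_l\},\qquad \theta_2^\xi(n)=\theta_{\infty,2}^\xi(n)=\sup_{k\in\mathbb N^*}\theta_{k,2}^\xi(n).$$ *)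

theory Defs
  imports "HOL-Probability.Probability" "HOL-Library.Extended_Nat"
begin

subsection \<open>Dependence coefficients\<close>

text \<open>
  Vectors of \<open>\<real>^m\<close>, with \<open>m\<close> varying, are extensional functions on \<open>{..<m}\<close>, i.e. points
  of the space of \<open>PiM {..<m} (\<lambda>_. borel)\<close>; coordinates are numbered from 0.
\<close>

definition d1 :: "nat \<Rightarrow> (nat \<Rightarrow> real) \<Rightarrow> (nat \<Rightarrow> real) \<Rightarrow> real" where
  "d1 m x y = (\<Sum>i<m. \<bar>x i - y i\<bar>)"

definition Lip1 :: "nat \<Rightarrow> ((nat \<Rightarrow> real) \<Rightarrow> real) set" where
  "Lip1 m = {h. \<forall>x \<in> {..<m} \<rightarrow>\<^sub>E UNIV. \<forall>y \<in> {..<m} \<rightarrow>\<^sub>E UNIV. \<bar>h x - h y\<bar> \<le> d1 m x y}"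

text \<open>The Bochner integral of a non-integrable function is 0, hence the case distinction.\<close>

definition norm2 :: "'a measure \<Rightarrow> ('a \<Rightarrow> real) \<Rightarrow> ennreal" where
  "norm2 M Z = (if integrable M (\<lambda>\<omega>. (Z \<omega>)\<^sup>2) then ennreal (sqrt (\<integral>\<omega>. (Z \<omega>)\<^sup>2 \<partial>M)) else \<infinity>)"

definition theta2 :: "'a measure \<Rightarrow> 'a measure \<Rightarrow> nat \<Rightarrow> ('a \<Rightarrow> nat \<Rightarrow> real) \<Rightarrow> ennreal" where
  "theta2 M F m Y =
     (SUP h \<in> Lip1 m. norm2 M (\<lambda>\<omega>. real_cond_exp M F (\<lambda>\<omega>'. h (Y \<omega>')) \<omega> - (\<integral>\<omega>'. h (Y \<omega>') \<partial>M)))"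

text \<open>The \<open>\<sigma>\<close>-algebra generated by \<open>\<xi> j\<close>, \<open>j \<le> p\<close> (the measure it carries is irrelevant).\<close>

definition past :: "'a measure \<Rightarrow> (int \<Rightarrow> 'a \<Rightarrow> real) \<Rightarrow> int \<Rightarrow> 'a measure" where
  "past M \<xi> p = sigma (space M) (\<Union>j\<in>{..p}. {\<xi> j -` A \<inter> space M | A. A \<in> sets borel})"

definition theta_coeff ::
    "'a measure \<Rightarrow> (int \<Rightarrow> 'a \<Rightarrow> real) \<Rightarrow> enat \<Rightarrow> nat \<Rightarrow> ennreal" where
  "theta_coeff M \<xi> k n =
     (SUP l \<in> {l::nat. 1 \<le> l \<and> enat l \<le> k}.
        (SUP (p, j) \<in> {(p::int, j::nat \<Rightarrow> int). p + int n \<le> j 0 \<and> strict_mono_on {..<l} j}.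
           theta2 M (past M \<xi> p) l (\<lambda>\<omega>. \<lambda>i\<in>{..<l}. \<xi> (j i) \<omega>)) / of_nat l)"

abbreviation theta2_coeff :: "'a measure \<Rightarrow> (int \<Rightarrow> 'a \<Rightarrow> real) \<Rightarrow> nat \<Rightarrow> ennreal" where
  "theta2_coeff M \<xi> n \<equiv> theta_coeff M \<xi> \<infinity> n"

subsection \<open>Invertible measure-preserving transformations\<close>

definition invertible_mpt :: "'a measure \<Rightarrow> ('a \<Rightarrow> 'a) \<Rightarrow> bool" where
  "invertible_mpt M T \<longleftrightarrow>
     bij_betw T (space M) (space M) \<and> T \<in> measurable M M \<and>
     inv_into (space M) T \<in> measurable M M \<and> distr M M T = M"

definition iter_int :: "'a measure \<Rightarrow> ('a \<Rightarrow> 'a) \<Rightarrow> int \<Rightarrow> 'a \<Rightarrow> 'a" where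
  "iter_int M T x =
     (if 0 \<le> x then T ^^ nat x else inv_into (space M) T ^^ nat (- x))"

subsection \<open>Random walks on the integers\<close>

text \<open>The increments are \<open>X 1, X 2, \<dots>\<close>; the value of \<open>X 0\<close> plays no role.\<close>

definition iid_increments :: "'w measure \<Rightarrow> (nat \<Rightarrow> 'w \<Rightarrow> int) \<Rightarrow> bool" where
  "iid_increments P X \<longleftrightarrow>
     prob_space.indep_vars P (\<lambda>_. count_space UNIV) X {1..} \<and>
     (\<forall>i\<ge>1. distr P (count_space UNIV) (X i) = distr P (count_space UNIV) (X 1))"

definition walk :: "(nat \<Rightarrow> 'w \<Rightarrow> int) \<Rightarrow> nat \<Rightarrow> 'w \<Rightarrow> int" where
  "walk X n \<omega> = (\<Sum>i=1..n. X i \<omega>)"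

text \<open>Transience: the walk returns to its starting point with probability less than 1.\<close>

definition transient_walk :: "'w measure \<Rightarrow> (nat \<Rightarrow> 'w \<Rightarrow> int) \<Rightarrow> bool" where
  "transient_walk P X \<longleftrightarrow> measure P {\<omega> \<in> space P. \<exists>n\<ge>1. walk X n \<omega> = 0} < 1"

definition green :: "'w measure \<Rightarrow> (nat \<Rightarrow> 'w \<Rightarrow> int) \<Rightarrow> int \<Rightarrow> ennreal" where
  "green P X x = (\<Sum>k. ennreal (measure P {\<omega> \<in> space P. walk X k \<omega> = x}))"

subsection \<open>The limiting variance\<close>

definition variance_term ::
    "'a measure \<Rightarrow> ('a \<Rightarrow> 'a) \<Rightarrow> 'w measure \<Rightarrow> (nat \<Rightarrow> 'w \<Rightarrow> int) \<Rightarrow> ('a \<Rightarrow> real) \<Rightarrow> int \<Rightarrow> real" where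
  "variance_term M T P X f x =
     enn2real (green P X x) * (\<integral>y. f y * f (iter_int M T x y) \<partial>M)"

definition sigma2 ::
    "'a measure \<Rightarrow> ('a \<Rightarrow> 'a) \<Rightarrow> 'w measure \<Rightarrow> (nat \<Rightarrow> 'w \<Rightarrow> int) \<Rightarrow> ('a \<Rightarrow> real) \<Rightarrow> real" where
  "sigma2 M T P X f =
     2 * (\<Sum>\<^sub>\<infinity>x\<in>UNIV. variance_term M T P X f x) - (\<integral>y. (f y)\<^sup>2 \<partial>M)"

end

theory Submission
  imports Defs "HOL-Real_Asymp.Real_Asymp"
begin

text \<open>
For a fixed path \<open>\<omega>\<close> of the walk, let \<open>N\<^sub>n(x)\<close> be the number of visits to \<open>x\<close> up to time \<open>n\<close>.
The sum under study is \<open>\<Sum>x. N\<^sub>n(x) \<cdot> f \<circ> T\<^sup>x\<close>: a weighted sum of a stationary sequence \<open>\<xi>\<close> with weights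
that are deterministic once \<open>\<omega>\<close> is frozen. The theorem therefore splits into a central limit
theorem for weighted sums of \<open>\<xi>\<close> and almost sure statements about occupation numbers.

The weighted sums. Since \<open>x\<^bsup>3/2\<^esup> g(x)\<close> is non-increasing, \<open>\<theta>\<^sub>2(n) \<le> g(1) n\<^bsup>-3/2\<^esup>\<close>. By duality
in \<open>L\<^sup>2\<close> this bounds the covariance of a variable of the past with a Lipschitz function of a
block of \<open>m\<close> later variables at distance \<open>n\<close> by a multiple of \<open>m n\<^bsup>-3/2\<^esup>\<close>
(\<open>cov_past_block_le\<close>). In particular covariances are summable, and the variance of a weighted
sum is at most a constant times the sum of the squared weights (\<open>variance_sum_le\<close>). Normality
comes from Bernstein's method. The at most \<open>n + 1\<close> points carrying weight are cut, in increasing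
order, into blocks of \<open>n\<^bsup>0.46\<^esup>\<close> points separated by discarded stretches of \<open>n\<^bsup>0.4\<^esup>\<close> points, and the
variables are truncated at level \<open>n\<^bsup>0.01\<^esup>\<close>. If all weights, after division by \<open>\<surd>n\<close>, are at most
\<open>n\<^bsup>-0.49\<^esup>\<close>, then
  \<^item> replacing the joint characteristic function of the blocks by the product costs a multiple
    of \<open>n\<^bsup>0.54\<^esup> n\<^bsup>-0.49\<^esup> n\<^bsup>0.46\<^esup> n\<^bsup>-0.6\<^esup> = n\<^bsup>-0.09\<^esup>\<close>;
  \<^item> the discarded points have total squared weight at most a multiple of \<open>n\<^bsup>0.94 - 0.98\<^esup>\<close>;
  \<^item> each truncated block sum is bounded by a multiple of \<open>n\<^bsup>-0.49 + 0.46 + 0.01\<^esup>\<close>, so its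
    characteristic function agrees with the Gaussian one up to a negligible multiple of its variance.
All three tend to zero, which gives \<open>weighted_sum_char_gauss\<close>: the characteristic function of the
weighted sum approaches that of a centred Gaussian variable of the same variance.

The walk. Three facts are needed for almost every path. The weights must be small: by
transience the number of returns to a site has a geometric tail, so that eventually
\<open>N\<^sub>n(x) \<le> n\<^bsup>0.01\<^esup>\<close> for all \<open>x\<close> (\<open>AE_visits_le\<close>). The squared weights must have a bounded sum, and
the variances must converge. Both quantities are averages
\<open>(1/n) \<Sum>k,l. c (S\<^sub>l - S\<^sub>k)\<close>, with \<open>c\<close> the indicator of \<open>0\<close> and the covariance
function of \<open>\<xi>\<close> respectively, and \<open>AE_pair_average\<close> shows that they converge to
\<open>2 \<Sum>x. G(0,x) c(x) - c(0)\<close>. There the pairs of times at distance at most \<open>L\<close> obey a strong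
law of large numbers, because their contribution is a stationary sequence of finite range, while
the remaining pairs are controlled, uniformly in \<open>n\<close>, by the maximal ergodic inequality for the
shift. For \<open>c\<close> the covariance function the limit is the variance \<open>\<sigma>\<^sup>2(f)\<close>, and Levy's continuity
theorem concludes.
\<close>

section \<open>Square integrable random variables\<close>

lemma (in prob_space) L2_product:
  fixes X Y :: "'a \<Rightarrow> real"
  assumes [measurable]: "X \<in> borel_measurable M" "Y \<in> borel_measurable M"
    and X: "integrable M (\<lambda>v. (X v)\<^sup>2)" and Y: "integrable M (\<lambda>v. (Y v)\<^sup>2)"
  shows "integrable M (\<lambda>v. X v * Y v)"
    and "\<bar>\<integral>v. X v * Y v \<partial>M\<bar> \<le> sqrt (\<integral>v. (X v)\<^sup>2 \<partial>M) * sqrt (\<integral>v. (Y v)\<^sup>2 \<partial>M)"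
proof -
  show I: "integrable M (\<lambda>v. X v * Y v)"
  proof (rule Bochner_Integration.integrable_bound)
    show "integrable M (\<lambda>v. (X v)\<^sup>2 + (Y v)\<^sup>2)" using X Y by simp
    show "AE v in M. norm (X v * Y v) \<le> norm ((X v)\<^sup>2 + (Y v)\<^sup>2)"
    proof (rule AE_I2)
      fix v
      have "2 * \<bar>X v\<bar> * \<bar>Y v\<bar> \<le> (X v)\<^sup>2 + (Y v)\<^sup>2"
        using sum_squares_bound[of "\<bar>X v\<bar>" "\<bar>Y v\<bar>"] by simp
      moreover have "\<bar>X v\<bar> * \<bar>Y v\<bar> \<ge> 0" by simp
      ultimately have "\<bar>X v\<bar> * \<bar>Y v\<bar> \<le> (X v)\<^sup>2 + (Y v)\<^sup>2" by linarith
      then show "norm (X v * Y v) \<le> norm ((X v)\<^sup>2 + (Y v)\<^sup>2)" by (simp add: abs_mult)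
    qed
  qed simp
  define A B C where "A = (\<integral>v. (X v)\<^sup>2 \<partial>M)" and "B = (\<integral>v. (Y v)\<^sup>2 \<partial>M)"
    and "C = (\<integral>v. X v * Y v \<partial>M)"
  have nn: "A \<ge> 0" "B \<ge> 0" by (simp_all add: A_def B_def)
  \<comment> \<open>The Gram matrix of \<open>X\<close> and \<open>Y\<close> is positive semidefinite.\<close>
  have q: "s\<^sup>2 * A + 2 * s * t * C + t\<^sup>2 * B \<ge> 0" for s t
  proof -
    have "0 \<le> (\<integral>v. (s * X v + t * Y v)\<^sup>2 \<partial>M)" by simp
    also have "\<dots> = (\<integral>v. s\<^sup>2 * (X v)\<^sup>2 + 2 * s * t * (X v * Y v) + t\<^sup>2 * (Y v)\<^sup>2 \<partial>M)"
      by (intro Bochner_Integration.integral_cong) (auto simp: power2_eq_square algebra_simps)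
    also have "\<dots> = s\<^sup>2 * A + 2 * s * t * C + t\<^sup>2 * B"
      using X Y I by (simp add: A_def B_def C_def)
    finally show ?thesis .
  qed
  have "C\<^sup>2 \<le> A * B"
  proof (cases "A = 0")
    case True
    have "C = 0"
    proof (rule ccontr)
      assume "C \<noteq> 0"
      have "2 * (- (B+1) / (2*C)) * 1 * C + B \<ge> 0" using q[of "- (B+1) / (2*C)" 1] True by simp
      then show False using \<open>C \<noteq> 0\<close> by (simp add: field_simps)
    qed
    then show ?thesis using True by simp
  next
    case False
    then have "A > 0" using nn by simp
    have "0 \<le> C\<^sup>2 * A - 2 * C * A * C + A\<^sup>2 * B" using q[of "-C" A] by (simp add: mult_ac)
    then have "A * C\<^sup>2 \<le> A * (A * B)" by (simp add: power2_eq_square algebra_simps)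
    then show ?thesis using \<open>A > 0\<close> by simp
  qed
  then have "sqrt (C\<^sup>2) \<le> sqrt (A * B)" by (rule real_sqrt_le_mono)
  then show "\<bar>\<integral>v. X v * Y v \<partial>M\<bar> \<le> sqrt (\<integral>v. (X v)\<^sup>2 \<partial>M) * sqrt (\<integral>v. (Y v)\<^sup>2 \<partial>M)"
    by (simp add: A_def B_def C_def real_sqrt_mult)
qed

context prob_space
begin

definition L2 :: "('a \<Rightarrow> real) \<Rightarrow> bool" where
  "L2 X \<longleftrightarrow> X \<in> borel_measurable M \<and> integrable M (\<lambda>v. (X v)\<^sup>2)"

abbreviation moment2 :: "('a \<Rightarrow> real) \<Rightarrow> real" where
  "moment2 X \<equiv> expectation (\<lambda>v. (X v)\<^sup>2)"

abbreviation l2norm :: "('a \<Rightarrow> real) \<Rightarrow> real" where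
  "l2norm X \<equiv> sqrt (moment2 X)"

lemma L2_measurable: "L2 X \<Longrightarrow> X \<in> borel_measurable M"
  by (simp add: L2_def)

lemma L2_integrable_mult: "L2 X \<Longrightarrow> L2 Y \<Longrightarrow> integrable M (\<lambda>v. X v * Y v)"
  unfolding L2_def by (intro L2_product(1)) auto

lemma L2_square: "L2 X \<Longrightarrow> integrable M (\<lambda>v. (X v)\<^sup>2)"
  by (simp add: L2_def)

lemma L2_integrable: "L2 X \<Longrightarrow> integrable M X"
  unfolding L2_def by (auto intro: square_integrable_imp_integrable)

lemma L2_cauchy_schwarz: "L2 X \<Longrightarrow> L2 Y \<Longrightarrow> \<bar>expectation (\<lambda>v. X v * Y v)\<bar> \<le> l2norm X * l2norm Y"
  unfolding L2_def by (intro L2_product(2)) auto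

lemma L2_dominated:
  assumes "X \<in> borel_measurable M" "L2 Y" "\<And>v. \<bar>X v\<bar> \<le> \<bar>Y v\<bar>"
  shows "L2 X"
  unfolding L2_def
proof
  show "integrable M (\<lambda>v. (X v)\<^sup>2)"
    by (rule Bochner_Integration.integrable_bound[OF L2_square[OF assms(2)]])
       (use assms in \<open>auto simp: abs_le_square_iff\<close>)
qed fact

lemma L2_const: "L2 (\<lambda>_. c)"
  by (simp add: L2_def)

lemma L2_cmult: "L2 X \<Longrightarrow> L2 (\<lambda>v. c * X v)"
  by (auto simp: L2_def power_mult_distrib)

lemma L2_add:
  assumes "L2 X" "L2 Y" shows "L2 (\<lambda>v. X v + Y v)"
proof -
  have "integrable M (\<lambda>v. (X v)\<^sup>2 + (Y v)\<^sup>2 + 2 * (X v * Y v))"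
    using assms L2_integrable_mult[OF assms] by (auto simp: L2_def)
  then show ?thesis using assms by (auto simp: L2_def power2_sum mult.assoc)
qed

lemma L2_diff: "L2 X \<Longrightarrow> L2 Y \<Longrightarrow> L2 (\<lambda>v. X v - Y v)"
  using L2_add[of X "\<lambda>v. (-1) * Y v"] L2_cmult[of Y "-1"] by simp

lemma L2_sum: "(\<And>i. i \<in> I \<Longrightarrow> L2 (X i)) \<Longrightarrow> L2 (\<lambda>v. \<Sum>i\<in>I. X i v)"
  by (induction I rule: infinite_finite_induct) (auto intro: L2_add L2_const)

lemma l2norm_triangle:
  assumes "L2 X" "L2 Y"
  shows "l2norm (\<lambda>v. X v + Y v) \<le> l2norm X + l2norm Y"
proof (rule real_le_lsqrt)
  have "expectation (\<lambda>v. (X v + Y v)\<^sup>2) = expectation (\<lambda>v. (X v)\<^sup>2 + (Y v)\<^sup>2 + 2 * (X v * Y v))"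
    by (intro Bochner_Integration.integral_cong) (auto simp: power2_sum)
  also have "\<dots> = moment2 X + moment2 Y + 2 * expectation (\<lambda>v. X v * Y v)"
    using L2_integrable_mult[OF assms] assms[THEN L2_square] by simp
  also have "\<dots> \<le> (l2norm X + l2norm Y)\<^sup>2"
    using L2_cauchy_schwarz[OF assms] by (simp add: power2_sum)
  finally show "expectation (\<lambda>v. (X v + Y v)\<^sup>2) \<le> (l2norm X + l2norm Y)\<^sup>2" .
qed simp

text \<open>
Write the difference of squares as \<open>(X - Y)(X + Y)\<close>: replacing a variable by an \<open>L\<^sup>2\<close>-close one
changes the variance little. This and the next estimate let small contributions to the
sum be dropped.
\<close>

lemma second_moment_diff_le:
  assumes "L2 X" "L2 Y"
  shows "\<bar>moment2 X - moment2 Y\<bar>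
     \<le> l2norm (\<lambda>v. X v - Y v) * (l2norm X + l2norm Y)"
proof -
  have "moment2 X - moment2 Y
      = expectation (\<lambda>v. (X v - Y v) * (X v + Y v))"
    using assms[THEN L2_square] 
    by (subst Bochner_Integration.integral_diff[symmetric]) 
       (auto intro!: Bochner_Integration.integral_cong simp: power2_eq_square algebra_simps)
  also have "\<bar>\<dots>\<bar> \<le> l2norm (\<lambda>v. X v - Y v) * l2norm (\<lambda>v. X v + Y v)"
    using assms by (intro L2_cauchy_schwarz L2_diff L2_add)
  also have "\<dots> \<le> l2norm (\<lambda>v. X v - Y v) * (l2norm X + l2norm Y)"
    by (intro mult_left_mono l2norm_triangle assms) simp
  finally show ?thesis .
qed

lemma abs_expectation_le_l2norm:
  assumes "L2 X" shows "expectation (\<lambda>v. \<bar>X v\<bar>) \<le> l2norm X"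
proof -
  have "L2 (\<lambda>v. \<bar>X v\<bar>)" using assms by (auto simp: L2_def)
  from L2_cauchy_schwarz[OF this L2_const[of 1]] show ?thesis by (simp add: prob_space)
qed

text \<open>
Among all constants, the mean is the one at smallest \<open>L\<^sup>2\<close> distance.
\<close>

lemma expectation_diff_const_sq:
  assumes "L2 X"
  shows "expectation (\<lambda>v. (X v - expectation X)\<^sup>2) \<le> moment2 X"
proof -
  have "expectation (\<lambda>v. (X v - expectation X)\<^sup>2) = moment2 X - (expectation X)\<^sup>2"
    using L2_integrable[OF assms] L2_square[OF assms] by (rule variance_eq)
  then show ?thesis by simp
qed

lemma lipschitz_measurable:
  fixes \<phi> :: "real \<Rightarrow> real"
  assumes "C-lipschitz_on UNIV \<phi>" shows "\<phi> \<in> borel_measurable borel"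
  using lipschitz_on_continuous_on[OF assms] by (rule borel_measurable_continuous_onI)

lemma L2_lipschitz:
  fixes \<phi> :: "real \<Rightarrow> real"
  assumes "1-lipschitz_on UNIV \<phi>" "L2 X" shows "L2 (\<lambda>v. \<phi> (X v))"
proof (rule L2_dominated)
  note [measurable] = lipschitz_measurable[OF assms(1)] L2_measurable[OF assms(2)]
  show "(\<lambda>v. \<phi> (X v)) \<in> borel_measurable M" by measurable
  have "L2 (\<lambda>v. \<bar>X v\<bar>)" using assms by (auto simp: L2_def)
  then show "L2 (\<lambda>v. \<bar>\<phi> 0\<bar> + \<bar>X v\<bar>)" by (intro L2_add L2_const)
  fix v show "\<bar>\<phi> (X v)\<bar> \<le> \<bar>\<bar>\<phi> 0\<bar> + \<bar>X v\<bar>\<bar>"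
    using lipschitz_onD[OF assms(1), of "X v" 0] by (simp add: dist_real_def)
qed

abbreviation cf :: "real \<Rightarrow> ('a \<Rightarrow> real) \<Rightarrow> complex" where
  "cf t X \<equiv> expectation (\<lambda>v. iexp (t * X v))"

text \<open>
Characteristic functions move by at most the \<open>L\<^sup>2\<close> distance, because \<open>s \<mapsto> e\<^bsup>its\<^esup>\<close> is
\<open>\<bar>t\<bar>\<close>-Lipschitz.
\<close>

lemma char_diff_le:
  assumes "L2 X" "L2 Y"
  shows "cmod (cf t X - cf t Y)
     \<le> \<bar>t\<bar> * l2norm (\<lambda>v. X v - Y v)"
proof -
  note [measurable] = assms[THEN L2_measurable]
  have i: "complex_integrable M (\<lambda>v. iexp (t * X v))" "complex_integrable M (\<lambda>v. iexp (t * Y v))"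
    by (auto intro!: integrable_const_bound[where B = 1])
  have d: "L2 (\<lambda>v. X v - Y v)" using assms by (rule L2_diff)
  have "cmod (cf t X - cf t Y)
      = cmod (expectation (\<lambda>v. iexp (t * X v) - iexp (t * Y v)))"
    using i by simp
  also have "\<dots> \<le> expectation (\<lambda>v. cmod (iexp (t * X v) - iexp (t * Y v)))"
    by (rule integral_norm_bound)
  also have "\<dots> \<le> expectation (\<lambda>v. \<bar>t\<bar> * \<bar>X v - Y v\<bar>)"
  proof (rule integral_mono)
    show "integrable M (\<lambda>v. cmod (iexp (t * X v) - iexp (t * Y v)))" using i by auto
    show "integrable M (\<lambda>v. \<bar>t\<bar> * \<bar>X v - Y v\<bar>)" using L2_integrable[OF d] by auto
    fix v
    have "iexp (t * X v) - iexp (t * Y v) = iexp (t * Y v) * (iexp (t * X v - t * Y v) - 1)"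
      by (simp add: right_diff_distrib exp_diff exp_minus field_simps)
    also have "cmod \<dots> = cmod (iexp (t * X v - t * Y v) - 1)" by (simp add: norm_mult)
    also have "\<dots> \<le> \<bar>t * X v - t * Y v\<bar>" using iexp_approx1[of "t * X v - t * Y v" 0] by simp
    also have "\<dots> = \<bar>t\<bar> * \<bar>X v - Y v\<bar>" by (simp add: abs_mult[symmetric] right_diff_distrib)
    finally show "cmod (iexp (t * X v) - iexp (t * Y v)) \<le> \<bar>t\<bar> * \<bar>X v - Y v\<bar>" .
  qed
  also have "\<dots> = \<bar>t\<bar> * expectation (\<lambda>v. \<bar>X v - Y v\<bar>)" by simp
  also have "\<dots> \<le> \<bar>t\<bar> * l2norm (\<lambda>v. X v - Y v)"
    by (intro mult_left_mono abs_expectation_le_l2norm d) simp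
  finally show ?thesis .
qed

text \<open>
Second order Taylor expansion of both sides. Boundedness trades the third absolute moment for
\<open>\<beta> V\<close>, so the error is proportional to \<open>V\<close> and can be summed over blocks.
\<close>

lemma char_bounded_gauss:
  assumes [measurable]: "U \<in> borel_measurable M" and \<beta>: "\<And>v. \<bar>U v\<bar> \<le> \<beta>"
    and E0: "expectation U = 0" and V: "V = moment2 U"
  shows "cmod (cf t U - exp (- (t\<^sup>2 * V / 2)))
     \<le> (\<bar>t\<bar> ^ 3 * \<beta> / 6 + t ^ 4 * \<beta>\<^sup>2 / 8) * V"
proof -
  have \<beta>0: "\<beta> \<ge> 0" using \<beta> order_trans[OF abs_ge_zero] by blast
  have i1: "integrable M U" using \<beta> by (intro integrable_const_bound[where B = \<beta>]) auto
  have sq: "(U v)\<^sup>2 \<le> \<beta>\<^sup>2" for v using \<beta>[of v] \<beta>0 by (metis abs_of_nonneg abs_le_square_iff)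
  have i2: "integrable M (\<lambda>v. (U v)\<^sup>2)" using sq by (intro integrable_const_bound[where B = "\<beta>\<^sup>2"]) auto
  have V0: "V \<ge> 0" "V \<le> \<beta>\<^sup>2"
    using sq integral_mono[OF i2, of "\<lambda>_. \<beta>\<^sup>2"] by (auto simp: V prob_space)
  have "cmod (char (distr M borel U) t - (1 - t\<^sup>2 * V / 2))
     \<le> (t\<^sup>2 / 6) * expectation (\<lambda>v. min (6 * (U v)\<^sup>2) (\<bar>t\<bar> * \<bar>U v\<bar> ^ 3))"
    by (rule char_approx3') (use i1 i2 E0 in \<open>auto simp: V\<close>)
  also have "\<dots> \<le> (t\<^sup>2 / 6) * expectation (\<lambda>v. \<bar>t\<bar> * \<beta> * (U v)\<^sup>2)"
  proof (intro mult_left_mono integral_mono)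
    show "integrable M (\<lambda>v. \<bar>t\<bar> * \<beta> * (U v)\<^sup>2)" using i2 by simp
    show "integrable M (\<lambda>v. min (6 * (U v)\<^sup>2) (\<bar>t\<bar> * \<bar>U v\<bar> ^ 3))"
      by (rule Bochner_Integration.integrable_bound[where f = "\<lambda>v. 6 * (U v)\<^sup>2"]) (use i2 in auto)
    fix v
    have "\<bar>U v\<bar> ^ 3 = \<bar>U v\<bar> * (U v)\<^sup>2" by (simp add: power3_eq_cube power2_eq_square)
    also have "\<dots> \<le> \<beta> * (U v)\<^sup>2" using \<beta> by (intro mult_right_mono) auto
    finally have "\<bar>t\<bar> * \<bar>U v\<bar> ^ 3 \<le> \<bar>t\<bar> * (\<beta> * (U v)\<^sup>2)" by (intro mult_left_mono) auto
    then show "min (6 * (U v)\<^sup>2) (\<bar>t\<bar> * \<bar>U v\<bar> ^ 3) \<le> \<bar>t\<bar> * \<beta> * (U v)\<^sup>2" by (simp add: mult.assoc)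
  qed simp
  also have "\<dots> = \<bar>t\<bar> ^ 3 * \<beta> / 6 * V" by (simp add: V power3_eq_cube power2_eq_square)
  finally have a: "cmod (char (distr M borel U) t - (1 - t\<^sup>2 * V / 2)) \<le> \<bar>t\<bar> ^ 3 * \<beta> / 6 * V" .
  define y where "y = t\<^sup>2 * V / 2"
  have y0: "y \<ge> 0" using V0 by (simp add: y_def)
  have "\<bar>exp (- y) - (1 - y)\<bar> \<le> y\<^sup>2 / 2"
  proof -
    have 1: "1 - y \<le> exp (- y)" using exp_ge_add_one_self[of "-y"] by simp
    have "exp (-y) - (1 - y) - y\<^sup>2 / 2 \<le> exp (-0) - (1 - 0) - 0\<^sup>2 / 2"
    proof (rule DERIV_nonpos_imp_nonincreasing[OF y0])
      fix x :: real assume "0 \<le> x"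
      show "\<exists>d. ((\<lambda>y. exp (-y) - (1 - y) - y\<^sup>2 / 2) has_real_derivative d) (at x) \<and> d \<le> 0"
        by (rule exI[of _ "- exp (-x) + 1 - x"])
           (use exp_ge_add_one_self[of "-x"] in \<open>auto intro!: derivative_eq_intros\<close>)
    qed
    then show ?thesis using 1 by simp
  qed
  moreover have "y\<^sup>2 / 2 = t ^ 4 / 8 * (V * V)" by (simp add: y_def power2_eq_square power4_eq_xxxx)
  moreover have "t ^ 4 / 8 * (V * V) \<le> t ^ 4 / 8 * (\<beta>\<^sup>2 * V)"
    using V0 by (intro mult_left_mono mult_right_mono) auto
  ultimately have b: "\<bar>exp (- y) - (1 - y)\<bar> \<le> t ^ 4 * \<beta>\<^sup>2 / 8 * V" by simp
  have "cmod (complex_of_real (1 - y) - complex_of_real (exp (- y))) = \<bar>exp (- y) - (1 - y)\<bar>"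
    by (metis norm_of_real of_real_diff abs_minus_commute)
  then have c: "cmod (complex_of_real (1 - y) - complex_of_real (exp (- y))) \<le> t ^ 4 * \<beta>\<^sup>2 / 8 * V"
    using b by simp
  have "cmod (char (distr M borel U) t - complex_of_real (exp (- y)))
     \<le> cmod (char (distr M borel U) t - complex_of_real (1 - y)) + cmod (complex_of_real (1 - y) - complex_of_real (exp (- y)))"
    by (metis norm_triangle_sub diff_add_cancel add_diff_eq norm_triangle_ineq)
  also have "\<dots> \<le> \<bar>t\<bar> ^ 3 * \<beta> / 6 * V + t ^ 4 * \<beta>\<^sup>2 / 8 * V"
    using a c by (intro add_mono) (auto simp: y_def)
  also have "\<dots> = (\<bar>t\<bar> ^ 3 * \<beta> / 6 + t ^ 4 * \<beta>\<^sup>2 / 8) * V" by (simp add: algebra_simps)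
  also have "char (distr M borel U) t = cf t U"
    unfolding char_def by (subst integral_distr) auto
  finally show ?thesis by (simp add: y_def)
qed

end

section \<open>From the dependence coefficient to covariances\<close>

lemma past_subalgebra:
  assumes "\<And>j. \<xi> j \<in> borel_measurable M"
  shows "subalgebra M (past M \<xi> p)"
proof -
  have "(\<Union>j\<in>{..p}. {\<xi> j -` A \<inter> space M |A. A \<in> sets borel}) \<subseteq> sets M"
    using assms by (auto intro: measurable_sets)
  then show ?thesis
    unfolding subalgebra_def past_def
    by (auto intro!: sets.sigma_sets_subset simp: space_measure_of_conv)
       (metis (no_types, lifting) sets.sigma_sets_subset sets_measure_of_conv subsetD sets.space_closed
         order_trans Un_iff insertE empty_iff)
qed

lemma measurable_past:
  assumes "j \<le> p"
  shows "\<xi> j \<in> borel_measurable (past M \<xi> p)"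
proof (rule measurableI)
  fix A :: "real set" assume "A \<in> sets borel"
  let ?G = "\<Union>j\<in>{..p}. {\<xi> j -` A \<inter> space M |A. A \<in> sets borel}"
  have sub: "?G \<subseteq> Pow (space M)" by auto
  have "\<xi> j -` A \<inter> space M \<in> ?G" using assms \<open>A \<in> sets borel\<close> by blast
  then show "\<xi> j -` A \<inter> space (past M \<xi> p) \<in> sets (past M \<xi> p)"
    unfolding past_def using sub by (simp add: sets_measure_of space_measure_of_conv)
qed simp

text \<open>
Unfolds the two suprema. The division by the number \<open>l\<close> of variables in the coefficient
becomes a factor \<open>l\<close> here.
\<close>

lemma theta2_le_of_coeff:
  assumes \<theta>: "theta2_coeff M \<xi> n \<le> ennreal G" and "G \<ge> 0" and l: "l \<ge> 1"
    and j: "p + int n \<le> j 0" "strict_mono_on {..<l} j" and h: "h \<in> Lip1 l"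
  shows "norm2 M (\<lambda>v. real_cond_exp M (past M \<xi> p) (\<lambda>v'. h (\<lambda>i\<in>{..<l}. \<xi> (j i) v')) v
           - (\<integral>v'. h (\<lambda>i\<in>{..<l}. \<xi> (j i) v') \<partial>M)) \<le> ennreal (G * real l)"
    (is "?N \<le> _")
proof -
  let ?th = "theta2 M (past M \<xi> p) l (\<lambda>v. \<lambda>i\<in>{..<l}. \<xi> (j i) v)"
  have "?th \<le> (SUP (p, j) \<in> {(p::int, j::nat \<Rightarrow> int). p + int n \<le> j 0 \<and> strict_mono_on {..<l} j}.
           theta2 M (past M \<xi> p) l (\<lambda>v. \<lambda>i\<in>{..<l}. \<xi> (j i) v))"
    by (rule SUP_upper2[where i = "(p, j)"]) (use j in auto)
  then have "?th / of_nat l \<le> theta2_coeff M \<xi> n"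
    unfolding theta_coeff_def
    by (intro SUP_upper2[where i = l]) (use l in \<open>auto intro!: divide_right_mono_ennreal\<close>)
  then have "?th / of_nat l \<le> ennreal G" using \<theta> by (rule order_trans)
  then have "?th / of_nat l * of_nat l \<le> ennreal G * of_nat l"
    by (rule mult_right_mono) simp
  also have "?th / of_nat l * of_nat l = ?th"
    using l by (subst ennreal_divide_times)
      (simp add: ennreal_divide_self ennreal_of_nat_eq_real_of_nat ennreal_zero_less_divide)
  also have "ennreal G * of_nat l = ennreal (G * real l)"
    using \<open>G \<ge> 0\<close> by (simp add: ennreal_mult ennreal_of_nat_eq_real_of_nat)
  finally have "?th \<le> ennreal (G * real l)" .
  moreover have "?N \<le> ?th" unfolding theta2_def using h by (rule SUP_upper2) simp
  ultimately show ?thesis by (rule order_trans[rotated])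
qed

lemma norm2_le_imp:
  assumes "norm2 M Z \<le> ennreal c" "c \<ge> 0"
  shows "integrable M (\<lambda>v. (Z v)\<^sup>2)" "sqrt (\<integral>v. (Z v)\<^sup>2 \<partial>M) \<le> c"
proof -
  show *: "integrable M (\<lambda>v. (Z v)\<^sup>2)"
    using assms(1) unfolding norm2_def by (auto split: if_splits simp: top_unique)
  show "sqrt (\<integral>v. (Z v)\<^sup>2 \<partial>M) \<le> c"
    using assms * unfolding norm2_def by (auto split: if_splits simp: ennreal_le_iff)
qed

text \<open>
The covariance equals \<open>E (W (E(Z | past) - E Z))\<close>; the Cauchy--Schwarz inequality brings in the
\<open>L\<^sup>2\<close> norm of the second factor, which \<open>\<theta>\<^sub>2\<close> controls.
\<close>

lemma cov_le_theta2:
  assumes "prob_space M" and \<xi>[measurable]: "\<And>j. \<xi> j \<in> borel_measurable M"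
    and \<theta>: "theta2_coeff M \<xi> n \<le> ennreal G" and "G \<ge> 0" and l: "l \<ge> 1"
    and j: "p + int n \<le> j 0" "strict_mono_on {..<l} j" and h: "h \<in> Lip1 l"
    and Zdef: "\<And>v. Z v = h (\<lambda>i\<in>{..<l}. \<xi> (j i) v)"
    and Zm[measurable]: "Z \<in> borel_measurable M" and Z: "integrable M (\<lambda>v. (Z v)\<^sup>2)"
    and Wm: "W \<in> borel_measurable (past M \<xi> p)" and W: "integrable M (\<lambda>v. (W v)\<^sup>2)"
  shows "\<bar>(\<integral>v. W v * Z v \<partial>M) - (\<integral>v. W v \<partial>M) * (\<integral>v. Z v \<partial>M)\<bar>
     \<le> sqrt (\<integral>v. (W v)\<^sup>2 \<partial>M) * (G * real l)"
proof -
  interpret prob_space M by fact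
  have sub: "subalgebra M (past M \<xi> p)" by (rule past_subalgebra) (rule \<xi>)
  interpret F: finite_measure_subalgebra M "past M \<xi> p"
    by unfold_locales (rule sub)
  have [measurable]: "W \<in> borel_measurable M" by (rule measurable_from_subalg[OF sub Wm])
  let ?c = "real_cond_exp M (past M \<xi> p) Z"
  let ?D = "\<lambda>v. ?c v - (\<integral>v. Z v \<partial>M)"
  have Zeq: "Z = (\<lambda>v. h (\<lambda>i\<in>{..<l}. \<xi> (j i) v))" using Zdef by auto
  have "norm2 M ?D \<le> ennreal (G * real l)"
    using theta2_le_of_coeff[OF \<theta> \<open>G \<ge> 0\<close> l j h] unfolding Zeq .
  note D = norm2_le_imp[OF this]
  have GL: "G * real l \<ge> 0" using \<open>G \<ge> 0\<close> by simp
  have WZ: "integrable M (\<lambda>v. W v * Z v)" by (rule L2_product(1)) (use W Z in auto)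
  have iW: "integrable M W" by (rule square_integrable_imp_integrable) (use W in auto)
  note CE = F.real_cond_exp_intg[OF WZ Wm Zm]
  have [measurable]: "?c \<in> borel_measurable M" by simp
  have "(\<integral>v. W v * Z v \<partial>M) - (\<integral>v. W v \<partial>M) * (\<integral>v. Z v \<partial>M) = (\<integral>v. W v * ?D v \<partial>M)"
    using CE iW by (simp add: right_diff_distrib)
  also have "\<bar>\<dots>\<bar> \<le> sqrt (\<integral>v. (W v)\<^sup>2 \<partial>M) * sqrt (\<integral>v. (?D v)\<^sup>2 \<partial>M)"
    by (rule L2_product(2)) (use W D(1)[OF GL] in auto)
  also have "\<dots> \<le> sqrt (\<integral>v. (W v)\<^sup>2 \<partial>M) * (G * real l)"
    by (intro mult_left_mono D(2) GL) simp
  finally show ?thesis .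
qed

text \<open>
A given distance from \<open>x\<close> is attained by at most one point on each side of \<open>x\<close>, hence the factor \<open>2\<close>.
\<close>

lemma sum_gap_le_suminf:
  fixes \<gamma> :: "nat \<Rightarrow> real"
  assumes "finite A" and \<gamma>: "\<And>r. \<gamma> r \<ge> 0" and sm: "summable (\<lambda>r. \<gamma> (r + q))"
  shows "(\<Sum>y\<in>A. if q \<le> nat \<bar>x - y\<bar> then \<gamma> (nat \<bar>x - y\<bar>) else 0) \<le> 2 * (\<Sum>r. \<gamma> (r + q))"
proof -
  have one: "(\<Sum>y\<in>B. \<gamma> (nat \<bar>x - y\<bar>)) \<le> (\<Sum>r. \<gamma> (r + q))"
    if "finite B" "inj_on (\<lambda>y. nat \<bar>x - y\<bar>) B" "\<And>y. y \<in> B \<Longrightarrow> q \<le> nat \<bar>x - y\<bar>" for B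
  proof -
    have inj: "inj_on (\<lambda>y. nat \<bar>x - y\<bar> - q) B"
      using that(2,3) by (auto simp: inj_on_def) (metis le_add_diff_inverse2)
    have "(\<Sum>y\<in>B. \<gamma> (nat \<bar>x - y\<bar>)) = (\<Sum>r\<in>(\<lambda>y. nat \<bar>x - y\<bar> - q) ` B. \<gamma> (r + q))"
      using that(3) by (subst sum.reindex[OF inj]) (auto intro!: sum.cong)
    also have "\<dots> \<le> (\<Sum>r. \<gamma> (r + q))"
      using that(1) by (intro sum_le_suminf[OF sm]) (auto simp: \<gamma>)
    finally show ?thesis .
  qed
  let ?A = "{y\<in>A. q \<le> nat \<bar>x - y\<bar>}"
  have "(\<Sum>y\<in>A. if q \<le> nat \<bar>x - y\<bar> then \<gamma> (nat \<bar>x - y\<bar>) else 0) = (\<Sum>y\<in>?A. \<gamma> (nat \<bar>x - y\<bar>))"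
    using \<open>finite A\<close> by (simp add: sum.If_cases Int_def)
  also have "?A = {y\<in>?A. x \<le> y} \<union> {y\<in>?A. y < x}" by auto
  also have "(\<Sum>y\<in>\<dots>. \<gamma> (nat \<bar>x - y\<bar>))
     = (\<Sum>y\<in>{y\<in>?A. x \<le> y}. \<gamma> (nat \<bar>x - y\<bar>)) + (\<Sum>y\<in>{y\<in>?A. y < x}. \<gamma> (nat \<bar>x - y\<bar>))"
    using \<open>finite A\<close> by (intro sum.union_disjoint) auto
  also have "\<dots> \<le> (\<Sum>r. \<gamma> (r + q)) + (\<Sum>r. \<gamma> (r + q))"
    by (intro add_mono one) (use \<open>finite A\<close> in \<open>auto simp: inj_on_def\<close>)
  finally show ?thesis by simp
qed

text \<open>
Schur's test for a kernel that depends only on the distance: bound the product of two weights by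
the mean of their squares and sum over the other point first.
\<close>

lemma sum_pairs_gap_le:
  fixes \<gamma> :: "nat \<Rightarrow> real" and b :: "int \<Rightarrow> real"
  assumes A: "finite A" and \<gamma>: "\<And>r. \<gamma> r \<ge> 0" and sm: "summable (\<lambda>r. \<gamma> (r + q))"
  shows "(\<Sum>x\<in>A. \<Sum>y\<in>A. if q \<le> nat \<bar>x - y\<bar> then \<bar>b x\<bar> * \<bar>b y\<bar> * \<gamma> (nat \<bar>x - y\<bar>) else 0)
     \<le> (\<Sum>x\<in>A. (b x)\<^sup>2) * (2 * (\<Sum>r. \<gamma> (r + q)))"
proof -
  define k where "k x y = (if q \<le> nat \<bar>x - y\<bar> then \<gamma> (nat \<bar>x - y\<bar>) else 0)" for x y :: int
  have k0: "k x y \<ge> 0" and ks: "k x y = k y x" for x y 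
    by (auto simp: k_def \<gamma> abs_minus_commute)
  have kle: "(\<Sum>y\<in>A. k x y) \<le> 2 * (\<Sum>r. \<gamma> (r + q))" for x
    unfolding k_def by (rule sum_gap_le_suminf[OF A \<gamma> sm])
  have "(\<Sum>x\<in>A. \<Sum>y\<in>A. if q \<le> nat \<bar>x - y\<bar> then \<bar>b x\<bar> * \<bar>b y\<bar> * \<gamma> (nat \<bar>x - y\<bar>) else 0)
      = (\<Sum>x\<in>A. \<Sum>y\<in>A. \<bar>b x\<bar> * \<bar>b y\<bar> * k x y)"
    by (intro sum.cong) (auto simp: k_def)
  also have "\<dots> \<le> (\<Sum>x\<in>A. \<Sum>y\<in>A. (b x)\<^sup>2 / 2 * k x y + (b y)\<^sup>2 / 2 * k x y)"
  proof (intro sum_mono)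
    fix x y
    have "\<bar>b x\<bar> * \<bar>b y\<bar> \<le> (b x)\<^sup>2 / 2 + (b y)\<^sup>2 / 2"
      using sum_squares_bound[of "\<bar>b x\<bar>" "\<bar>b y\<bar>"] by simp
    from mult_right_mono[OF this k0[of x y]]
    show "\<bar>b x\<bar> * \<bar>b y\<bar> * k x y \<le> (b x)\<^sup>2 / 2 * k x y + (b y)\<^sup>2 / 2 * k x y"
      by (simp add: distrib_right)
  qed
  also have "\<dots> = (\<Sum>x\<in>A. \<Sum>y\<in>A. (b x)\<^sup>2 / 2 * k x y) + (\<Sum>x\<in>A. \<Sum>y\<in>A. (b y)\<^sup>2 / 2 * k x y)"
    by (simp add: sum.distrib)
  also have "(\<Sum>x\<in>A. \<Sum>y\<in>A. (b y)\<^sup>2 / 2 * k x y) = (\<Sum>x\<in>A. \<Sum>y\<in>A. (b x)\<^sup>2 / 2 * k x y)"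
    by (subst sum.swap) (simp add: ks[symmetric])
  also have "(\<Sum>x\<in>A. \<Sum>y\<in>A. (b x)\<^sup>2 / 2 * k x y) + (\<Sum>x\<in>A. \<Sum>y\<in>A. (b x)\<^sup>2 / 2 * k x y)
      = (\<Sum>x\<in>A. (b x)\<^sup>2 * (\<Sum>y\<in>A. k x y))"
    by (simp add: sum.distrib[symmetric] sum_distrib_left sum_distrib_right mult.commute)
  also have "\<dots> \<le> (\<Sum>x\<in>A. (b x)\<^sup>2 * (2 * (\<Sum>r. \<gamma> (r + q))))"
    by (intro sum_mono mult_left_mono kle) simp
  finally show ?thesis by (simp add: sum_distrib_right)
qed

text \<open>
The common law makes all variance bounds uniform in the index. The decay exponent \<open>3/2\<close> makes the
covariances summable and leaves room for the choice of block lengths in Bernstein's method.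
\<close>

locale theta_decaying = prob_space M for M :: "'a measure" +
  fixes \<xi> :: "int \<Rightarrow> 'a \<Rightarrow> real" and C :: real
  assumes \<xi>_meas[measurable]: "\<xi> x \<in> borel_measurable M"
    and \<xi>_distr: "distr M borel (\<xi> x) = distr M borel (\<xi> 0)"
    and \<xi>_sq: "integrable M (\<lambda>v. (\<xi> 0 v)\<^sup>2)"
    and C_nonneg: "C \<ge> 0"
    and theta: "n \<ge> 1 \<Longrightarrow> theta2_coeff M \<xi> n \<le> ennreal (C * real n powr (-3/2))"
begin

lemma expectation_\<xi>:
  fixes \<phi> :: "real \<Rightarrow> real"
  assumes [measurable]: "\<phi> \<in> borel_measurable borel"
  shows "expectation (\<lambda>v. \<phi> (\<xi> x v)) = expectation (\<lambda>v. \<phi> (\<xi> 0 v))"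
proof -
  have "expectation (\<lambda>v. \<phi> (\<xi> x v)) = integral\<^sup>L (distr M borel (\<xi> x)) \<phi>" for x
    by (subst integral_distr) auto
  then show ?thesis by (simp add: \<xi>_distr[of x])
qed

lemma L2_\<xi>: "L2 (\<xi> x)"
proof -
  have "integrable (distr M borel (\<xi> x)) (\<lambda>r. r\<^sup>2)"
    using \<xi>_sq by (subst \<xi>_distr) (simp add: integrable_distr_eq)
  then show ?thesis by (simp add: L2_def integrable_distr_eq)
qed

lemma L2_lip_\<xi>: "1-lipschitz_on UNIV \<phi> \<Longrightarrow> L2 (\<lambda>v. \<phi> (\<xi> x v))"
  by (rule L2_lipschitz[OF _ L2_\<xi>])

text \<open>
The form in which the dependence coefficient is used: the block enters through a Lipschitz
function of a weighted sum, such as the sine or cosine of the sum. Dividing by the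
bound \<open>\<kappa>\<close> on the weights turns it into a member of \<open>Lip1\<close>, and the points of \<open>J\<close> in increasing order are the
indices of the block.
\<close>

lemma cov_past_block_le:
  fixes \<phi> \<psi> :: "real \<Rightarrow> real"
  assumes J: "finite J" "J \<noteq> {}" "\<And>x. x \<in> J \<Longrightarrow> p + int n \<le> x" and n: "n \<ge> 1"
    and \<phi>: "1-lipschitz_on UNIV \<phi>" and \<psi>: "1-lipschitz_on UNIV \<psi>"
    and c: "\<And>x. x \<in> J \<Longrightarrow> \<bar>c x\<bar> \<le> \<kappa>" and \<kappa>: "\<kappa> > 0"
    and Wm: "W \<in> borel_measurable (past M \<xi> p)" and W: "integrable M (\<lambda>v. (W v)\<^sup>2)"
  defines "Z \<equiv> \<lambda>v. \<psi> (\<Sum>x\<in>J. c x * \<phi> (\<xi> x v))"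
  shows "\<bar>expectation (\<lambda>v. W v * Z v) - expectation W * expectation Z\<bar>
     \<le> l2norm W * (\<kappa> * real (card J) * (C * real n powr (-3/2)))"
proof -
  define j where "j i = sorted_list_of_set J ! i" for i
  let ?l = "card J"
  have l1: "?l \<ge> 1" using J by (simp add: Suc_le_eq card_gt_0_iff)
  have mono: "strict_mono_on {..<?l} j"
    unfolding j_def strict_mono_on_def
    using strict_sorted_list_of_set[of J] by (auto simp: sorted_wrt_iff_nth_less)
  have bij: "bij_betw j {..<?l} J"
    unfolding j_def by (rule bij_betw_nth) (use J in auto)
  have jJ: "j i \<in> J" if "i < ?l" for i using bij that by (auto simp: bij_betw_def)
  define h where "h y = \<psi> (\<Sum>i<?l. c (j i) * \<phi> (y i)) / \<kappa>" for y :: "nat \<Rightarrow> real"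
  have hL: "h \<in> Lip1 ?l"
    unfolding Lip1_def
  proof (intro CollectI ballI)
    fix y z :: "nat \<Rightarrow> real"
    have "\<bar>h y - h z\<bar> = \<bar>\<psi> (\<Sum>i<?l. c (j i) * \<phi> (y i)) - \<psi> (\<Sum>i<?l. c (j i) * \<phi> (z i))\<bar> / \<kappa>"
      using \<kappa> by (simp add: h_def diff_divide_distrib[symmetric])
    also have "\<dots> \<le> \<bar>(\<Sum>i<?l. c (j i) * \<phi> (y i)) - (\<Sum>i<?l. c (j i) * \<phi> (z i))\<bar> / \<kappa>"
      using lipschitz_onD[OF \<psi>] \<kappa> by (intro divide_right_mono) (auto simp: dist_real_def)
    also have "\<dots> = \<bar>\<Sum>i<?l. c (j i) * (\<phi> (y i) - \<phi> (z i))\<bar> / \<kappa>"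
      by (simp add: sum_subtractf[symmetric] right_diff_distrib)
    also have "\<dots> \<le> (\<Sum>i<?l. \<kappa> * \<bar>y i - z i\<bar>) / \<kappa>"
    proof (intro divide_right_mono order_trans[OF sum_abs] sum_mono)
      fix i assume "i \<in> {..<?l}"
      then have "\<bar>c (j i)\<bar> \<le> \<kappa>" using c jJ by auto
      moreover have "\<bar>\<phi> (y i) - \<phi> (z i)\<bar> \<le> \<bar>y i - z i\<bar>"
        using lipschitz_onD[OF \<phi>, of "y i" "z i"] by (auto simp: dist_real_def)
      ultimately show "\<bar>c (j i) * (\<phi> (y i) - \<phi> (z i))\<bar> \<le> \<kappa> * \<bar>y i - z i\<bar>"
        unfolding abs_mult using \<kappa> by (intro mult_mono) auto
    qed (use \<kappa> in auto)
    also have "\<dots> = d1 ?l y z" using \<kappa> by (simp add: d1_def sum_distrib_left[symmetric])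
    finally show "\<bar>h y - h z\<bar> \<le> d1 ?l y z" .
  qed
  have Zh: "Z v / \<kappa> = h (\<lambda>i\<in>{..<?l}. \<xi> (j i) v)" for v
    unfolding Z_def h_def by (subst sum.reindex_bij_betw[OF bij, symmetric]) simp
  have "L2 (\<lambda>v. \<Sum>x\<in>J. c x * \<phi> (\<xi> x v))"
    by (intro L2_sum L2_cmult L2_lip_\<xi> \<phi>)
  then have "L2 Z" unfolding Z_def by (rule L2_lipschitz[OF \<psi>])
  then have LZ: "L2 (\<lambda>v. Z v / \<kappa>)" using L2_cmult[of Z "1 / \<kappa>"] by simp
  have "p + int n \<le> j 0" using J(3) jJ[of 0] l1 by auto
  from cov_le_theta2[OF prob_space_axioms \<xi>_meas theta[OF n] _ l1 this mono hL Zh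
        L2_measurable[OF LZ] L2_square[OF LZ] Wm W]
  have "\<bar>expectation (\<lambda>v. W v * (Z v / \<kappa>)) - expectation W * expectation (\<lambda>v. Z v / \<kappa>)\<bar>
     \<le> l2norm W * (C * real n powr (-3/2) * real ?l)" using C_nonneg by simp
  also have "\<bar>expectation (\<lambda>v. W v * (Z v / \<kappa>)) - expectation W * expectation (\<lambda>v. Z v / \<kappa>)\<bar>
     = \<bar>expectation (\<lambda>v. W v * Z v) - expectation W * expectation Z\<bar> / \<kappa>"
    using \<kappa> by (simp add: diff_divide_distrib[symmetric])
  finally show ?thesis using \<kappa> by (simp add: divide_le_eq mult_ac)
qed

text \<open>
Bounds covariances at distance \<open>r\<close> when \<open>s\<close> bounds the \<open>L\<^sup>2\<close> norm of the variables. Since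
\<open>0 powr a = 0\<close>, the second summand vanishes at \<open>r = 0\<close>, where the variance bound \<open>s\<^sup>2\<close> takes over.
\<close>

definition cov_bound :: "real \<Rightarrow> nat \<Rightarrow> real" where
  "cov_bound s r = (if r = 0 then s\<^sup>2 else 0) + s * C * real r powr (-3/2)"

lemma cov_bound_nonneg: "s \<ge> 0 \<Longrightarrow> cov_bound s r \<ge> 0"
  using C_nonneg by (simp add: cov_bound_def)

lemma summable_cov_bound: "summable (\<lambda>r. cov_bound s (r + q))"
proof -
  have "summable (\<lambda>r. real r powr (-3/2))" by (subst summable_real_powr_iff) simp
  then have "summable (\<lambda>r. s * C * real r powr (-3/2))" by (rule summable_mult)
  moreover have "summable (\<lambda>r. if r = 0 then s\<^sup>2 else (0::real))"
    by (rule summable_finite[of "{0}"]) auto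
  ultimately have "summable (\<lambda>r. cov_bound s r)" unfolding cov_bound_def by (intro summable_add)
  then show ?thesis by (subst summable_iff_shift)
qed

text \<open>
For \<open>x < y\<close> the variable at \<open>x\<close> belongs to the past and the one at \<open>y\<close> is a block of length one.
\<close>

lemma cov_le_cov_bound:
  assumes \<eta>: "1-lipschitz_on UNIV \<eta>" and E0: "expectation (\<lambda>v. \<eta> (\<xi> 0 v)) = 0"
    and s: "l2norm (\<lambda>v. \<eta> (\<xi> 0 v)) \<le> s"
  shows "\<bar>expectation (\<lambda>v. \<eta> (\<xi> x v) * \<eta> (\<xi> y v))\<bar> \<le> cov_bound s (nat \<bar>x - y\<bar>)"
proof -
  note [measurable] = lipschitz_measurable[OF \<eta>]
  have s0: "s \<ge> 0" by (rule order_trans[OF _ s]) simp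
  have E0': "expectation (\<lambda>v. \<eta> (\<xi> x v)) = 0" for x using E0 expectation_\<xi>[of \<eta> x] by simp
  have S: "expectation (\<lambda>v. (\<eta> (\<xi> x v))\<^sup>2) = expectation (\<lambda>v. (\<eta> (\<xi> 0 v))\<^sup>2)" for x
    by (rule expectation_\<xi>) simp
  have lt: "\<bar>expectation (\<lambda>v. \<eta> (\<xi> x v) * \<eta> (\<xi> y v))\<bar> \<le> cov_bound s (nat \<bar>x - y\<bar>)" if "x < y" for x y
  proof -
    have "\<bar>expectation (\<lambda>v. \<eta> (\<xi> x v) * (\<Sum>z\<in>{y}. 1 * \<eta> (\<xi> z v))) - expectation (\<lambda>v. \<eta> (\<xi> x v))
           * expectation (\<lambda>v. (\<Sum>z\<in>{y}. 1 * \<eta> (\<xi> z v)))\<bar>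
      \<le> l2norm (\<lambda>v. \<eta> (\<xi> x v)) * (1 * real (card {y}) * (C * real (nat (y - x)) powr (-3/2)))"
    proof (rule cov_past_block_le[where \<psi> = "\<lambda>x. x"  and p = x])
      show "1-lipschitz_on UNIV (\<lambda>x::real. x)" by (rule lipschitz_intros)
      have "\<xi> x \<in> borel_measurable (past M \<xi> x)" by (rule measurable_past) simp
      then show "(\<lambda>v. \<eta> (\<xi> x v)) \<in> borel_measurable (past M \<xi> x)" by measurable
      show "integrable M (\<lambda>v. (\<eta> (\<xi> x v))\<^sup>2)" by (intro L2_square L2_lip_\<xi> \<eta>)
    qed (use \<eta> that in auto)
    also have "\<dots> \<le> s * (1 * real (card {y}) * (C * real (nat (y - x)) powr (-3/2)))"
      using s C_nonneg by (intro mult_right_mono) (auto simp: S[of x])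
    finally show ?thesis using that by (simp add: E0' cov_bound_def)
  qed
  show ?thesis
  proof (cases x y rule: linorder_cases)
    case equal
    have "expectation (\<lambda>v. (\<eta> (\<xi> 0 v))\<^sup>2) \<le> s\<^sup>2" using s s0 by (metis real_sqrt_le_iff real_sqrt_unique)
    then show ?thesis using equal S[of y] s0 C_nonneg by (simp add: cov_bound_def power2_eq_square)
  next
    case greater
    then show ?thesis using lt[of y x] by (simp add: mult.commute abs_minus_commute)
  qed (use lt in auto)
qed

definition var_const :: "real \<Rightarrow> real" where
  "var_const s = 2 * (\<Sum>r. cov_bound s r)"

text \<open>
Diagonal and off-diagonal terms are treated together by Schur's test; \<open>var_const s\<close> tends to \<open>0\<close>
with \<open>s\<close>, so a truncation error that is small for one variable is small for all weighted sums.
\<close>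

lemma variance_sum_le:
  assumes A: "finite A"
    and \<eta>: "1-lipschitz_on UNIV \<eta>" and E0: "expectation (\<lambda>v. \<eta> (\<xi> 0 v)) = 0"
    and s: "l2norm (\<lambda>v. \<eta> (\<xi> 0 v)) \<le> s"
  shows "expectation (\<lambda>v. (\<Sum>x\<in>A. b x * \<eta> (\<xi> x v))\<^sup>2) \<le> (\<Sum>x\<in>A. (b x)\<^sup>2) * var_const s"
proof -
  have s0: "s \<ge> 0" by (rule order_trans[OF _ s]) simp
  have i: "integrable M (\<lambda>v. \<eta> (\<xi> x v) * \<eta> (\<xi> y v))" for x y
    by (intro L2_integrable_mult L2_lip_\<xi> \<eta>)
  have "expectation (\<lambda>v. (\<Sum>x\<in>A. b x * \<eta> (\<xi> x v))\<^sup>2)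
     = expectation (\<lambda>v. \<Sum>x\<in>A. \<Sum>y\<in>A. b x * b y * (\<eta> (\<xi> x v) * \<eta> (\<xi> y v)))"
    by (intro Bochner_Integration.integral_cong)
       (auto simp: power2_eq_square sum_product mult_ac)
  also have "\<dots> = (\<Sum>x\<in>A. \<Sum>y\<in>A. b x * b y * expectation (\<lambda>v. \<eta> (\<xi> x v) * \<eta> (\<xi> y v)))"
    using i by (subst Bochner_Integration.integral_sum, force, subst Bochner_Integration.integral_sum) auto
  also have "\<dots> \<le> (\<Sum>x\<in>A. \<Sum>y\<in>A. if 0 \<le> nat \<bar>x - y\<bar> then \<bar>b x\<bar> * \<bar>b y\<bar> * cov_bound s (nat \<bar>x - y\<bar>) else 0)"
  proof (intro sum_mono)
    fix x y
    have "b x * b y * expectation (\<lambda>v. \<eta> (\<xi> x v) * \<eta> (\<xi> y v))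
       \<le> \<bar>b x\<bar> * \<bar>b y\<bar> * \<bar>expectation (\<lambda>v. \<eta> (\<xi> x v) * \<eta> (\<xi> y v))\<bar>"
      by (metis abs_ge_self abs_mult)
    also have "\<dots> \<le> \<bar>b x\<bar> * \<bar>b y\<bar> * cov_bound s (nat \<bar>x - y\<bar>)"
      by (intro mult_left_mono cov_le_cov_bound \<eta> E0 s) simp
    finally show "b x * b y * expectation (\<lambda>v. \<eta> (\<xi> x v) * \<eta> (\<xi> y v))
      \<le> (if 0 \<le> nat \<bar>x - y\<bar> then \<bar>b x\<bar> * \<bar>b y\<bar> * cov_bound s (nat \<bar>x - y\<bar>) else 0)" by simp
  qed
  also have "\<dots> \<le> (\<Sum>x\<in>A. (b x)\<^sup>2) * (2 * (\<Sum>r. cov_bound s (r + 0)))"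
    by (rule sum_pairs_gap_le[OF A cov_bound_nonneg[OF s0] summable_cov_bound])
  finally show ?thesis by (simp add: var_const_def)
qed

end

section \<open>Decoupling of separated blocks\<close>

lemma lipschitz_cos: "1-lipschitz_on UNIV (cos :: real \<Rightarrow> real)"
  by (rule bounded_derivative_imp_lipschitz[where f' = "\<lambda>x y. - sin x * y"])
     (auto intro!: derivative_eq_intros onorm_le mult_left_le_one_le simp: has_field_derivative_def abs_mult)

lemma lipschitz_sin: "1-lipschitz_on UNIV (sin :: real \<Rightarrow> real)"
  by (rule bounded_derivative_imp_lipschitz[where f' = "\<lambda>x y. cos x * y"])
     (auto intro!: derivative_eq_intros onorm_le mult_left_le_one_le simp: has_field_derivative_def abs_mult)

lemma (in prob_space) expectation_iexp:
  assumes [measurable]: "X \<in> borel_measurable M"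
  shows "expectation (\<lambda>v. iexp (X v)) = Complex (expectation (\<lambda>v. cos (X v))) (expectation (\<lambda>v. sin (X v)))"
proof -
  have i: "complex_integrable M (\<lambda>v. iexp (X v))"
    by (auto intro!: integrable_const_bound[where B = 1])
  show ?thesis
    by (rule complex_eqI) (simp_all add: integral_Re[OF i, symmetric] integral_Im[OF i, symmetric] Re_exp Im_exp)
qed

lemma (in prob_space) cmod_expectation_iexp_le_1:
  assumes "X \<in> borel_measurable M"
  shows "cmod (expectation (\<lambda>v. iexp (X v))) \<le> 1"
proof -
  have "cmod (expectation (\<lambda>v. iexp (X v))) \<le> expectation (\<lambda>v. cmod (iexp (X v)))"
    by (rule integral_norm_bound)
  then show ?thesis by (simp add: prob_space)
qed

context theta_decaying
begin

text \<open>
By the addition formulas, the difference of characteristic functions is made of four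
covariances between the sine or cosine of \<open>t W\<close>, which is bounded by \<open>1\<close>, and the sine or
cosine of \<open>t U\<close>, which is Lipschitz.
\<close>

lemma char_decouple_step:
  assumes J: "finite J" "\<And>x. x \<in> J \<Longrightarrow> p + int q \<le> x" "card J \<le> m" and q: "q \<ge> 1"
    and \<eta>: "1-lipschitz_on UNIV \<eta>" and b: "\<And>x. x \<in> J \<Longrightarrow> \<bar>b x\<bar> \<le> \<kappa>" and \<kappa>: "\<kappa> > 0"
    and Wm: "W \<in> borel_measurable (past M \<xi> p)"
  defines "U \<equiv> \<lambda>v. \<Sum>x\<in>J. b x * \<eta> (\<xi> x v)"
  shows "cmod (expectation (\<lambda>v. iexp (t * (W v + U v)))
           - cf t W * cf t U)
     \<le> 4 * \<bar>t\<bar> * \<kappa> * real m * (C * real q powr (-3/2))"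
proof -
  note [measurable] = lipschitz_measurable[OF \<eta>]
  have [measurable]: "W \<in> borel_measurable M"
    by (rule measurable_from_subalg[OF past_subalgebra Wm]) simp
  have [measurable]: "U \<in> borel_measurable M" unfolding U_def by measurable
  have nn: "4 * \<bar>t\<bar> * \<kappa> * real m * (C * real q powr (-3/2)) \<ge> 0" using \<kappa> C_nonneg by simp
  consider "J = {} \<or> t = 0" | "J \<noteq> {}" "t \<noteq> 0" by blast
  then show ?thesis
  proof cases
    case 1
    then have "(\<lambda>v. iexp (t * (W v + U v))) = (\<lambda>v. iexp (t * W v))"
      and "(\<lambda>v. iexp (t * U v)) = (\<lambda>_. 1)"
      by (auto simp: U_def)
    then show ?thesis using nn by (simp add: prob_space)
  next
    case 2
    define a c where "a v = t * W v" and "c v = t * U v" for v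
    have [measurable]: "a \<in> borel_measurable M" "c \<in> borel_measurable M"
      unfolding a_def c_def by measurable
    have am[measurable]: "a \<in> borel_measurable (past M \<xi> p)" unfolding a_def using Wm by measurable
    let ?e = "\<bar>t\<bar> * \<kappa> * real m * (C * real q powr (-3/2))"
    have cov: "\<bar>expectation (\<lambda>v. V (a v) * \<psi> (c v)) - expectation (\<lambda>v. V (a v)) * expectation (\<lambda>v. \<psi> (c v))\<bar> \<le> ?e"
      if \<psi>: "1-lipschitz_on UNIV \<psi>" and V: "V \<in> borel_measurable borel" "\<And>x. \<bar>V x\<bar> \<le> 1" for V \<psi> :: "real \<Rightarrow> real"
    proof -
      note [measurable] = V(1)
      have V2: "(V x)\<^sup>2 \<le> 1" for x using V(2)[of x] by (simp add: abs_square_le_1)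
      have iV: "integrable M (\<lambda>v. (V (a v))\<^sup>2)"
        using V2 by (intro integrable_const_bound[where B = 1]) auto
      have lV: "l2norm (\<lambda>v. V (a v)) \<le> 1"
        using integral_mono[OF iV, of "\<lambda>_. 1"] V2 by (simp add: prob_space)
      have ce: "c = (\<lambda>v. \<Sum>x\<in>J. (t * b x) * \<eta> (\<xi> x v))"
        by (auto simp: c_def U_def sum_distrib_left mult.assoc)
      have "\<bar>expectation (\<lambda>v. V (a v) * \<psi> (c v)) - expectation (\<lambda>v. V (a v)) * expectation (\<lambda>v. \<psi> (c v))\<bar>
         \<le> l2norm (\<lambda>v. V (a v)) * ((\<bar>t\<bar> * \<kappa>) * real (card J) * (C * real q powr (-3/2)))"
        unfolding ce
      proof (rule cov_past_block_le[where p = p])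
        show "(\<lambda>v. V (a v)) \<in> borel_measurable (past M \<xi> p)" by measurable
        show "\<bar>t * b x\<bar> \<le> \<bar>t\<bar> * \<kappa>" if "x \<in> J" for x
          using b[OF that] by (simp add: abs_mult mult_left_mono)
      qed (use 2 J q \<kappa> \<eta> \<psi> iV in auto)
      also have "\<dots> \<le> 1 * ((\<bar>t\<bar> * \<kappa>) * real m * (C * real q powr (-3/2)))"
        using J(3) \<kappa> C_nonneg lV by (intro mult_mono) auto
      finally show ?thesis by simp
    qed
    note cc = cov[OF lipschitz_cos, of cos] and cs = cov[OF lipschitz_cos, of sin]
      and sc = cov[OF lipschitz_sin, of cos] and ss = cov[OF lipschitz_sin, of sin]
    let ?Ca = "expectation (\<lambda>v. cos (a v))" and ?Sa = "expectation (\<lambda>v. sin (a v))"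
      and ?Cc = "expectation (\<lambda>v. cos (c v))" and ?Sc = "expectation (\<lambda>v. sin (c v))"
    have int: "integrable M (\<lambda>v. f (a v) * h (c v))" 
      if "f \<in> {cos, sin}" "h \<in> {cos, sin}" for f h :: "real \<Rightarrow> real"
      by (rule integrable_const_bound[where B = 1]) 
         (use that in \<open>auto simp: abs_mult intro!: mult_le_one\<close>)
    have D: "expectation (\<lambda>v. iexp (a v + c v)) - expectation (\<lambda>v. iexp (a v)) * expectation (\<lambda>v. iexp (c v))
      = Complex ((expectation (\<lambda>v. cos (a v) * cos (c v)) - ?Ca * ?Cc) - (expectation (\<lambda>v. sin (a v) * sin (c v)) - ?Sa * ?Sc))
          ((expectation (\<lambda>v. sin (a v) * cos (c v)) - ?Sa * ?Cc) + (expectation (\<lambda>v. cos (a v) * sin (c v)) - ?Ca * ?Sc))"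
    proof -
      have "expectation (\<lambda>v. cos (a v + c v)) = expectation (\<lambda>v. cos (a v) * cos (c v)) - expectation (\<lambda>v. sin (a v) * sin (c v))"
        unfolding cos_add by (rule Bochner_Integration.integral_diff) (auto intro: int)
      moreover have "expectation (\<lambda>v. sin (a v + c v)) = expectation (\<lambda>v. sin (a v) * cos (c v)) + expectation (\<lambda>v. cos (a v) * sin (c v))"
        unfolding sin_add by (rule Bochner_Integration.integral_add) (auto intro: int)
      moreover have "expectation (\<lambda>v. iexp (a v + c v)) = Complex (expectation (\<lambda>v. cos (a v + c v))) (expectation (\<lambda>v. sin (a v + c v)))"
        by (rule expectation_iexp) measurable
      moreover note expectation_iexp[of a] expectation_iexp[of c]
      ultimately show ?thesis by (simp add: complex_eq_iff)
    qed
    have four: "cmod (Complex (x\<^sub>1 - x\<^sub>2) (x\<^sub>3 + x\<^sub>4)) \<le> 4 * e"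
      if "\<bar>x\<^sub>1\<bar> \<le> e" "\<bar>x\<^sub>2\<bar> \<le> e" "\<bar>x\<^sub>3\<bar> \<le> e" "\<bar>x\<^sub>4\<bar> \<le> e" for x\<^sub>1 x\<^sub>2 x\<^sub>3 x\<^sub>4 e
      using cmod_le[of "Complex (x\<^sub>1 - x\<^sub>2) (x\<^sub>3 + x\<^sub>4)"] that by simp
    have "cmod (expectation (\<lambda>v. iexp (a v + c v)) - expectation (\<lambda>v. iexp (a v)) * expectation (\<lambda>v. iexp (c v))) \<le> 4 * ?e"
      unfolding D by (rule four) (rule cc ss sc cs; simp)+
    then show ?thesis by (simp add: a_def c_def distrib_left)
  qed
qed

lemma char_decouple_blocks:
  assumes B: "\<And>j. j < k \<Longrightarrow> finite (B j)" "\<And>j. j < k \<Longrightarrow> card (B j) \<le> m"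
    and gap: "\<And>i j x y. i < j \<Longrightarrow> j < k \<Longrightarrow> x \<in> B i \<Longrightarrow> y \<in> B j \<Longrightarrow> x + int q \<le> y" and q: "q \<ge> 1"
    and \<eta>: "1-lipschitz_on UNIV \<eta>" and b: "\<And>j x. j < k \<Longrightarrow> x \<in> B j \<Longrightarrow> \<bar>b x\<bar> \<le> \<kappa>" and \<kappa>: "\<kappa> > 0"
  defines "U \<equiv> \<lambda>j v. \<Sum>x\<in>B j. b x * \<eta> (\<xi> x v)"
  shows "cmod (expectation (\<lambda>v. iexp (t * (\<Sum>j<k. U j v))) - (\<Prod>j<k. cf t (U j)))
     \<le> real k * (4 * \<bar>t\<bar> * \<kappa> * real m * (C * real q powr (-3/2)))"
  using B gap b
proof (induction k)
  case 0
  then show ?case by (simp add: prob_space)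
next
  case (Suc k)
  note [measurable] = lipschitz_measurable[OF \<eta>]
  have [measurable]: "U j \<in> borel_measurable M" for j unfolding U_def by measurable
  let ?e = "4 * \<bar>t\<bar> * \<kappa> * real m * (C * real q powr (-3/2))"
  let ?S = "\<lambda>v. \<Sum>j<k. U j v"
  have IH: "cmod (expectation (\<lambda>v. iexp (t * ?S v)) - (\<Prod>j<k. cf t (U j))) \<le> real k * ?e"
  proof (rule Suc.IH)
    show "x + int q \<le> y" if "i < j" "j < k" "x \<in> B i" "y \<in> B j" for i j x y
      using Suc.prems(3)[OF that(1) _ that(3,4)] that(2) by simp
    show "\<bar>b x\<bar> \<le> \<kappa>" if "j < k" "x \<in> B j" for j x
      using Suc.prems(4)[OF _ that(2)] that(1) by simp
  qed (use Suc.prems(1,2) in simp_all)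
  have step: "cmod (expectation (\<lambda>v. iexp (t * (?S v + U k v))) - expectation (\<lambda>v. iexp (t * ?S v)) * cf t (U k)) \<le> ?e"
  proof -
    \<comment> \<open>Any \<open>p\<close> between the earlier blocks and the gap before \<open>B k\<close> will do; empty blocks force the case distinction.\<close>
    define p where "p = (if B k = {} then (if (\<Union>j<k. B j) = {} then 0 else Max (\<Union>j<k. B j)) else Min (B k) - int q)"
    have fin: "finite (\<Union>j<k. B j)" "finite (B k)" using Suc.prems(1) by auto
    have le: "x \<le> p" if "j < k" "x \<in> B j" for j x
    proof (cases "B k = {}")
      case True
      have x: "x \<in> (\<Union>j<k. B j)" using that by auto
      then have "(\<Union>j<k. B j) \<noteq> {}" by blast
      then have "p = Max (\<Union>j<k. B j)" using True unfolding p_def by metis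
      then show ?thesis using Max_ge[OF fin(1) x] by simp
    next
      case False
      then have "Min (B k) \<in> B k" using fin by simp
      then have "x + int q \<le> Min (B k)" using Suc.prems(3)[of j k x "Min (B k)"] that by auto
      then show ?thesis using False by (simp add: p_def)
    qed
    have Sm: "?S \<in> borel_measurable (past M \<xi> p)"
      unfolding U_def
    proof (intro borel_measurable_sum borel_measurable_times borel_measurable_const)
      fix j x assume "j \<in> {..<k}" "x \<in> B j"
      then have "\<xi> x \<in> borel_measurable (past M \<xi> p)" using le by (intro measurable_past) auto
      then show "(\<lambda>v. \<eta> (\<xi> x v)) \<in> borel_measurable (past M \<xi> p)" by measurable
    qed
    show ?thesis
      unfolding U_def
    proof (rule char_decouple_step[where p = p, OF fin(2) _ _ q \<eta> _ \<kappa> Sm[unfolded U_def]])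
      show "p + int q \<le> x" if "x \<in> B k" for x
        using that fin by (auto simp: p_def)
      show "card (B k) \<le> m" using Suc.prems(2) by simp
      show "\<bar>b x\<bar> \<le> \<kappa>" if "x \<in> B k" for x
        using Suc.prems(4)[OF _ that] by simp
    qed
  qed
  have "expectation (\<lambda>v. iexp (t * (\<Sum>j<Suc k. U j v))) - (\<Prod>j<Suc k. cf t (U j))
     = (expectation (\<lambda>v. iexp (t * (?S v + U k v))) - expectation (\<lambda>v. iexp (t * ?S v)) * cf t (U k))
       + (expectation (\<lambda>v. iexp (t * ?S v)) - (\<Prod>j<k. cf t (U j))) * cf t (U k)"
    by (simp add: algebra_simps)
  also have "cmod \<dots> \<le> ?e + real k * ?e * 1"
    by (rule order_trans[OF norm_triangle_ineq], unfold norm_mult,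
        intro add_mono step mult_mono IH cmod_expectation_iexp_le_1) (use \<kappa> C_nonneg in auto)
  finally show ?case by (simp add: algebra_simps)
qed

end

section \<open>Bernstein blocks and truncation\<close>

lemma exp_minus_diff_le: "a \<ge> 0 \<Longrightarrow> c \<ge> 0 \<Longrightarrow> \<bar>exp (- a) - exp (- c)\<bar> \<le> \<bar>a - (c::real)\<bar>"
proof (induction a c rule: linorder_wlog)
  case (le a c)
  have "exp (- c) = exp (- a) * exp (- (c - a))" by (simp add: exp_add[symmetric])
  then have "exp (- a) - exp (- c) = exp (- a) * (1 - exp (- (c - a)))" by (simp add: right_diff_distrib)
  also have "\<dots> \<le> 1 * (c - a)"
  proof (rule mult_mono)
    show "1 - exp (- (c - a)) \<le> c - a" using exp_ge_add_one_self[of "- (c - a)"] by linarith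
  qed (use le in auto)
  finally show ?case using le by simp
qed (simp add: abs_minus_commute)

text \<open>
The \<open>i\<close>-th smallest point belongs to block \<open>i div (p + q)\<close>, unless \<open>i mod (p + q) \<ge> p\<close>, in which
case it is discarded into \<open>D\<close>. Cutting by rank instead of by position bounds the number of
blocks by the number of points however far these are spread, and distinct integers whose
ranks differ by \<open>q\<close> are at distance at least \<open>q\<close>.
\<close>

lemma exists_block_partition:
  fixes A :: "int set"
  assumes A: "finite A" and p: "p \<ge> 1" and q: "q \<ge> 1"
  obtains k :: nat and B :: "nat \<Rightarrow> int set" and D where
    "k = card A div (p + q) + 1" "A = (\<Union>j<k. B j) \<union> D" "(\<Union>j<k. B j) \<inter> D = {}"
    "\<And>j. j < k \<Longrightarrow> card (B j) \<le> p" "card D \<le> k * q"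
    "\<And>i j x y. i < j \<Longrightarrow> j < k \<Longrightarrow> x \<in> B i \<Longrightarrow> y \<in> B j \<Longrightarrow> x + int q \<le> y"
proof -
  define e where "e i = sorted_list_of_set A ! i" for i
  define m where "m = card A"
  define k where "k = m div (p + q) + 1"
  have bij: "bij_betw e {..<m} A"
    unfolding e_def m_def by (rule bij_betw_nth) (use A in auto)
  have mono: "e i < e i'" if "i < i'" "i' < m" for i i'
    using that strict_sorted_list_of_set[of A] by (auto simp: e_def m_def sorted_wrt_iff_nth_less)
  have spread: "e i + int d \<le> e (i + d)" if "i + d < m" for i d
    using that
  proof (induction d)
    case (Suc d)
    then show ?case using mono[of "i + d" "i + Suc d"] by simp
  qed simp
  define B where "B j = e ` {i. i < m \<and> i div (p + q) = j \<and> i mod (p + q) < p}" for j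
  define D where "D = e ` {i. i < m \<and> \<not> i mod (p + q) < p}"
  have inj: "inj_on e {..<m}" and img: "e ` {..<m} = A" using bij by (auto simp: bij_betw_def)
  have U: "(\<Union>j<k. B j) = e ` {i. i < m \<and> i mod (p + q) < p}"
  proof -
    have "i div (p + q) < k" if "i < m" for i
      using that by (simp add: k_def div_le_mono less_Suc_eq_le)
    then show ?thesis unfolding B_def by auto
  qed
  show ?thesis
  proof
    show "k = card A div (p + q) + 1" by (simp add: k_def m_def)
    have "{..<m} = {i. i < m \<and> i mod (p + q) < p} \<union> {i. i < m \<and> \<not> i mod (p + q) < p}" by auto
    then show "A = (\<Union>j<k. B j) \<union> D"
      unfolding U D_def img[symmetric] image_Un[symmetric] by simp
    show "(\<Union>j<k. B j) \<inter> D = {}"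
      unfolding U D_def using inj by (auto simp: inj_on_def)
    show "card (B j) \<le> p" for j
    proof -
      have "{i. i < m \<and> i div (p + q) = j \<and> i mod (p + q) < p} \<subseteq> (\<lambda>r. j * (p + q) + r) ` {..<p}"
      proof
        fix i assume "i \<in> {i. i < m \<and> i div (p + q) = j \<and> i mod (p + q) < p}"
        then show "i \<in> (\<lambda>r. j * (p + q) + r) ` {..<p}"
          by (intro image_eqI[of _ _ "i mod (p + q)"]) (auto simp: div_mult_mod_eq)
      qed
      then have "card {i. i < m \<and> i div (p + q) = j \<and> i mod (p + q) < p} \<le> card ((\<lambda>r. j * (p + q) + r) ` {..<p})"
        by (rule card_mono[rotated]) simp
      also have "\<dots> \<le> p" using card_image_le[of "{..<p}"] by simp
      finally show ?thesis unfolding B_def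
        by (rule order_trans[OF card_image_le, rotated]) simp
    qed
    show "card D \<le> k * q"
    proof -
      have "{i. i < m \<and> \<not> i mod (p + q) < p} \<subseteq> (\<lambda>(j, r). j * (p + q) + (p + r)) ` ({..<k} \<times> {..<q})"
      proof
        fix i assume i: "i \<in> {i. i < m \<and> \<not> i mod (p + q) < p}"
        have "i mod (p + q) < p + q" using p by simp
        then have "i mod (p + q) - p < q" using q by linarith
        moreover have "i div (p + q) < k"
          using i by (simp add: k_def div_le_mono less_Suc_eq_le)
        moreover have "i = i div (p + q) * (p + q) + (p + (i mod (p + q) - p))"
          using i by (simp add: div_mult_mod_eq)
        ultimately show "i \<in> (\<lambda>(j, r). j * (p + q) + (p + r)) ` ({..<k} \<times> {..<q})"
          by (intro image_eqI[of _ _ "(i div (p + q), i mod (p + q) - p)"]) auto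
      qed
      then have "card {i. i < m \<and> \<not> i mod (p + q) < p} \<le> card ((\<lambda>(j, r). j * (p + q) + (p + r)) ` ({..<k} \<times> {..<q}))"
        by (rule card_mono[rotated]) simp
      also have "\<dots> \<le> k * q" using card_image_le[of "{..<k} \<times> {..<q}"] by (simp add: card_cartesian_product)
      finally show ?thesis unfolding D_def
        by (rule order_trans[OF card_image_le, rotated]) simp
    qed
    show "x + int q \<le> y" if "i < j" "j < k" and xy: "x \<in> B i" "y \<in> B j" for i j x y
    proof -
      obtain a c where a: "x = e a" "a < m" "a div (p + q) = i" "a mod (p + q) < p"
        and c: "y = e c" "c < m" "c div (p + q) = j" "c mod (p + q) < p"
        using xy unfolding B_def by blast
      have "a = i * (p + q) + a mod (p + q)" "c = j * (p + q) + c mod (p + q)"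
        using a c div_mult_mod_eq[of a "p+q"] div_mult_mod_eq[of c "p+q"] by auto
      moreover have "(i + 1) * (p + q) \<le> j * (p + q)" using that by (intro mult_right_mono) auto
      ultimately have ac: "a + q \<le> c" using a(4) by (simp add: algebra_simps)
      then have "e a + int (c - a) \<le> e (a + (c - a))" using c by (intro spread) auto
      then show ?thesis using ac a c by simp
    qed
  qed
qed

context theta_decaying
begin

lemma var_const_eq: "var_const s = 2 * s\<^sup>2 + 2 * s * C * (\<Sum>r. real r powr (-3/2))"
proof -
  have "summable (\<lambda>r. real r powr (-3/2))" by (subst summable_real_powr_iff) simp
  then have 1: "(\<lambda>r. s * C * real r powr (-3/2)) sums (s * C * (\<Sum>r. real r powr (-3/2)))"
    by (intro sums_mult summable_sums)
  have 2: "(\<lambda>r. if r = 0 then s\<^sup>2 else (0::real)) sums s\<^sup>2"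
    using sums_single[of 0 "\<lambda>_. s\<^sup>2"] by simp
  have "(\<lambda>r. cov_bound s r) sums (s\<^sup>2 + s * C * (\<Sum>r. real r powr (-3/2)))"
    unfolding cov_bound_def using sums_add[OF 2 1] by simp
  then show ?thesis unfolding var_const_def by (simp add: sums_iff algebra_simps)
qed

lemma var_const_nonneg: "s \<ge> 0 \<Longrightarrow> var_const s \<ge> 0"
  unfolding var_const_def using summable_cov_bound[of s 0]
  by (intro mult_nonneg_nonneg suminf_nonneg cov_bound_nonneg) auto

lemma l2norm_sum_le:
  assumes A: "finite A"
    and \<eta>: "1-lipschitz_on UNIV \<eta>" and E0: "expectation (\<lambda>v. \<eta> (\<xi> 0 v)) = 0"
    and s: "l2norm (\<lambda>v. \<eta> (\<xi> 0 v)) \<le> s" and b: "(\<Sum>x\<in>A. (b x)\<^sup>2) \<le> L"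
  shows "l2norm (\<lambda>v. \<Sum>x\<in>A. b x * \<eta> (\<xi> x v)) \<le> sqrt (L * var_const s)"
proof (rule real_sqrt_le_mono)
  have s0: "s \<ge> 0" by (rule order_trans[OF _ s]) simp
  have "expectation (\<lambda>v. (\<Sum>x\<in>A. b x * \<eta> (\<xi> x v))\<^sup>2) \<le> (\<Sum>x\<in>A. (b x)\<^sup>2) * var_const s"
    by (rule variance_sum_le[OF A \<eta> E0 s])
  also have "\<dots> \<le> L * var_const s" using b var_const_nonneg[OF s0] by (rule mult_right_mono)
  finally show "expectation (\<lambda>v. (\<Sum>x\<in>A. b x * \<eta> (\<xi> x v))\<^sup>2) \<le> L * var_const s" .
qed

text \<open>
Expanding the square leaves the products over pairs of different blocks; all their points are at
distance at least \<open>q\<close>, so only the tail of the covariance series enters.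
\<close>

lemma variance_blocks_le:
  fixes b :: "int \<Rightarrow> real" and k :: nat
  assumes B: "\<And>j. j < k \<Longrightarrow> finite (B j)"
    and gap: "\<And>i j x y. i < j \<Longrightarrow> j < k \<Longrightarrow> x \<in> B i \<Longrightarrow> y \<in> B j \<Longrightarrow> x + int q \<le> y" and q: "q \<ge> 1"
    and \<eta>: "1-lipschitz_on UNIV \<eta>" and E0: "expectation (\<lambda>v. \<eta> (\<xi> 0 v)) = 0"
    and s: "l2norm (\<lambda>v. \<eta> (\<xi> 0 v)) \<le> s"
  defines "U \<equiv> \<lambda>j v. \<Sum>x\<in>B j. b x * \<eta> (\<xi> x v)"
  shows "\<bar>expectation (\<lambda>v. (\<Sum>j<k. U j v)\<^sup>2) - (\<Sum>j<k. moment2 (U j))\<bar>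
     \<le> (\<Sum>x\<in>(\<Union>j<k. B j). (b x)\<^sup>2) * (2 * (\<Sum>r. cov_bound s (r + q)))"
proof -
  have s0: "s \<ge> 0" by (rule order_trans[OF _ s]) simp
  have L2U: "L2 (U j)" for j unfolding U_def by (intro L2_sum L2_cmult L2_lip_\<xi> \<eta>)
  let ?c = "\<lambda>x y. expectation (\<lambda>v. \<eta> (\<xi> x v) * \<eta> (\<xi> y v))"
  have i: "integrable M (\<lambda>v. \<eta> (\<xi> x v) * \<eta> (\<xi> y v))" for x y
    by (intro L2_integrable_mult L2_lip_\<xi> \<eta>)
  have UU: "expectation (\<lambda>v. U i v * U j v) = (\<Sum>x\<in>B i. \<Sum>y\<in>B j. b x * b y * ?c x y)" for i j
  proof -
    have "expectation (\<lambda>v. U i v * U j v)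
       = expectation (\<lambda>v. \<Sum>x\<in>B i. \<Sum>y\<in>B j. b x * b y * (\<eta> (\<xi> x v) * \<eta> (\<xi> y v)))"
      unfolding U_def by (intro Bochner_Integration.integral_cong) (auto simp: sum_product mult_ac)
    also have "\<dots> = (\<Sum>x\<in>B i. \<Sum>y\<in>B j. b x * b y * ?c x y)"
      using i by (subst Bochner_Integration.integral_sum, force, subst Bochner_Integration.integral_sum) auto
    finally show ?thesis .
  qed
  have far: "q \<le> nat \<bar>x - y\<bar>" if "i \<noteq> j" "i < k" "j < k" "x \<in> B i" "y \<in> B j" for i j :: nat and x y
    using gap[of i j x y] gap[of j i y x] that by (cases i j rule: linorder_cases) auto
  have disj: "B i \<inter> B j = {}" if "i < k" "j < k" "i \<noteq> j" for i j :: nat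
    using far[OF that(3,1,2)] q by force
  let ?f = "\<lambda>x y. if q \<le> nat \<bar>x - y\<bar> then \<bar>b x\<bar> * \<bar>b y\<bar> * cov_bound s (nat \<bar>x - y\<bar>) else 0"
  have f0: "?f x y \<ge> 0" for x y using cov_bound_nonneg[OF s0] by simp
  have "expectation (\<lambda>v. (\<Sum>j<k. U j v)\<^sup>2) = expectation (\<lambda>v. \<Sum>i<k. \<Sum>j<k. U i v * U j v)"
    by (intro Bochner_Integration.integral_cong) (auto simp: power2_eq_square sum_product)
  also have "\<dots> = (\<Sum>i<k. \<Sum>j<k. expectation (\<lambda>v. U i v * U j v))"
    using L2_integrable_mult[OF L2U L2U]
    by (subst Bochner_Integration.integral_sum, force, subst Bochner_Integration.integral_sum) auto
  finally have "expectation (\<lambda>v. (\<Sum>j<k. U j v)\<^sup>2) - (\<Sum>j<k. moment2 (U j))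
     = (\<Sum>i<k. (\<Sum>j<k. expectation (\<lambda>v. U i v * U j v)) - expectation (\<lambda>v. U i v * U i v))"
    by (simp add: sum_subtractf power2_eq_square)
  also have "\<dots> = (\<Sum>i<k. \<Sum>j\<in>{..<k} - {i}. expectation (\<lambda>v. U i v * U j v))"
    by (intro sum.cong refl) (simp add: sum.remove)
  also have "\<bar>\<dots>\<bar> \<le> (\<Sum>i<k. \<Sum>j\<in>{..<k} - {i}. \<Sum>x\<in>B i. \<Sum>y\<in>B j. ?f x y)"
  proof (rule order_trans[OF sum_abs], rule sum_mono, rule order_trans[OF sum_abs], rule sum_mono)
    fix i j assume ij: "i \<in> {..<k}" "j \<in> {..<k} - {i}"
    show "\<bar>expectation (\<lambda>v. U i v * U j v)\<bar> \<le> (\<Sum>x\<in>B i. \<Sum>y\<in>B j. ?f x y)"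
      unfolding UU
    proof (rule order_trans[OF sum_abs], rule sum_mono, rule order_trans[OF sum_abs], rule sum_mono)
      fix x y assume "x \<in> B i" "y \<in> B j"
      then have "q \<le> nat \<bar>x - y\<bar>" using ij by (intro far[of i j]) auto
      then show "\<bar>b x * b y * ?c x y\<bar> \<le> ?f x y"
        by (simp add: abs_mult mult_left_mono cov_le_cov_bound[OF \<eta> E0 s])
    qed
  qed
  also have "\<dots> \<le> (\<Sum>i<k. \<Sum>j<k. \<Sum>x\<in>B i. \<Sum>y\<in>B j. ?f x y)"
    by (intro sum_mono sum_mono2 sum_nonneg f0) auto
  also have "\<dots> = (\<Sum>i<k. \<Sum>x\<in>B i. \<Sum>j<k. \<Sum>y\<in>B j. ?f x y)"
    by (intro sum.cong refl sum.swap)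
  also have "\<dots> = (\<Sum>x\<in>(\<Union>j<k. B j). \<Sum>y\<in>(\<Union>j<k. B j). ?f x y)"
    using B disj by (subst sum.UNION_disjoint, simp, force, force, intro sum.cong refl)
      (subst sum.UNION_disjoint, auto)
  also have "\<dots> \<le> (\<Sum>x\<in>(\<Union>j<k. B j). (b x)\<^sup>2) * (2 * (\<Sum>r. cov_bound s (r + q)))"
    using B by (intro sum_pairs_gap_le cov_bound_nonneg s0 summable_cov_bound) auto
  finally show ?thesis .
qed

text \<open>
Three replacements: the joint characteristic function by the product over blocks, each factor by a
Gaussian one, and the sum of the block variances by the variance of the total.
\<close>

lemma char_blocks_gauss:
  assumes B: "\<And>j. j < k \<Longrightarrow> finite (B j)" "\<And>j. j < k \<Longrightarrow> card (B j) \<le> m"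
    and gap: "\<And>i j x y. i < j \<Longrightarrow> j < k \<Longrightarrow> x \<in> B i \<Longrightarrow> y \<in> B j \<Longrightarrow> x + int q \<le> y" and q: "q \<ge> 1"
    and \<eta>: "1-lipschitz_on UNIV \<eta>" and E0: "expectation (\<lambda>v. \<eta> (\<xi> 0 v)) = 0"
    and s: "l2norm (\<lambda>v. \<eta> (\<xi> 0 v)) \<le> s" and K: "\<And>x. \<bar>\<eta> x\<bar> \<le> K"
    and b: "\<And>j x. j < k \<Longrightarrow> x \<in> B j \<Longrightarrow> \<bar>b x\<bar> \<le> \<kappa>" and \<kappa>: "\<kappa> > 0"
    and L: "(\<Sum>x\<in>(\<Union>j<k. B j). (b x)\<^sup>2) \<le> L" and \<beta>: "\<beta> = \<kappa> * real m * K"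
  defines "T \<equiv> \<lambda>v. \<Sum>j<k. \<Sum>x\<in>B j. b x * \<eta> (\<xi> x v)"
  shows "cmod (cf t T - exp (- (t\<^sup>2 * moment2 T / 2)))
     \<le> real k * (4 * \<bar>t\<bar> * \<kappa> * real m * (C * real q powr (-3/2)))
       + (\<bar>t\<bar> ^ 3 * \<beta> / 6 + t ^ 4 * \<beta>\<^sup>2 / 8) * (L * var_const s)
       + t\<^sup>2 * (L * (\<Sum>r. cov_bound s (r + q)))"
proof -
  note [measurable] = lipschitz_measurable[OF \<eta>]
  have s0: "s \<ge> 0" by (rule order_trans[OF _ s]) simp
  have K0: "K \<ge> 0" by (rule order_trans[OF _ K[of 0]]) simp
  have \<beta>0: "\<beta> \<ge> 0" using \<beta> \<kappa> K0 by simp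
  define U where "U j v = (\<Sum>x\<in>B j. b x * \<eta> (\<xi> x v))" for j v
  define V where "V j = moment2 (U j)" for j
  have T: "T v = (\<Sum>j<k. U j v)" for v by (simp add: T_def U_def)
  have Um[measurable]: "U j \<in> borel_measurable M" for j unfolding U_def by measurable
  have V0: "V j \<ge> 0" for j by (simp add: V_def)
  have bU: "\<bar>U j v\<bar> \<le> \<beta>" if "j < k" for j v
  proof -
    have "\<bar>U j v\<bar> \<le> (\<Sum>x\<in>B j. \<kappa> * K)"
      unfolding U_def using b[OF that] K \<kappa>
      by (intro order_trans[OF sum_abs] sum_mono) (auto simp: abs_mult intro!: mult_mono)
    also have "\<dots> = real (card (B j)) * (\<kappa> * K)" by simp
    also have "\<dots> \<le> real m * (\<kappa> * K)" using B(2)[OF that] \<kappa> K0 by (intro mult_right_mono) auto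
    finally show ?thesis by (simp add: \<beta> mult_ac)
  qed
  have EU: "expectation (U j) = 0" for j
  proof -
    have i: "integrable M (\<lambda>v. \<eta> (\<xi> x v))" for x by (intro L2_integrable L2_lip_\<xi> \<eta>)
    have "expectation (\<lambda>v. \<eta> (\<xi> x v)) = 0" for x using E0 expectation_\<xi>[of \<eta> x] by simp
    then show ?thesis unfolding U_def using i by (subst Bochner_Integration.integral_sum) auto
  qed
  have disj: "B i \<inter> B j = {}" if "i < k" "j < k" "i \<noteq> j" for i j :: nat
    using gap[of i j] gap[of j i] that q by (cases i j rule: linorder_cases) force+
  have VL: "(\<Sum>j<k. V j) \<le> L * var_const s"
  proof -
    have "(\<Sum>j<k. V j) \<le> (\<Sum>j<k. (\<Sum>x\<in>B j. (b x)\<^sup>2) * var_const s)"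
      unfolding V_def U_def using B by (intro sum_mono variance_sum_le \<eta> E0 s) auto
    also have "\<dots> = (\<Sum>x\<in>(\<Union>j<k. B j). (b x)\<^sup>2) * var_const s"
      using B disj by (subst sum.UNION_disjoint) (auto simp: sum_distrib_right)
    also have "\<dots> \<le> L * var_const s" using L var_const_nonneg[OF s0] by (rule mult_right_mono)
    finally show ?thesis .
  qed
  let ?P = "\<Prod>j<k. cf t (U j)"
  let ?G = "\<Prod>j<k. complex_of_real (exp (- (t\<^sup>2 * V j / 2)))"
  have 1: "cmod (cf t T - ?P) \<le> real k * (4 * \<bar>t\<bar> * \<kappa> * real m * (C * real q powr (-3/2)))"
    unfolding T U_def by (rule char_decouple_blocks[OF B gap q \<eta> b \<kappa>])
  have 2: "cmod (?P - ?G) \<le> (\<bar>t\<bar> ^ 3 * \<beta> / 6 + t ^ 4 * \<beta>\<^sup>2 / 8) * (L * var_const s)"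
  proof -
    have "cmod (?P - ?G) \<le> (\<Sum>j<k. cmod (cf t (U j) - complex_of_real (exp (- (t\<^sup>2 * V j / 2)))))"
      using V0 by (intro norm_prod_diff cmod_expectation_iexp_le_1) (auto simp del: of_real_exp)
    also have "\<dots> \<le> (\<Sum>j<k. (\<bar>t\<bar> ^ 3 * \<beta> / 6 + t ^ 4 * \<beta>\<^sup>2 / 8) * V j)"
      by (intro sum_mono char_bounded_gauss EU bU V_def Um) auto
    also have "\<dots> \<le> (\<bar>t\<bar> ^ 3 * \<beta> / 6 + t ^ 4 * \<beta>\<^sup>2 / 8) * (L * var_const s)"
      unfolding sum_distrib_left[symmetric] using \<beta>0 by (intro mult_left_mono VL) auto
    finally show ?thesis .
  qed
  have 3: "cmod (?G - exp (- (t\<^sup>2 * moment2 T / 2))) \<le> t\<^sup>2 * (L * (\<Sum>r. cov_bound s (r + q)))"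
  proof -
    have "?G = complex_of_real (exp (- (t\<^sup>2 * (\<Sum>j<k. V j) / 2)))"
      by (simp add: exp_sum[symmetric] sum_negf sum_distrib_left sum_divide_distrib flip: of_real_prod of_real_exp)
    then have "cmod (?G - exp (- (t\<^sup>2 * moment2 T / 2)))
       = \<bar>exp (- (t\<^sup>2 * (\<Sum>j<k. V j) / 2)) - exp (- (t\<^sup>2 * moment2 T / 2))\<bar>"
      by (metis norm_of_real of_real_diff)
    also have "\<dots> \<le> \<bar>t\<^sup>2 * (\<Sum>j<k. V j) / 2 - t\<^sup>2 * moment2 T / 2\<bar>"
      by (rule exp_minus_diff_le) (auto intro!: sum_nonneg mult_nonneg_nonneg V0)
    also have "\<dots> = t\<^sup>2 / 2 * \<bar>moment2 T - (\<Sum>j<k. V j)\<bar>"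
      by (subst abs_minus_commute) (simp add: right_diff_distrib[symmetric] diff_divide_distrib[symmetric] abs_mult)
    also have "\<dots> \<le> t\<^sup>2 / 2 * ((\<Sum>x\<in>(\<Union>j<k. B j). (b x)\<^sup>2) * (2 * (\<Sum>r. cov_bound s (r + q))))"
      unfolding T V_def U_def by (intro mult_left_mono variance_blocks_le B gap q \<eta> E0 s) auto
    also have "\<dots> \<le> t\<^sup>2 / 2 * (L * (2 * (\<Sum>r. cov_bound s (r + q))))"
      by (intro mult_left_mono mult_right_mono L mult_nonneg_nonneg suminf_nonneg summable_cov_bound cov_bound_nonneg s0) auto
    finally show ?thesis by simp
  qed
  have tri: "cmod (w - z) \<le> e\<^sub>1 + e\<^sub>2 + e\<^sub>3"
    if "cmod (w - x) \<le> e\<^sub>1" "cmod (x - y) \<le> e\<^sub>2" "cmod (y - z) \<le> e\<^sub>3" for w x y z e\<^sub>1 e\<^sub>2 e\<^sub>3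
    using norm_diff_triangle_le[OF norm_diff_triangle_le[OF that(1,2)] that(3)] .
  show ?thesis by (rule tri[OF 1 2 3])
qed

end

definition clip :: "real \<Rightarrow> real \<Rightarrow> real" where
  "clip K x = max (- K) (min x K)"

lemma clip_lipschitz: "1-lipschitz_on UNIV (\<lambda>x. clip K x - m)"
  by (rule lipschitz_onI) (auto simp: dist_real_def clip_def)

lemma clip_remainder_lipschitz: "1-lipschitz_on UNIV (\<lambda>x. x - (clip K x - m))" if "K \<ge> 0"
  by (rule lipschitz_onI) (use that in \<open>auto simp: dist_real_def clip_def max_def min_def abs_if\<close>)

context theta_decaying
begin

text \<open>
Truncation at level \<open>K\<close>, recentred. Both it and its difference from the identity are
\<open>1\<close>-Lipschitz, so the covariance bounds apply to either part.
\<close>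

definition trunc :: "real \<Rightarrow> real \<Rightarrow> real" where
  "trunc K x = clip K x - expectation (\<lambda>v. clip K (\<xi> 0 v))"

definition trunc_err :: "real \<Rightarrow> real" where
  "trunc_err K = l2norm (\<lambda>v. \<xi> 0 v - trunc K (\<xi> 0 v))"

text \<open>
The \<open>L\<^sup>2\<close> error committed by truncating at \<open>K\<close> and by discarding the points between the blocks;
\<open>(N / p + 1) q\<close> bounds the number of discarded points.
\<close>

definition block_err :: "real \<Rightarrow> real \<Rightarrow> nat \<Rightarrow> nat \<Rightarrow> nat \<Rightarrow> real \<Rightarrow> real" where
  "block_err L \<kappa> N p q K = sqrt (L * var_const (trunc_err K))
     + sqrt (\<kappa>\<^sup>2 * ((real N / real p + 1) * real q) * var_const (l2norm (\<xi> 0)))"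

lemma clip_measurable[measurable]: "clip K \<in> borel_measurable borel"
  unfolding clip_def by measurable

lemma clip_integrable: "K \<ge> 0 \<Longrightarrow> integrable M (\<lambda>v. clip K (\<xi> x v))"
  by (rule integrable_const_bound[where B = K]) (auto simp: clip_def)

lemma trunc_centered: "K \<ge> 0 \<Longrightarrow> expectation (\<lambda>v. trunc K (\<xi> 0 v)) = 0"
  unfolding trunc_def using clip_integrable[of K 0] by (simp add: prob_space)

lemma trunc_bound: assumes "K \<ge> 0" shows "\<bar>trunc K x\<bar> \<le> 2 * K"
proof -
  have c: "\<bar>clip K y\<bar> \<le> K" for y using assms by (auto simp: clip_def)
  have "\<bar>expectation (\<lambda>v. clip K (\<xi> 0 v))\<bar> \<le> expectation (\<lambda>v. \<bar>clip K (\<xi> 0 v)\<bar>)"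
    by (rule integral_abs_bound)
  also have "\<dots> \<le> expectation (\<lambda>_. K)"
    using clip_integrable[OF assms] c by (intro integral_mono) auto
  finally show ?thesis using c[of x] unfolding trunc_def by (simp add: prob_space)
qed

lemma L2_clip: "L2 (\<lambda>v. clip K (\<xi> x v))"
  using L2_lip_\<xi>[OF clip_lipschitz[of K 0]] by simp

lemma trunc_l2norm_le:
  assumes "K \<ge> 0" shows "l2norm (\<lambda>v. trunc K (\<xi> 0 v)) \<le> l2norm (\<xi> 0)"
proof (rule real_sqrt_le_mono)
  have "expectation (\<lambda>v. (trunc K (\<xi> 0 v))\<^sup>2) \<le> expectation (\<lambda>v. (clip K (\<xi> 0 v))\<^sup>2)"
    unfolding trunc_def by (rule expectation_diff_const_sq[OF L2_clip])
  also have "\<dots> \<le> expectation (\<lambda>v. (\<xi> 0 v)\<^sup>2)"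
    using assms by (intro integral_mono L2_square L2_clip L2_\<xi>) (auto simp: clip_def abs_le_square_iff[symmetric])
  finally show "expectation (\<lambda>v. (trunc K (\<xi> 0 v))\<^sup>2) \<le> expectation (\<lambda>v. (\<xi> 0 v)\<^sup>2)" .
qed

text \<open>
Dominated convergence: the part cut off vanishes pointwise and is dominated by \<open>\<xi> 0\<close>. As \<open>\<xi> 0\<close> is
centred, the error of the recentred truncation is the part cut off minus its own mean, which
is no larger in \<open>L\<^sup>2\<close>.
\<close>

lemma trunc_err_tendsto:
  assumes E0: "expectation (\<xi> 0) = 0"
  shows "(trunc_err \<longlongrightarrow> 0) at_top"
proof -
  have R: "expectation (\<lambda>v. (\<xi> 0 v - trunc K (\<xi> 0 v))\<^sup>2) \<le> expectation (\<lambda>v. (\<xi> 0 v - clip K (\<xi> 0 v))\<^sup>2)" if "K \<ge> 0" for K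
  proof -
    have "L2 (\<lambda>v. \<xi> 0 v - clip K (\<xi> 0 v))" by (intro L2_diff L2_\<xi> L2_clip)
    from expectation_diff_const_sq[OF this]
    show ?thesis
      using L2_integrable[OF L2_\<xi>] clip_integrable[OF that] E0 by (simp add: trunc_def algebra_simps)
  qed
  have lim: "((\<lambda>K. expectation (\<lambda>v. (\<xi> 0 v - clip K (\<xi> 0 v))\<^sup>2)) \<longlongrightarrow> expectation (\<lambda>v. 0)) at_top"
  proof (rule integral_dominated_convergence_at_top[where w = "\<lambda>v. (\<xi> 0 v)\<^sup>2"])
    show "integrable M (\<lambda>v. (\<xi> 0 v)\<^sup>2)" by (rule \<xi>_sq)
    show "AE v in M. ((\<lambda>K. (\<xi> 0 v - clip K (\<xi> 0 v))\<^sup>2) \<longlongrightarrow> 0) at_top"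
    proof (rule AE_I2, rule tendsto_eventually)
      fix v
      show "\<forall>\<^sub>F K in at_top. (\<xi> 0 v - clip K (\<xi> 0 v))\<^sup>2 = 0"
        using eventually_ge_at_top[of "\<bar>\<xi> 0 v\<bar>"] by eventually_elim (auto simp: clip_def)
    qed
    show "\<forall>\<^sub>F K in at_top. AE v in M. norm ((\<xi> 0 v - clip K (\<xi> 0 v))\<^sup>2) \<le> (\<xi> 0 v)\<^sup>2"
      using eventually_ge_at_top[of "0::real"]
      by eventually_elim (auto simp: clip_def abs_le_square_iff[symmetric])
  qed auto
  have "((\<lambda>K. sqrt (expectation (\<lambda>v. (\<xi> 0 v - clip K (\<xi> 0 v))\<^sup>2))) \<longlongrightarrow> 0) at_top"
    using tendsto_real_sqrt[OF lim] by simp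
  then show ?thesis
  proof (rule Lim_null_comparison[rotated])
    show "\<forall>\<^sub>F K in at_top. norm (trunc_err K) \<le> sqrt (expectation (\<lambda>v. (\<xi> 0 v - clip K (\<xi> 0 v))\<^sup>2))"
      using eventually_ge_at_top[of "0::real"] by eventually_elim (auto simp: trunc_err_def R)
  qed
qed

text \<open>
The weighted sum is first replaced by the truncated sum over the blocks, at \<open>L\<^sup>2\<close> distance
\<open>block_err\<close>, in its characteristic function and in its variance; the rest is the estimate for
separated blocks.
\<close>

lemma char_weighted_sum_gauss:
  assumes A: "finite A" "card A \<le> N" and b: "\<And>x. x \<in> A \<Longrightarrow> \<bar>b x\<bar> \<le> \<kappa>" and \<kappa>: "\<kappa> > 0"
    and L: "(\<Sum>x\<in>A. (b x)\<^sup>2) \<le> L" and p: "p \<ge> 1" and q: "q \<ge> 1" and K: "K \<ge> 0"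
    and E0: "expectation (\<xi> 0) = 0"
  defines "X \<equiv> \<lambda>v. \<Sum>x\<in>A. b x * \<xi> x v" and "V \<equiv> L * var_const (l2norm (\<xi> 0))"
    and "\<beta> \<equiv> \<kappa> * real p * (2 * K)" and "\<delta> \<equiv> block_err L \<kappa> N p q K"
  shows "cmod (cf t X - exp (- (t\<^sup>2 * moment2 X / 2)))
     \<le> \<bar>t\<bar> * \<delta> + ((real N / real p + 1) * (4 * \<bar>t\<bar> * \<kappa> * real p * (C * real q powr (-3/2)))
       + (\<bar>t\<bar> ^ 3 * \<beta> / 6 + t ^ 4 * \<beta>\<^sup>2 / 8) * V
       + t\<^sup>2 * (L * (\<Sum>r. cov_bound (l2norm (\<xi> 0)) (r + q)))) + t\<^sup>2 * (\<delta> * sqrt V)"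
proof -
  let ?s = "l2norm (\<xi> 0)"
  define \<eta> where "\<eta> = trunc K"
  have \<eta>: "1-lipschitz_on UNIV \<eta>" unfolding \<eta>_def trunc_def[abs_def] by (rule clip_lipschitz)
  have \<eta>0: "expectation (\<lambda>v. \<eta> (\<xi> 0 v)) = 0" unfolding \<eta>_def by (rule trunc_centered[OF K])
  have \<eta>s: "l2norm (\<lambda>v. \<eta> (\<xi> 0 v)) \<le> ?s" unfolding \<eta>_def by (rule trunc_l2norm_le[OF K])
  have \<eta>K: "\<bar>\<eta> x\<bar> \<le> 2 * K" for x unfolding \<eta>_def by (rule trunc_bound[OF K])
  define \<rho> where "\<rho> x = x - \<eta> x" for x
  have \<rho>: "1-lipschitz_on UNIV \<rho>" unfolding \<rho>_def \<eta>_def trunc_def by (rule clip_remainder_lipschitz[OF K])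
  have \<rho>0: "expectation (\<lambda>v. \<rho> (\<xi> 0 v)) = 0"
    using E0 \<eta>0 L2_integrable[OF L2_\<xi>] L2_integrable[OF L2_lip_\<xi>[OF \<eta>]] by (simp add: \<rho>_def)
  have \<rho>s: "l2norm (\<lambda>v. \<rho> (\<xi> 0 v)) \<le> trunc_err K" by (simp add: \<rho>_def \<eta>_def trunc_err_def)
  have id: "1-lipschitz_on UNIV (\<lambda>x::real. x)" by (rule lipschitz_intros)
  have vc: "var_const ?s \<ge> 0" by (rule var_const_nonneg) simp
  obtain k B D where k: "k = card A div (p + q) + 1" and AB: "A = (\<Union>j<k. B j) \<union> D" "(\<Union>j<k. B j) \<inter> D = {}"
    and Bp: "\<And>j. j < k \<Longrightarrow> card (B j) \<le> p" and D: "card D \<le> k * q"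
    and gap: "\<And>i j x y. i < j \<Longrightarrow> j < k \<Longrightarrow> x \<in> B i \<Longrightarrow> y \<in> B j \<Longrightarrow> x + int q \<le> y"
    using exists_block_partition[OF A(1) p q] by metis
  have finB: "finite (B j)" if "j < k" for j
    by (rule finite_subset[OF _ A(1)]) (use that AB in auto)
  have finU: "finite (\<Union>j<k. B j)" and finD: "finite D" using AB(1) A(1) by auto
  have disj: "B i \<inter> B j = {}" if "i < k" "j < k" "i \<noteq> j" for i j :: nat
    using gap[of i j] gap[of j i] that q by (cases i j rule: linorder_cases) force+
  have kle: "real k \<le> real N / real p + 1"
  proof -
    have "real (card A div (p + q)) \<le> real (card A) / real (p + q)" by (rule of_nat_div_le_of_nat)
    also have "\<dots> \<le> real N / real p" using A(2) p by (intro frac_le) auto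
    finally show ?thesis by (simp add: k)
  qed
  define T where "T v = (\<Sum>j<k. \<Sum>x\<in>B j. b x * \<eta> (\<xi> x v))" for v
  have TU: "T v = (\<Sum>x\<in>(\<Union>j<k. B j). b x * \<eta> (\<xi> x v))" for v
    unfolding T_def using finB disj by (subst sum.UNION_disjoint) auto
  have sq_sub: "(\<Sum>x\<in>S. (b x)\<^sup>2) \<le> L" if "S \<subseteq> A" for S
    by (rule order_trans[OF sum_mono2[OF A(1) that] L]) simp
  have bU: "(\<Sum>x\<in>(\<Union>j<k. B j). (b x)\<^sup>2) \<le> L" by (rule sq_sub) (use AB in auto)
  have bD: "(\<Sum>x\<in>D. (b x)\<^sup>2) \<le> \<kappa>\<^sup>2 * ((real N / real p + 1) * real q)"
  proof -
    have "(\<Sum>x\<in>D. (b x)\<^sup>2) \<le> (\<Sum>x\<in>D. \<kappa>\<^sup>2)"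
      using b AB(1) \<kappa> by (intro sum_mono) (auto simp: abs_le_square_iff[symmetric])
    also have "\<dots> = real (card D) * \<kappa>\<^sup>2" by simp
    also have "\<dots> \<le> real (k * q) * \<kappa>\<^sup>2" using D by (intro mult_right_mono) (auto simp del: of_nat_mult)
    also have "\<dots> \<le> ((real N / real p + 1) * real q) * \<kappa>\<^sup>2"
      using kle by (auto intro!: mult_right_mono)
    finally show ?thesis by (simp add: mult.commute)
  qed
  have L2X: "L2 X" unfolding X_def by (intro L2_sum L2_cmult L2_\<xi>)
  have L2T: "L2 T" unfolding T_def by (intro L2_sum L2_cmult L2_lip_\<xi> \<eta>)
  have \<delta>: "l2norm (\<lambda>v. X v - T v) \<le> \<delta>"
  proof -
    \<comment> \<open>Truncation remainder on all of \<open>A\<close>, plus the truncated variables at the discarded points.\<close>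
    have eq: "X v - T v = (\<Sum>x\<in>A. b x * \<rho> (\<xi> x v)) + (\<Sum>x\<in>D. b x * \<eta> (\<xi> x v))" for v
    proof -
      have "X v = (\<Sum>x\<in>A. b x * \<rho> (\<xi> x v)) + (\<Sum>x\<in>A. b x * \<eta> (\<xi> x v))"
        by (simp add: X_def \<rho>_def sum.distrib[symmetric] algebra_simps)
      also have "(\<Sum>x\<in>A. b x * \<eta> (\<xi> x v)) = T v + (\<Sum>x\<in>D. b x * \<eta> (\<xi> x v))"
        unfolding TU by (subst AB(1), rule sum.union_disjoint[OF finU finD AB(2)])
      finally show ?thesis by simp
    qed
    have "l2norm (\<lambda>v. X v - T v) \<le> l2norm (\<lambda>v. \<Sum>x\<in>A. b x * \<rho> (\<xi> x v)) + l2norm (\<lambda>v. \<Sum>x\<in>D. b x * \<eta> (\<xi> x v))"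
      unfolding eq by (intro l2norm_triangle L2_sum L2_cmult L2_lip_\<xi> \<eta> \<rho>)
    also have "\<dots> \<le> \<delta>" unfolding \<delta>_def block_err_def
      by (intro add_mono l2norm_sum_le A(1) finD \<rho> \<rho>0 \<rho>s \<eta> \<eta>0 \<eta>s L bD)
    finally show ?thesis .
  qed
  have \<delta>0: "\<delta> \<ge> 0" by (rule order_trans[OF _ \<delta>]) simp
  have nX: "l2norm X \<le> sqrt V" unfolding X_def V_def by (intro l2norm_sum_le[OF A(1) id _ _ L]) (use E0 in auto)
  have nT: "l2norm T \<le> sqrt V" unfolding TU V_def by (intro l2norm_sum_le[OF finU \<eta> \<eta>0 \<eta>s bU])
  have bB: "\<bar>b x\<bar> \<le> \<kappa>" if "j < k" "x \<in> B j" for j x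
    using b that AB(1) by blast
  let ?e1 = "\<bar>t\<bar> * \<delta>" and ?e2 = "(real N / real p + 1) * (4 * \<bar>t\<bar> * \<kappa> * real p * (C * real q powr (-3/2)))
       + (\<bar>t\<bar> ^ 3 * \<beta> / 6 + t ^ 4 * \<beta>\<^sup>2 / 8) * V
       + t\<^sup>2 * (L * (\<Sum>r. cov_bound ?s (r + q)))" and ?e3 = "t\<^sup>2 * (\<delta> * sqrt V)"
  have 1: "cmod (cf t X - cf t T) \<le> ?e1"
    using char_diff_le[OF L2X L2T, of t] mult_left_mono[OF \<delta>, of "\<bar>t\<bar>"] by (rule order_trans) simp
  have 2: "cmod (cf t T - exp (- (t\<^sup>2 * moment2 T / 2))) \<le> ?e2"
  proof -
    have "cmod (cf t T - exp (- (t\<^sup>2 * moment2 T / 2)))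
       \<le> real k * (4 * \<bar>t\<bar> * \<kappa> * real p * (C * real q powr (-3/2)))
       + (\<bar>t\<bar> ^ 3 * \<beta> / 6 + t ^ 4 * \<beta>\<^sup>2 / 8) * (L * var_const ?s)
       + t\<^sup>2 * (L * (\<Sum>r. cov_bound ?s (r + q)))"
      unfolding T_def
      by (rule char_blocks_gauss[where q = q and K = "2 * K"])
         (fact finB Bp gap q \<eta> \<eta>0 \<eta>s \<eta>K bB \<kappa> bU meta_eq_to_obj_eq[OF \<beta>_def])+
    also have "\<dots> \<le> ?e2" unfolding V_def
      using kle \<kappa> C_nonneg by (intro add_mono mult_right_mono order_refl) auto
    finally show ?thesis .
  qed
  have 3: "cmod (exp (- (t\<^sup>2 * moment2 T / 2)) - complex_of_real (exp (- (t\<^sup>2 * moment2 X / 2)))) \<le> ?e3"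
  proof -
    have "cmod (complex_of_real (exp (- (t\<^sup>2 * moment2 T / 2))) - complex_of_real (exp (- (t\<^sup>2 * moment2 X / 2))))
      = \<bar>exp (- (t\<^sup>2 * moment2 T / 2)) - exp (- (t\<^sup>2 * moment2 X / 2))\<bar>"
      by (metis norm_of_real of_real_diff)
    also have "\<dots> \<le> \<bar>t\<^sup>2 * moment2 T / 2 - t\<^sup>2 * moment2 X / 2\<bar>"
      by (rule exp_minus_diff_le) auto
    also have "\<dots> = t\<^sup>2 / 2 * \<bar>moment2 X - moment2 T\<bar>"
      by (subst abs_minus_commute) (simp add: right_diff_distrib[symmetric] diff_divide_distrib[symmetric] abs_mult)
    also have "\<dots> \<le> t\<^sup>2 / 2 * (l2norm (\<lambda>v. X v - T v) * (l2norm X + l2norm T))"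
      by (intro mult_left_mono second_moment_diff_le L2X L2T) simp
    also have "\<dots> \<le> t\<^sup>2 / 2 * (\<delta> * (sqrt V + sqrt V))"
      using \<delta> \<delta>0 nX nT by (intro mult_left_mono mult_mono add_mono) auto
    finally show ?thesis by simp
  qed
  have tri: "cmod (w - z) \<le> e\<^sub>1 + e\<^sub>2 + e\<^sub>3"
    if "cmod (w - x) \<le> e\<^sub>1" "cmod (x - y) \<le> e\<^sub>2" "cmod (y - z) \<le> e\<^sub>3" for w x y z e\<^sub>1 e\<^sub>2 e\<^sub>3
    using norm_diff_triangle_le[OF norm_diff_triangle_le[OF that(1,2)] that(3)] .
  show ?thesis by (rule tri[OF 1 2 3])
qed

lemma cov_bound_tail_tendsto: "(\<lambda>q. \<Sum>r. cov_bound s (r + q)) \<longlonglongrightarrow> 0"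
proof -
  have sm: "summable (cov_bound s)" using summable_cov_bound[of s 0] by simp
  have "(\<lambda>q. (\<Sum>r. cov_bound s r) - (\<Sum>r<q. cov_bound s r)) \<longlonglongrightarrow> (\<Sum>r. cov_bound s r) - (\<Sum>r. cov_bound s r)"
    by (intro tendsto_diff tendsto_const summable_LIMSEQ sm)
  then show ?thesis by (simp add: suminf_minus_initial_segment[OF sm])
qed

text \<open>
The exponents solve the constraints of Bernstein's method: with weights \<open>n\<^bsup>-0.49\<^esup>\<close>, blocks of length
\<open>p\<close>, gaps of length \<open>q\<close> and truncation at \<open>K\<close>, one needs
\<open>n\<^bsup>0.51\<^esup> q\<^bsup>-3/2\<^esup>\<close>, \<open>n\<^bsup>0.02\<^esup> q / p\<close> and \<open>n\<^bsup>-0.49\<^esup> p K\<close> to tend to \<open>0\<close> while \<open>K\<close> tends to infinity.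
\<close>

theorem weighted_sum_char_gauss:
  fixes A :: "nat \<Rightarrow> int set" and b :: "nat \<Rightarrow> int \<Rightarrow> real"
  assumes E0: "expectation (\<xi> 0) = 0"
    and A: "\<And>n. finite (A n)" "\<And>n. card (A n) \<le> Suc n"
    and b: "\<forall>\<^sub>F n in sequentially. \<forall>x\<in>A n. \<bar>b n x\<bar> \<le> real n powr (-49/100)"
    and L: "\<forall>\<^sub>F n in sequentially. (\<Sum>x\<in>A n. (b n x)\<^sup>2) \<le> L"
  defines "X \<equiv> \<lambda>n v. \<Sum>x\<in>A n. b n x * \<xi> x v"
  shows "(\<lambda>n. cf t (X n) - exp (- (t\<^sup>2 * moment2 (X n) / 2))) \<longlonglongrightarrow> 0"
proof -
  define p where "p n = nat \<lceil>real n powr (46/100)\<rceil>" for n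
  define q where "q n = nat \<lceil>real n powr (4/10)\<rceil>" for n
  define \<kappa> where "\<kappa> n = real n powr (-49/100)" for n
  define K where "K n = real n powr (1/100)" for n
  define V where "V = L * var_const (l2norm (\<xi> 0))"
  define \<beta> where "\<beta> n = \<kappa> n * real (p n) * (2 * K n)" for n
  define \<delta> where "\<delta> n = block_err L (\<kappa> n) (Suc n) (p n) (q n) (K n)" for n
  define a where "a n = (real (Suc n) / real (p n) + 1) * (\<kappa> n * real (p n) * real (q n) powr (-3/2))" for n
  define \<tau> where "\<tau> n = (\<Sum>r. cov_bound (l2norm (\<xi> 0)) (r + q n))" for n
  have a0: "a \<longlonglongrightarrow> 0" unfolding a_def \<kappa>_def p_def q_def by real_asymp
  have \<beta>0: "\<beta> \<longlonglongrightarrow> 0" unfolding \<beta>_def \<kappa>_def p_def K_def by real_asymp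
  have w0: "(\<lambda>n. (\<kappa> n)\<^sup>2 * ((real (Suc n) / real (p n) + 1) * real (q n))) \<longlonglongrightarrow> 0"
    unfolding \<kappa>_def p_def q_def by real_asymp
  have "filterlim q at_top sequentially" unfolding q_def by real_asymp
  then have \<tau>0: "\<tau> \<longlonglongrightarrow> 0" unfolding \<tau>_def by (rule filterlim_compose[OF cov_bound_tail_tendsto])
  have "filterlim K at_top sequentially" unfolding K_def by real_asymp
  then have e0: "(\<lambda>n. trunc_err (K n)) \<longlonglongrightarrow> 0"
    by (rule filterlim_compose[OF trunc_err_tendsto[OF E0]])
  have "(\<lambda>n. L * var_const (trunc_err (K n))) \<longlonglongrightarrow> L * (2 * 0\<^sup>2 + 2 * 0 * C * (\<Sum>r. real r powr (-3/2)))"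
    unfolding var_const_eq by (intro tendsto_intros e0)
  then have "(\<lambda>n. sqrt (L * var_const (trunc_err (K n)))
        + sqrt ((\<kappa> n)\<^sup>2 * ((real (Suc n) / real (p n) + 1) * real (q n)) * var_const (l2norm (\<xi> 0))))
      \<longlonglongrightarrow> sqrt 0 + sqrt (0 * var_const (l2norm (\<xi> 0)))"
    by (intro tendsto_add tendsto_real_sqrt tendsto_mult w0 tendsto_const) simp
  then have \<delta>0: "\<delta> \<longlonglongrightarrow> 0" unfolding \<delta>_def block_err_def by simp
  define err where "err n = \<bar>t\<bar> * \<delta> n + (4 * \<bar>t\<bar> * C * a n
       + (\<bar>t\<bar> ^ 3 * \<beta> n / 6 + t ^ 4 * (\<beta> n)\<^sup>2 / 8) * V + t\<^sup>2 * (L * \<tau> n)) + t\<^sup>2 * (\<delta> n * sqrt V)" for n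
  have "err \<longlonglongrightarrow> \<bar>t\<bar> * 0 + (4 * \<bar>t\<bar> * C * 0
       + (\<bar>t\<bar> ^ 3 * 0 / 6 + t ^ 4 * 0\<^sup>2 / 8) * V + t\<^sup>2 * (L * 0)) + t\<^sup>2 * (0 * sqrt V)"
    unfolding err_def by (intro tendsto_intros \<delta>0 a0 \<beta>0 \<tau>0) auto
  then have err0: "err \<longlonglongrightarrow> 0" by simp
  show ?thesis
  proof (rule Lim_null_comparison[OF _ err0])
    show "\<forall>\<^sub>F n in sequentially. norm (cf t (X n) - exp (- (t\<^sup>2 * moment2 (X n) / 2))) \<le> err n"
      using b L eventually_ge_at_top[of 1]
    proof eventually_elim
      case (elim n)
      have pq: "p n \<ge> 1" "q n \<ge> 1" using elim(3) by (auto simp: p_def q_def Suc_le_eq)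
      have "cmod (expectation (\<lambda>v. iexp (t * (\<Sum>x\<in>A n. b n x * \<xi> x v))) - exp (- (t\<^sup>2 * expectation (\<lambda>v. (\<Sum>x\<in>A n. b n x * \<xi> x v)\<^sup>2) / 2)))
       \<le> \<bar>t\<bar> * \<delta> n + ((real (Suc n) / real (p n) + 1) * (4 * \<bar>t\<bar> * \<kappa> n * real (p n) * (C * real (q n) powr (-3/2)))
       + (\<bar>t\<bar> ^ 3 * \<beta> n / 6 + t ^ 4 * (\<beta> n)\<^sup>2 / 8) * V
       + t\<^sup>2 * (L * \<tau> n)) + t\<^sup>2 * (\<delta> n * sqrt V)"
        unfolding \<delta>_def \<beta>_def V_def \<tau>_def
        by (rule char_weighted_sum_gauss[OF A _ _ elim(2) pq _ E0])
           (use elim in \<open>auto simp: \<kappa>_def K_def\<close>)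
      also have "\<dots> = err n" by (simp add: err_def a_def mult_ac)
      finally show ?case unfolding X_def by simp
    qed
  qed
qed

end

section \<open>Central limit theorem along a sampled path\<close>

text \<open>
The centred normal law is the image of the standard one under scaling by \<open>\<sigma>\<close>.
\<close>

lemma char_normal:
  assumes "\<sigma> > 0"
  shows "char (density lborel (\<lambda>t. ennreal (normal_density 0 \<sigma> t))) t = exp (- (t\<^sup>2 * \<sigma>\<^sup>2 / 2))"
proof -
  interpret prob_space std_normal_distribution by (rule prob_space_normal_density) simp
  have "distributed std_normal_distribution lborel (\<lambda>x. x) (\<lambda>x. ennreal (std_normal_density x))"
    unfolding distributed_def by (auto intro!: measure_eqI simp: emeasure_distr)
  from normal_density_affine[OF this, of \<sigma> 0] assms
  have "distributed std_normal_distribution lborel (\<lambda>x. \<sigma> * x) (\<lambda>x. ennreal (normal_density 0 \<sigma> x))" by simp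
  then have eq: "distr std_normal_distribution lborel (\<lambda>x. \<sigma> * x) = density lborel (\<lambda>t. ennreal (normal_density 0 \<sigma> t))"
    by (rule distributed_distr_eq_density)
  have "char (density lborel (\<lambda>t. ennreal (normal_density 0 \<sigma> t))) t = (CLINT x|std_normal_distribution. iexp (t * (\<sigma> * x)))"
    unfolding char_def eq[symmetric] by (subst integral_distr) auto
  also have "\<dots> = char std_normal_distribution (t * \<sigma>)" by (simp add: char_def mult.assoc)
  also have "\<dots> = exp (- (t\<^sup>2 * \<sigma>\<^sup>2 / 2))" by (simp add: char_std_normal_distribution power_mult_distrib)
  finally show ?thesis .
qed

definition occ :: "(nat \<Rightarrow> int) \<Rightarrow> nat \<Rightarrow> int \<Rightarrow> nat" where
  "occ s n x = card {l\<in>{..n}. s l = x}"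

lemma sum_occ:
  fixes h :: "int \<Rightarrow> real"
  shows "(\<Sum>k\<le>n. h (s k)) = (\<Sum>x\<in>s ` {..n}. real (occ s n x) * h x)"
proof -
  have "(\<Sum>k\<le>n. h (s k)) = (\<Sum>x\<in>s ` {..n}. \<Sum>k\<in>{l\<in>{..n}. s l = x}. h (s k))"
    by (rule sum.image_gen) simp
  also have "\<dots> = (\<Sum>x\<in>s ` {..n}. real (occ s n x) * h x)"
    by (intro sum.cong refl) (simp add: occ_def)
  finally show ?thesis .
qed

lemma sum_occ_sq: "(\<Sum>x\<in>s ` {..n}. (real (occ s n x))\<^sup>2) = (\<Sum>k<Suc n. \<Sum>l<Suc n. if s l - s k = 0 then 1 else 0)"
proof -
  have "(\<Sum>k<Suc n. \<Sum>l<Suc n. if s l - s k = 0 then (1::real) else 0) = (\<Sum>k\<le>n. real (occ s n (s k)))"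
    unfolding lessThan_Suc_atMost
  proof (intro sum.cong refl)
    fix k
    have "(\<Sum>l\<le>n. if s l - s k = 0 then (1::real) else 0) = (\<Sum>l\<in>{l\<in>{..n}. s l = s k}. 1)"
      by (subst sum.inter_filter) auto
    then show "(\<Sum>l\<le>n. if s l - s k = 0 then (1::real) else 0) = real (occ s n (s k))" by (simp add: occ_def)
  qed
  also have "\<dots> = (\<Sum>x\<in>s ` {..n}. (real (occ s n x))\<^sup>2)"
    unfolding sum_occ[where h = "\<lambda>x. real (occ s n x)"] by (simp add: power2_eq_square)
  finally show ?thesis by simp
qed

lemma tendsto_average_shift:
  fixes u :: "nat \<Rightarrow> real"
  assumes "(\<lambda>m. u m / real m) \<longlonglongrightarrow> r"
  shows "(\<lambda>n. u (Suc n) / real n) \<longlonglongrightarrow> r"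
proof -
  have "(\<lambda>n. real (Suc n) / real n) \<longlonglongrightarrow> 1" by real_asymp
  from tendsto_mult[OF LIMSEQ_Suc[OF assms] this]
  have "(\<lambda>n. u (Suc n) / real (Suc n) * (real (Suc n) / real n)) \<longlonglongrightarrow> r" by simp
  then show ?thesis by (simp del: of_nat_Suc)
qed

context theta_decaying
begin

text \<open>
A path is deterministic here. The hypothesis \<open>self\<close> bounds the sum of the squared weights,
\<open>var\<close> identifies the limiting variance, and \<open>occ\<close> makes every weight at most \<open>n\<^bsup>-0.49\<^esup>\<close>.
\<close>

theorem sampled_clt:
  fixes s :: "nat \<Rightarrow> int" and c :: "int \<Rightarrow> real"
  assumes E0: "expectation (\<xi> 0) = 0"
    and stat: "\<And>x y. expectation (\<lambda>v. \<xi> x v * \<xi> y v) = c (y - x)"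
    and occ: "\<forall>\<^sub>F n in sequentially. \<forall>x. real (occ s n x) \<le> real n powr (1/100)"
    and self: "(\<lambda>m. (\<Sum>k<m. \<Sum>l<m. if s l - s k = 0 then 1 else 0) / real m) \<longlonglongrightarrow> R"
    and var: "(\<lambda>m. (\<Sum>k<m. \<Sum>l<m. c (s l - s k)) / real m) \<longlonglongrightarrow> V" and V: "V > 0"
  shows "weak_conv_m (\<lambda>n. distr M borel (\<lambda>v. (1 / sqrt (real n)) * (\<Sum>k=0..n. \<xi> (s k) v)))
           (density lborel (\<lambda>t. ennreal (normal_density 0 (sqrt V) t)))"
proof (rule levy_continuity)
  define A where "A n = s ` {..n}" for n
  define b where "b n x = real (occ s n x) / sqrt (real n)" for n x
  define X where "X n v = (\<Sum>x\<in>A n. b n x * \<xi> x v)" for n v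
  have Xeq: "(1 / sqrt (real n)) * (\<Sum>k=0..n. \<xi> (s k) v) = X n v" for n v
    unfolding atLeast0AtMost sum_occ[where h = "\<lambda>x. \<xi> x v"] X_def A_def b_def
    by (simp add: sum_distrib_left)
  have [measurable]: "X n \<in> borel_measurable M" for n unfolding X_def by measurable
  have sq: "(\<Sum>x\<in>A n. (b n x)\<^sup>2) = (\<Sum>k<Suc n. \<Sum>l<Suc n. if s l - s k = 0 then 1 else 0) / real n" for n
    unfolding sum_occ_sq[symmetric] A_def b_def by (simp add: power_divide sum_divide_distrib)
  have L: "\<forall>\<^sub>F n in sequentially. (\<Sum>x\<in>A n. (b n x)\<^sup>2) \<le> R + 1"
  proof -
    have "(\<lambda>n. \<Sum>x\<in>A n. (b n x)\<^sup>2) \<longlonglongrightarrow> R"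
      unfolding sq by (rule tendsto_average_shift[where u = "\<lambda>m. \<Sum>k<m. \<Sum>l<m. if s l - s k = 0 then 1 else 0", OF self])
    then have "\<forall>\<^sub>F n in sequentially. (\<Sum>x\<in>A n. (b n x)\<^sup>2) < R + 1" by (rule order_tendstoD) simp
    then show ?thesis by eventually_elim simp
  qed
  have vX: "moment2 (X n) = (\<Sum>k<Suc n. \<Sum>l<Suc n. c (s l - s k)) / real n" for n
  proof -
    have "moment2 (X n) = expectation (\<lambda>v. (\<Sum>k<Suc n. \<Sum>l<Suc n. \<xi> (s k) v * \<xi> (s l) v) / real n)"
      by (intro Bochner_Integration.integral_cong refl)
         (simp only: Xeq[symmetric], simp add: power_mult_distrib power_divide power2_eq_square[of "sum _ _"] sum_product
           atLeast0AtMost lessThan_Suc_atMost del: sum.lessThan_Suc sum.atMost_Suc)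
    also have "\<dots> = (\<Sum>k<Suc n. \<Sum>l<Suc n. c (s l - s k)) / real n"
    proof -
      have i: "integrable M (\<lambda>v. \<xi> x v * \<xi> y v)" for x y by (intro L2_integrable_mult L2_\<xi>)
      have "expectation (\<lambda>v. \<Sum>k<Suc n. \<Sum>l<Suc n. \<xi> (s k) v * \<xi> (s l) v) = (\<Sum>k<Suc n. \<Sum>l<Suc n. c (s l - s k))"
        using i stat by (subst Bochner_Integration.integral_sum, force, subst Bochner_Integration.integral_sum)
          (auto simp del: sum.lessThan_Suc)
      then show ?thesis by (simp del: sum.lessThan_Suc)
    qed
    finally show ?thesis .
  qed
  have varX: "(\<lambda>n. moment2 (X n)) \<longlonglongrightarrow> V"
    unfolding vX by (rule tendsto_average_shift[where u = "\<lambda>m. \<Sum>k<m. \<Sum>l<m. c (s l - s k)", OF var])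
  have bb: "\<forall>\<^sub>F n in sequentially. \<forall>x\<in>A n. \<bar>b n x\<bar> \<le> real n powr (-49/100)"
    using occ eventually_ge_at_top[of 1]
  proof eventually_elim
    case (elim n)
    show ?case
    proof
      fix x
      have "\<bar>b n x\<bar> \<le> real n powr (1/100) / sqrt (real n)"
        using elim by (simp add: b_def divide_right_mono)
      also have "\<dots> = real n powr (1/100) / real n powr (1/2)" by (simp add: powr_half_sqrt)
      also have "\<dots> = real n powr (-49/100)" by (simp add: powr_diff[symmetric])
      finally show "\<bar>b n x\<bar> \<le> real n powr (-49/100)" .
    qed
  qed
  fix t
  have "(\<lambda>n. cf t (X n) - exp (- (t\<^sup>2 * moment2 (X n) / 2))) \<longlonglongrightarrow> 0"
    unfolding X_def
    by (rule weighted_sum_char_gauss[OF E0 _ _ bb L]) 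
       (auto simp: A_def intro: order_trans[OF card_image_le])
  moreover have "(\<lambda>n. complex_of_real (exp (- (t\<^sup>2 * moment2 (X n) / 2)))) \<longlonglongrightarrow> exp (- (t\<^sup>2 * V / 2))"
    by (intro tendsto_intros varX) simp
  ultimately have "(\<lambda>n. cf t (X n)) \<longlonglongrightarrow> exp (- (t\<^sup>2 * V / 2))"
    using tendsto_add by fastforce
  moreover have "char (distr M borel (X n)) t = cf t (X n)" for n
    unfolding char_def by (subst integral_distr) auto
  ultimately show "(\<lambda>n. char (distr M borel (\<lambda>v. (1 / sqrt (real n)) * (\<Sum>k=0..n. \<xi> (s k) v))) t)
      \<longlonglongrightarrow> char (density lborel (\<lambda>t. ennreal (normal_density 0 (sqrt V) t))) t"
    using V unfolding Xeq by (simp add: char_normal)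
next
  show "real_distribution (density lborel (\<lambda>t. ennreal (normal_density 0 (sqrt V) t)))"
    using V prob_space_normal_density[of "sqrt V" 0] unfolding real_distribution_def real_distribution_axioms_def by simp
  show "real_distribution (distr M borel (\<lambda>v. (1 / sqrt (real n)) * (\<Sum>k=0..n. \<xi> (s k) v)))" for n
    by (rule real_distribution_distr) measurable
qed

end

section \<open>Random walk as a shift on sequence space\<close>

lemma card_insert_le': "card (insert a A) \<le> Suc (card A)"
  by (cases "finite A") (auto simp: card_insert_if)
locale int_walk = sequence_space D for D :: "int measure" +
  assumes sets_D: "sets D = UNIV"
begin

definition W :: "nat \<Rightarrow> (nat \<Rightarrow> int) \<Rightarrow> int" where "W n w = (\<Sum>i<n. w i)"

definition shiftn :: "nat \<Rightarrow> (nat \<Rightarrow> int) \<Rightarrow> nat \<Rightarrow> int" where "shiftn k w = (\<lambda>i. w (i + k))"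

lemma space_D: "space D = UNIV"
  using sets_D sets.sets_into_space[of UNIV D] by auto

lemma space_S: "space S = UNIV"
  by (simp add: space_PiM space_D)

lemma W_0[simp]: "W 0 w = 0" by (simp add: W_def)

lemma W_shift: "W l (shiftn k w) = W (k + l) w - W k w"
proof -
  have "W (k + l) w = W k w + (\<Sum>i<l. w (i + k))"
    unfolding W_def by (induction l) (auto simp: add_ac)
  then show ?thesis by (simp add: W_def shiftn_def)
qed

lemma shiftn_shiftn: "shiftn l (shiftn k w) = shiftn (k + l) w"
  by (simp add: shiftn_def add_ac)

lemma shiftn_0[simp]: "shiftn 0 w = w" by (simp add: shiftn_def)

lemma W_cong: "(\<And>i. i < k \<Longrightarrow> w i = w' i) \<Longrightarrow> n \<le> k \<Longrightarrow> W n w = W n w'"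
  unfolding W_def by (intro sum.cong) auto

lemma shiftn_measurable[measurable]: "shiftn k \<in> measurable S S"
  unfolding shiftn_def by (rule measurable_abs_UNIV) simp

lemma W_measurable[measurable]: "W n \<in> measurable S (count_space UNIV)"
proof (induction n)
  case (Suc n)
  have s: "sets D = sets (count_space UNIV)" by (simp add: sets_D)
  have c: "(\<lambda>w. w n) \<in> measurable S (count_space UNIV)"
    using measurable_component_singleton[of n UNIV "\<lambda>_. D"] unfolding measurable_cong_sets[OF refl s] by simp
  have "(\<lambda>w. (\<lambda>i w. i + w n) (W n w) w) \<in> measurable S (count_space UNIV)"
    by (rule measurable_compose_countable[OF _ Suc]) (rule measurable_compose[OF c], simp)
  then show ?case by (simp add: W_def add.commute)
qed (simp add: W_def)

lemma shiftn_comb_seq: "shiftn k (comb_seq k w w') = w'"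
  by (auto simp: shiftn_def comb_seq_add)

text \<open>
The first \<open>k\<close> increments are independent of the shifted sequence: the product measure is
the law of the concatenation \<open>comb_seq k w w'\<close> of two independent sequences.
\<close>

lemma integral_split:
  fixes F G :: "(nat \<Rightarrow> int) \<Rightarrow> real"
  assumes [measurable]: "F \<in> borel_measurable S" "G \<in> borel_measurable S"
    and F: "\<And>w. \<bar>F w\<bar> \<le> a" and G: "\<And>w. \<bar>G w\<bar> \<le> b"
    and dep: "\<And>w w'. (\<And>i. i < k \<Longrightarrow> w i = w' i) \<Longrightarrow> F w = F w'"
  shows "(\<integral>w. F w * G (shiftn k w) \<partial>S) = (\<integral>w. F w \<partial>S) * (\<integral>w. G w \<partial>S)"
proof -
  interpret SS: pair_prob_space S S ..
  have Fc: "F (comb_seq k w w') = F w" for w w' by (rule dep) (simp add: comb_seq_less)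
  have "(\<integral>w. F w * G (shiftn k w) \<partial>S) = (\<integral>w. F w * G (shiftn k w) \<partial>distr (S \<Otimes>\<^sub>M S) S (\<lambda>(w, w'). comb_seq k w w'))"
    by (simp add: PiM_comb_seq)
  also have "\<dots> = (\<integral>p. F (fst p) * G (snd p) \<partial>(S \<Otimes>\<^sub>M S))"
    by (subst integral_distr) (auto simp: Fc shiftn_comb_seq split_beta' measurable_comb_seq[unfolded split_beta'])
  also have "\<dots> = (\<integral>w. \<integral>w'. F w * G w' \<partial>S \<partial>S)"
  proof -
    have "integrable (S \<Otimes>\<^sub>M S) (\<lambda>(w, w'). F w * G w')"
    proof (rule SS.integrable_const_bound[where B = "a * b"])
      show "AE p in S \<Otimes>\<^sub>M S. norm (case p of (w, w') \<Rightarrow> F w * G w') \<le> a * b"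
        using F G order_trans[OF abs_ge_zero F] by (intro AE_I2) (auto simp: abs_mult intro!: mult_mono)
    qed measurable
    from SS.integral_fst[OF this] show ?thesis by (simp add: split_beta')
  qed
  also have "\<dots> = (\<integral>w. F w \<partial>S) * (\<integral>w. G w \<partial>S)" by simp
  finally show ?thesis .
qed

lemma integral_shift:
  fixes G :: "(nat \<Rightarrow> int) \<Rightarrow> real"
  assumes "G \<in> borel_measurable S" "\<And>w. \<bar>G w\<bar> \<le> b"
  shows "(\<integral>w. G (shiftn k w) \<partial>S) = (\<integral>w. G w \<partial>S)"
  using integral_split[of "\<lambda>_. 1" G 1 b k] assms by (simp add: P.prob_space)

lemma prob_split:
  assumes [measurable]: "Measurable.pred S A" "Measurable.pred S B"
    and dep: "\<And>w w'. (\<And>i. i < k \<Longrightarrow> w i = w' i) \<Longrightarrow> A w = A w'"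
  shows "\<P>(w in S. A w \<and> B (shiftn k w)) = \<P>(w in S. A w) * \<P>(w in S. B w)"
proof -
  have sets: "{w. A w} \<in> sets S" "{w. B w} \<in> sets S"
    using assms(1,2) by (simp_all add: pred_def space_S)
  have "(\<integral>w. indicator {w. A w} w * indicator {w. B w} (shiftn k w) \<partial>S)
      = (\<integral>w. indicat_real {w. A w} w \<partial>S) * (\<integral>w. indicat_real {w. B w} w \<partial>S)"
  proof (rule integral_split[where a = 1 and b = 1])
    show "indicat_real {w. A w} w = indicat_real {w. A w} w'" if "\<And>i. i < k \<Longrightarrow> w i = w' i" for w w'
      using dep[OF that] by (simp add: indicator_def)
  qed (use sets in \<open>simp_all add: indicator_def\<close>)
  moreover have "(\<lambda>w. indicator {w. A w} w * indicator {w. B w} (shiftn k w)) = indicat_real {w. A w \<and> B (shiftn k w)}"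
    by (auto simp: indicator_def)
  ultimately show ?thesis by (simp add: space_S)
qed

lemma prob_shift:
  assumes "Measurable.pred S B"
  shows "\<P>(w in S. B (shiftn k w)) = \<P>(w in S. B w)"
  using prob_split[of "\<lambda>_. True" B k] assms by (simp add: P.prob_space)

section \<open>Returns to the starting point\<close>

definition first_ret :: "nat \<Rightarrow> (nat \<Rightarrow> int) \<Rightarrow> bool" where
  "first_ret \<tau> w \<longleftrightarrow> \<tau> \<ge> 1 \<and> W \<tau> w = 0 \<and> (\<forall>i. 0 < i \<and> i < \<tau> \<longrightarrow> W i w \<noteq> 0)"

text \<open>
Counts returns one at a time: the recursion runs through the first return, so that the events
for different \<open>\<tau>\<close> are disjoint and their probabilities add up.
\<close>

primrec returns :: "nat \<Rightarrow> (nat \<Rightarrow> int) \<Rightarrow> bool" where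
  "returns 0 w = True"
| "returns (Suc m) w = (\<exists>\<tau>. first_ret \<tau> w \<and> returns m (shiftn \<tau> w))"

definition \<rho> :: real where "\<rho> = \<P>(w in S. \<exists>n\<ge>1. W n w = 0)"

lemma first_ret_measurable[measurable]: "Measurable.pred S (first_ret \<tau>)"
  unfolding first_ret_def by measurable

lemma returns_measurable[measurable]: "Measurable.pred S (returns m)"
proof (induction m)
  case (Suc m)
  note [measurable] = Suc
  show ?case unfolding returns.simps by measurable
qed simp

lemma first_ret_unique: "first_ret \<tau> w \<Longrightarrow> first_ret \<tau>' w \<Longrightarrow> \<tau> = \<tau>'"
  unfolding first_ret_def by (rule linorder_cases[of \<tau> \<tau>']) (auto simp: Suc_le_eq)

lemma ex_first_ret: "(\<exists>\<tau>. first_ret \<tau> w) \<longleftrightarrow> (\<exists>n\<ge>1. W n w = 0)"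
proof
  assume "\<exists>n\<ge>1. W n w = 0"
  then have ex: "\<exists>n. n \<ge> 1 \<and> W n w = 0" by blast
  let ?\<tau> = "LEAST n. n \<ge> 1 \<and> W n w = 0"
  have "first_ret ?\<tau> w"
    unfolding first_ret_def
  proof (intro conjI allI impI)
    show "?\<tau> \<ge> 1" "W ?\<tau> w = 0" using LeastI_ex[OF ex] by blast+
    show "W i w \<noteq> 0" if "0 < i \<and> i < ?\<tau>" for i
      using not_less_Least[OF conjunct2[OF that]] that by simp
  qed
  then show "\<exists>\<tau>. first_ret \<tau> w" by blast
qed (auto simp: first_ret_def)

text \<open>
The strong Markov property at the first return: \<open>first_ret \<tau>\<close> depends on the first \<open>\<tau>\<close>
increments only, and the walk starts afresh after time \<open>\<tau>\<close>.
\<close>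

lemma prob_returns_le: "\<P>(w in S. returns m w) \<le> \<rho> ^ m"
proof (induction m)
  case 0
  then show ?case by simp
next
  case (Suc m)
  have d1: "disjoint_family (\<lambda>\<tau>. {w \<in> space S. first_ret \<tau> w \<and> returns m (shiftn \<tau> w)})"
    and d2: "disjoint_family (\<lambda>\<tau>. {w \<in> space S. first_ret \<tau> w})"
    by (auto simp: disjoint_family_on_def dest: first_ret_unique)
  have 1: "(\<lambda>\<tau>. \<P>(w in S. first_ret \<tau> w \<and> returns m (shiftn \<tau> w))) sums \<P>(w in S. returns (Suc m) w)"
  proof -
    have "(\<lambda>\<tau>. \<P>(w in S. first_ret \<tau> w \<and> returns m (shiftn \<tau> w)))
        sums measure S (\<Union>\<tau>. {w \<in> space S. first_ret \<tau> w \<and> returns m (shiftn \<tau> w)})"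
      by (rule P.finite_measure_UNION) (use d1 in auto)
    moreover have "(\<Union>\<tau>. {w \<in> space S. first_ret \<tau> w \<and> returns m (shiftn \<tau> w)}) = {w \<in> space S. returns (Suc m) w}"
      by auto
    ultimately show ?thesis by metis
  qed
  have 2: "(\<lambda>\<tau>. \<P>(w in S. first_ret \<tau> w)) sums \<rho>"
  proof -
    have "(\<lambda>\<tau>. \<P>(w in S. first_ret \<tau> w)) sums measure S (\<Union>\<tau>. {w \<in> space S. first_ret \<tau> w})"
      by (rule P.finite_measure_UNION) (use d2 in auto)
    moreover have "(\<Union>\<tau>. {w \<in> space S. first_ret \<tau> w}) = {w \<in> space S. \<exists>n\<ge>1. W n w = 0}"
      using ex_first_ret by auto
    ultimately show ?thesis unfolding \<rho>_def by metis
  qed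
  have 3: "(\<lambda>\<tau>. \<P>(w in S. first_ret \<tau> w \<and> returns m (shiftn \<tau> w)))
      = (\<lambda>\<tau>. \<P>(w in S. first_ret \<tau> w) * \<P>(w in S. returns m w))"
  proof (rule ext, rule prob_split[OF first_ret_measurable returns_measurable])
    fix \<tau> :: nat and w w' :: "nat \<Rightarrow> int" assume eq: "\<And>i. i < \<tau> \<Longrightarrow> w i = w' i"
    have "W n w = W n w'" if "n \<le> \<tau>" for n by (rule W_cong[OF eq that])
    then show "first_ret \<tau> w = first_ret \<tau> w'" unfolding first_ret_def by auto
  qed
  have "\<P>(w in S. returns (Suc m) w) = \<rho> * \<P>(w in S. returns m w)"
    by (rule sums_unique2[OF 1[unfolded 3] sums_mult2[OF 2]])
  also have "\<dots> \<le> \<rho> * \<rho> ^ m" using Suc by (intro mult_left_mono) (auto simp: \<rho>_def)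
  finally show ?case by simp
qed

lemma visits_le_returns:
  assumes "\<not> returns m (shiftn k w)"
  shows "card {l\<in>{k..n}. W l w = W k w} \<le> m"
  using assms
proof (induction m arbitrary: k)
  case (Suc m)
  let ?V = "\<lambda>k. {l\<in>{k..n}. W l w = W k w}"
  show ?case
  proof (cases "\<exists>l>k. l \<le> n \<and> W l w = W k w")
    case False
    then have "?V k \<subseteq> {k}" by (auto simp: le_less)
    then have "card (?V k) \<le> card {k}" by (rule card_mono[rotated]) simp
    then show ?thesis by (rule order_trans) simp
  next
    case True
    then obtain l where "k < l" "W l w = W k w" by blast
    then have "l - k \<ge> 1 \<and> W (l - k) (shiftn k w) = 0" by (simp add: W_shift)
    then obtain \<tau> where \<tau>: "first_ret \<tau> (shiftn k w)" using ex_first_ret[of "shiftn k w"] by blast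
    have ret: "\<tau> \<ge> 1" "W (k + \<tau>) w = W k w"
      using \<tau> unfolding first_ret_def W_shift by simp_all
    have no: "W (k + i) w \<noteq> W k w" if "0 < i" "i < \<tau>" for i
      using \<tau> that unfolding first_ret_def W_shift by simp
    have "\<not> returns m (shiftn \<tau> (shiftn k w))" using Suc.prems \<tau> unfolding returns.simps by blast
    then have "\<not> returns m (shiftn (k + \<tau>) w)" unfolding shiftn_shiftn .
    from Suc.IH[OF this] have IH: "card (?V (k + \<tau>)) \<le> m" .
    have "?V k \<subseteq> insert k (?V (k + \<tau>))"
    proof
      fix l assume l: "l \<in> ?V k"
      show "l \<in> insert k (?V (k + \<tau>))"
      proof (cases "l = k \<or> k + \<tau> \<le> l")
        case False
        then have "0 < l - k" "l - k < \<tau>" and kl: "k + (l - k) = l" using l by auto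
        then show ?thesis using no[of "l - k"] l by simp
      next
        case True
        then show ?thesis using l ret(2) by simp
      qed
    qed
    then have "card (?V k) \<le> card (insert k (?V (k + \<tau>)))" by (rule card_mono[rotated]) simp
    also have "\<dots> \<le> Suc (card (?V (k + \<tau>)))" by (rule card_insert_le')
    also have "\<dots> \<le> Suc m" using IH by simp
    finally show ?thesis .
  qed
qed simp

text \<open>
Count the visits to \<open>x\<close> as returns after the first one.
\<close>

lemma visits_le:
  assumes "\<And>k. k \<le> n \<Longrightarrow> \<not> returns m (shiftn k w)"
  shows "card {l\<in>{..n}. W l w = x} \<le> m"
proof (cases "\<exists>l\<le>n. W l w = x")
  case True
  define k where "k = (LEAST l. l \<le> n \<and> W l w = x)"
  have k: "k \<le> n" "W k w = x" using LeastI_ex[OF True] by (auto simp: k_def)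
  have "k \<le> l" if "l \<le> n" "W l w = x" for l unfolding k_def by (rule Least_le) (use that in auto)
  then have "{l\<in>{..n}. W l w = x} = {l\<in>{k..n}. W l w = W k w}" using k by auto
  then show ?thesis using visits_le_returns[OF assms[OF k(1)]] by simp
next
  case False
  then have "{l\<in>{..n}. W l w = x} = {}" by auto
  then show ?thesis by (simp only: card.empty)
qed

lemma summable_geometric_small_power:
  assumes "0 < r" "r < (1::real)"
  shows "summable (\<lambda>n. real (Suc n) * r ^ nat \<lfloor>real n powr (1/100)\<rfloor>)"
proof -
  define c where "c = - ln r"
  have c: "c > 0" using assms by (simp add: c_def)
  have big: "(\<lambda>n. real (Suc n) * (exp c * exp (- c * real n powr (1/100)))) \<in> O(\<lambda>n. real n powr (-2))"
    using c by real_asymp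
  have "summable (\<lambda>n. real n powr (-2))" by (subst summable_real_powr_iff) simp
  then have "summable (\<lambda>n. norm (real n powr (-2)))" by simp
  from summable_comparison_test_bigo[OF this big]
  have sm: "summable (\<lambda>n. real (Suc n) * (exp c * exp (- c * real n powr (1/100))))" .
  show ?thesis
  proof (rule summable_comparison_test'[OF sm])
    fix n :: nat
    let ?m = "nat \<lfloor>real n powr (1/100)\<rfloor>"
    have "real n powr (1/100) - 1 \<le> real ?m" by linarith
    then have "c * (real n powr (1/100) - 1) \<le> c * real ?m" using c by (intro mult_left_mono) auto
    then have "exp (- (c * real ?m)) \<le> exp (c + - c * real n powr (1/100))"
      by (simp add: algebra_simps)
    also have "exp (- (c * real ?m)) = r ^ ?m"
      using assms by (simp add: c_def powr_realpow[symmetric] powr_def mult.commute)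
    also have "exp (c + - c * real n powr (1/100)) = exp c * exp (- c * real n powr (1/100))"
      by (simp only: exp_add)
    finally have "real (Suc n) * r ^ ?m \<le> real (Suc n) * (exp c * exp (- c * real n powr (1/100)))"
      by (intro mult_left_mono) auto
    then show "norm (real (Suc n) * r ^ ?m) \<le> real (Suc n) * (exp c * exp (- c * real n powr (1/100)))"
      using assms by (simp add: abs_mult del: of_nat_Suc)
  qed
qed

text \<open>
The probability that some time \<open>k \<le> n\<close> is followed by \<open>m\<close> returns is at most \<open>(n + 1) \<rho>\<^sup>m\<close>,
which is summable in \<open>n\<close> when \<open>m\<close> grows like a power of \<open>n\<close>; the Borel--Cantelli lemma concludes.
\<close>

theorem AE_visits_le:
  assumes "\<rho> < 1"
  shows "AE w in S. \<forall>\<^sub>F n in sequentially. \<forall>x. real (card {l\<in>{..n}. W l w = x}) \<le> real n powr (1/100)"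
proof -
  define m where "m n = nat \<lfloor>real n powr (1/100)\<rfloor>" for n
  \<comment> \<open>The ratio of the geometric bound has to be positive, while \<open>\<rho>\<close> may be \<open>0\<close>.\<close>
  define r where "r = max \<rho> (1/2)"
  have r: "0 < r" "r < 1" using assms by (auto simp: r_def)
  let ?A = "\<lambda>n. {w \<in> space S. \<exists>k\<in>{..n}. returns (m n) (shiftn k w)}"
  have le: "measure S (?A n) \<le> real (Suc n) * r ^ m n" for n
  proof -
    have "?A n = (\<Union>k\<in>{..n}. {w \<in> space S. returns (m n) (shiftn k w)})" by auto
    also have "measure S \<dots> \<le> (\<Sum>k\<in>{..n}. \<P>(w in S. returns (m n) (shiftn k w)))"
      by (rule P.finite_measure_subadditive_finite) auto
    also have "\<dots> = (\<Sum>k\<in>{..n}. \<P>(w in S. returns (m n) w))" by (simp add: prob_shift)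
    also have "\<dots> \<le> (\<Sum>k\<in>{..n}. r ^ m n)"
      by (intro sum_mono order_trans[OF prob_returns_le] power_mono) (auto simp: r_def \<rho>_def)
    finally show ?thesis by simp
  qed
  have "AE w in S. \<forall>\<^sub>F n in sequentially. w \<in> space S - ?A n"
  proof (rule borel_cantelli_AE1)
    show "summable (\<lambda>n. measure S (?A n))"
      by (rule summable_comparison_test'[OF summable_geometric_small_power[OF r]]) (use le in \<open>auto simp: m_def\<close>)
    show "emeasure S (?A n) < \<infinity>" for n by (simp add: less_top[symmetric])
  qed measurable
  then show ?thesis
  proof (rule AE_mp, intro AE_I2 impI)
    fix w assume "\<forall>\<^sub>F n in sequentially. w \<in> space S - ?A n"
    then show "\<forall>\<^sub>F n in sequentially. \<forall>x. real (card {l\<in>{..n}. W l w = x}) \<le> real n powr (1/100)"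
    proof eventually_elim
      case (elim n)
      have "card {l\<in>{..n}. W l w = x} \<le> m n" for x by (rule visits_le) (use elim in auto)
      moreover have "real (m n) \<le> real n powr (1/100)" by (simp add: m_def)
      ultimately show ?case by (meson of_nat_le_iff order_trans)
    qed
  qed
qed

end

section \<open>Ergodic averages over pairs of times\<close>

context prob_space
begin

text \<open>
The series of squares has finite expectation, hence converges almost surely.
\<close>

lemma AE_tendsto_zero_of_summable_second_moments:
  fixes Z :: "nat \<Rightarrow> 'a \<Rightarrow> real"
  assumes [measurable]: "\<And>j. Z j \<in> borel_measurable M"
    and sq: "\<And>j. integrable M (\<lambda>\<omega>. (Z j \<omega>)\<^sup>2)"
    and sm: "summable (\<lambda>j. moment2 (Z j))"
  shows "AE \<omega> in M. (\<lambda>j. Z j \<omega>) \<longlonglongrightarrow> 0"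
proof -
  have "(\<integral>\<^sup>+\<omega>. (\<Sum>j. ennreal ((Z j \<omega>)\<^sup>2)) \<partial>M) = (\<Sum>j. \<integral>\<^sup>+\<omega>. ennreal ((Z j \<omega>)\<^sup>2) \<partial>M)"
    by (rule nn_integral_suminf) measurable
  also have "\<dots> = (\<Sum>j. ennreal (moment2 (Z j)))"
    by (intro suminf_cong nn_integral_eq_integral sq) simp
  also have "\<dots> = ennreal (\<Sum>j. moment2 (Z j))"
    by (rule suminf_ennreal2) (use sm in auto)
  finally have "(\<integral>\<^sup>+\<omega>. (\<Sum>j. ennreal ((Z j \<omega>)\<^sup>2)) \<partial>M) \<noteq> \<infinity>" by simp
  then have "AE \<omega> in M. (\<Sum>j. ennreal ((Z j \<omega>)\<^sup>2)) \<noteq> \<infinity>"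
    by (rule nn_integral_PInf_AE[rotated]) measurable
  then show ?thesis
  proof (rule AE_mp, intro AE_I2 impI)
    fix \<omega> assume "(\<Sum>j. ennreal ((Z j \<omega>)\<^sup>2)) \<noteq> \<infinity>"
    then have "summable (\<lambda>j. (Z j \<omega>)\<^sup>2)" by (intro summable_suminf_not_top) auto
    then have "(\<lambda>j. (Z j \<omega>)\<^sup>2) \<longlonglongrightarrow> 0" by (rule summable_LIMSEQ_zero)
    then have "(\<lambda>j. sqrt ((Z j \<omega>)\<^sup>2)) \<longlonglongrightarrow> sqrt 0" by (rule tendsto_real_sqrt)
    then have "(\<lambda>j. \<bar>Z j \<omega>\<bar>) \<longlonglongrightarrow> 0" by simp
    then show "(\<lambda>j. Z j \<omega>) \<longlonglongrightarrow> 0" by (rule tendsto_rabs_zero_cancel)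
  qed
qed

lemma bounded_finite_range_second_moment:
  fixes Y :: "nat \<Rightarrow> 'a \<Rightarrow> real"
  assumes [measurable]: "\<And>k. Y k \<in> borel_measurable M" and B: "\<And>k \<omega>. \<bar>Y k \<omega>\<bar> \<le> B"
    and orth: "\<And>i j. i + L \<le> j \<Longrightarrow> expectation (\<lambda>\<omega>. Y i \<omega> * Y j \<omega>) = 0"
  shows "expectation (\<lambda>\<omega>. (\<Sum>k<n. Y k \<omega>)\<^sup>2) \<le> real n * (2 * real L * B\<^sup>2)"
proof -
  have B0: "B \<ge> 0" using B[of 0] order_trans[OF abs_ge_zero] by blast
  have YY: "\<bar>Y i \<omega> * Y j \<omega>\<bar> \<le> B\<^sup>2" for i j \<omega>
    using B B0 unfolding abs_mult power2_eq_square by (intro mult_mono) auto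
  have i: "integrable M (\<lambda>\<omega>. Y i \<omega> * Y j \<omega>)" for i j
    by (rule integrable_const_bound[where B = "B\<^sup>2"]) (use YY in auto)
  have e: "expectation (\<lambda>\<omega>. Y i \<omega> * Y j \<omega>) \<le> (if j \<in> {i + 1 - L..<i + L} then B\<^sup>2 else 0)" for i j
  proof (cases "j \<in> {i + 1 - L..<i + L}")
    case True
    have "expectation (\<lambda>\<omega>. Y i \<omega> * Y j \<omega>) \<le> expectation (\<lambda>_. B\<^sup>2)"
      using YY by (intro integral_mono i) (auto intro: order_trans[OF abs_ge_self])
    then show ?thesis using True by (simp add: prob_space)
  next
    case False
    then have "i + L \<le> j \<or> j + L \<le> i" by auto
    then show ?thesis using orth[of i j] orth[of j i] False by (auto simp: mult.commute)
  qed
  have "expectation (\<lambda>\<omega>. (\<Sum>k<n. Y k \<omega>)\<^sup>2) = expectation (\<lambda>\<omega>. \<Sum>i<n. \<Sum>j<n. Y i \<omega> * Y j \<omega>)"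
    by (intro Bochner_Integration.integral_cong) (auto simp: power2_eq_square sum_product)
  also have "\<dots> = (\<Sum>i<n. \<Sum>j<n. expectation (\<lambda>\<omega>. Y i \<omega> * Y j \<omega>))"
    using i by (subst Bochner_Integration.integral_sum, force, subst Bochner_Integration.integral_sum) auto
  also have "\<dots> \<le> (\<Sum>i<n. \<Sum>j<n. if j \<in> {i + 1 - L..<i + L} then B\<^sup>2 else 0)"
    by (intro sum_mono e)
  also have "\<dots> \<le> (\<Sum>i<n. 2 * real L * B\<^sup>2)"
  proof (rule sum_mono)
    fix i
    have "(\<Sum>j<n. if j \<in> {i + 1 - L..<i + L} then B\<^sup>2 else 0) = real (card ({..<n} \<inter> {i + 1 - L..<i + L})) * B\<^sup>2"
      by (simp only: sum.inter_restrict[OF finite_lessThan, symmetric] sum_constant)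
    also have "card ({..<n} \<inter> {i + 1 - L..<i + L}) \<le> card {i + 1 - L..<i + L}"
      by (rule card_mono) auto
    also have "\<dots> \<le> 2 * L" by simp
    finally show "(\<Sum>j<n. if j \<in> {i + 1 - L..<i + L} then B\<^sup>2 else 0) \<le> 2 * real L * B\<^sup>2"
      by (simp add: mult_right_mono)
  qed
  finally show ?thesis by simp
qed

text \<open>
The second moment of the \<open>n\<close>-th partial sum is of order \<open>n\<close>, so the averages converge along the squares \<open>n = j\<^sup>2\<close>;
between consecutive squares a partial sum of bounded terms changes by at most a multiple of \<open>\<surd>n\<close>.
\<close>

lemma strong_law_bounded_finite_range:
  fixes Y :: "nat \<Rightarrow> 'a \<Rightarrow> real"
  assumes Ym[measurable]: "\<And>k. Y k \<in> borel_measurable M" and B: "\<And>k \<omega>. \<bar>Y k \<omega>\<bar> \<le> B"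
    and orth: "\<And>i j. i + L \<le> j \<Longrightarrow> expectation (\<lambda>\<omega>. Y i \<omega> * Y j \<omega>) = 0"
  shows "AE \<omega> in M. (\<lambda>n. (\<Sum>k<n. Y k \<omega>) / real n) \<longlonglongrightarrow> 0"
proof -
  define Z where "Z j \<omega> = (\<Sum>k<j\<^sup>2. Y k \<omega>) / real (j\<^sup>2)" for j \<omega>
  have B0: "B \<ge> 0" using B[of 0] order_trans[OF abs_ge_zero] by blast
  have SB: "\<bar>\<Sum>k\<in>J. Y k \<omega>\<bar> \<le> real (card J) * B" for J :: "nat set" and \<omega>
    by (rule order_trans[OF sum_abs]) (use sum_bounded_above[of J "\<lambda>k. \<bar>Y k \<omega>\<bar>" B] B in auto)
  have Zm[measurable]: "Z j \<in> borel_measurable M" for j unfolding Z_def by measurable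
  have "AE \<omega> in M. (\<lambda>j. Z j \<omega>) \<longlonglongrightarrow> 0"
  proof (rule AE_tendsto_zero_of_summable_second_moments[OF Zm])
    show "integrable M (\<lambda>\<omega>. (Z j \<omega>)\<^sup>2)" for j
    proof (rule integrable_const_bound[where B = "B\<^sup>2"])
      have "\<bar>Z j \<omega>\<bar> \<le> B" for \<omega>
      proof -
        have "\<bar>\<Sum>k<j\<^sup>2. Y k \<omega>\<bar> \<le> real (card {..<j\<^sup>2}) * B" by (rule SB)
        then show ?thesis using B0 by (cases "j = 0") (auto simp: Z_def field_simps)
      qed
      then show "AE \<omega> in M. norm ((Z j \<omega>)\<^sup>2) \<le> B\<^sup>2"
        using B0 by (intro AE_I2) (auto simp: abs_le_square_iff[symmetric])
    qed measurable
    show "summable (\<lambda>j. moment2 (Z j))"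
    proof (rule summable_comparison_test')
      show "summable (\<lambda>j. 2 * real L * B\<^sup>2 * inverse (real j ^ 2))"
        by (intro summable_mult inverse_power_summable) simp
      fix j
      have "moment2 (Z j) = expectation (\<lambda>\<omega>. (\<Sum>k<j\<^sup>2. Y k \<omega>)\<^sup>2) / (real (j\<^sup>2))\<^sup>2"
        by (simp add: Z_def power_divide)
      also have "\<dots> \<le> real (j\<^sup>2) * (2 * real L * B\<^sup>2) / (real (j\<^sup>2))\<^sup>2"
        by (intro divide_right_mono bounded_finite_range_second_moment Ym B orth) auto
      also have "\<dots> = 2 * real L * B\<^sup>2 * inverse (real j ^ 2)"
        by (cases "j = 0") (auto simp: power2_eq_square field_simps)
      finally show "norm (moment2 (Z j)) \<le> 2 * real L * B\<^sup>2 * inverse (real j ^ 2)" by simp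
    qed
  qed
  then show ?thesis
  proof (rule AE_mp, intro AE_I2 impI)
    fix \<omega> assume Z: "(\<lambda>j. Z j \<omega>) \<longlonglongrightarrow> 0"
    \<comment> \<open>\<open>(r n)\<^sup>2\<close> is the last square up to \<open>n\<close>.\<close>
    define r where "r n = nat \<lfloor>sqrt (real n)\<rfloor>" for n
    have r_inf: "filterlim r at_top sequentially" unfolding r_def by real_asymp
    have "(\<lambda>n. \<bar>Z (r n) \<omega>\<bar>) \<longlonglongrightarrow> 0"
      using filterlim_compose[OF Z r_inf] by (rule tendsto_rabs_zero)
    moreover have "(\<lambda>n. B * (2 * sqrt (real n) + 1) / real n) \<longlonglongrightarrow> 0" by real_asymp
    ultimately have lim: "(\<lambda>n. \<bar>Z (r n) \<omega>\<bar> + B * (2 * sqrt (real n) + 1) / real n) \<longlonglongrightarrow> 0"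
      using tendsto_add by fastforce
    show "(\<lambda>n. (\<Sum>k<n. Y k \<omega>) / real n) \<longlonglongrightarrow> 0"
    proof (rule Lim_null_comparison[OF _ lim], rule eventually_sequentiallyI[of 1])
      fix n :: nat assume n: "1 \<le> n"
      have rs: "real (r n) \<le> sqrt (real n)" "sqrt (real n) < real (r n) + 1"
        unfolding r_def by auto
      have r1: "r n \<ge> 1" using n by (simp add: r_def le_nat_floor)
      have "(real (r n))\<^sup>2 \<le> (sqrt (real n))\<^sup>2" using rs by (intro power_mono) auto
      then have rn: "(r n)\<^sup>2 \<le> n" by (simp flip: of_nat_power)
      have "(sqrt (real n))\<^sup>2 \<le> (real (r n) + 1)\<^sup>2" using rs by (intro power_mono) auto
      then have nr: "real n \<le> real ((r n)\<^sup>2) + 2 * real (r n) + 1" by (simp add: power2_sum)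
      have split: "(\<Sum>k<n. Y k \<omega>) = (\<Sum>k<(r n)\<^sup>2. Y k \<omega>) + (\<Sum>k\<in>{(r n)\<^sup>2..<n}. Y k \<omega>)"
        using sum.atLeastLessThan_concat[of 0 "(r n)\<^sup>2" n "\<lambda>k. Y k \<omega>"] rn
        by (simp add: lessThan_atLeast0)
      have a: "\<bar>\<Sum>k<(r n)\<^sup>2. Y k \<omega>\<bar> / real n \<le> \<bar>Z (r n) \<omega>\<bar>"
      proof -
        have "0 < real ((r n)\<^sup>2)" "0 < real n" using r1 n by simp_all
        then have "\<bar>\<Sum>k<(r n)\<^sup>2. Y k \<omega>\<bar> / real n \<le> \<bar>\<Sum>k<(r n)\<^sup>2. Y k \<omega>\<bar> / real ((r n)\<^sup>2)"
          using rn by (intro divide_left_mono) (auto simp del: of_nat_power)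
        then show ?thesis by (simp add: Z_def abs_divide)
      qed
      have "\<bar>\<Sum>k\<in>{(r n)\<^sup>2..<n}. Y k \<omega>\<bar> \<le> real (card {(r n)\<^sup>2..<n}) * B" by (rule SB)
      also have "\<dots> = real (n - (r n)\<^sup>2) * B" by simp
      also have "\<dots> \<le> (2 * sqrt (real n) + 1) * B"
        using nr rn rs B0 by (intro mult_right_mono) (auto simp: of_nat_diff)
      finally have b: "\<bar>\<Sum>k\<in>{(r n)\<^sup>2..<n}. Y k \<omega>\<bar> / real n \<le> B * (2 * sqrt (real n) + 1) / real n"
        by (intro divide_right_mono) (auto simp: mult.commute)
      have "norm ((\<Sum>k<n. Y k \<omega>) / real n) \<le> \<bar>\<Sum>k<(r n)\<^sup>2. Y k \<omega>\<bar> / real n + \<bar>\<Sum>k\<in>{(r n)\<^sup>2..<n}. Y k \<omega>\<bar> / real n"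
        unfolding split by (simp add: add_divide_distrib[symmetric] divide_right_mono abs_triangle_ineq)
      then show "norm ((\<Sum>k<n. Y k \<omega>) / real n) \<le> \<bar>Z (r n) \<omega>\<bar> + B * (2 * sqrt (real n) + 1) / real n"
        using a b by linarith
    qed
  qed
qed

end

context int_walk
begin

text \<open>
Garsia's argument. Let \<open>X\<close> be the maximum of the partial sums of \<open>G - \<delta>\<close> along the shift, starting
with the empty sum. Where \<open>X > 0\<close> the maximum uses the first term, so \<open>X \<le> G - \<delta> + X \<circ> shiftn 1\<close>; as \<open>X\<close> and
\<open>X \<circ> shiftn 1\<close> have the same integral, \<open>G - \<delta>\<close> has non-negative integral over that event.
\<close>

lemma maximal_ergodic:
  assumes [measurable]: "G \<in> borel_measurable S" and G: "\<And>w. 0 \<le> G w" "\<And>w. G w \<le> B" and \<delta>: "\<delta> > (0::real)"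
  shows "\<P>(w in S. \<exists>n\<in>{1..N}. (\<Sum>k<n. G (shiftn k w)) > \<delta> * real n) \<le> (\<integral>w. G w \<partial>S) / \<delta>"
proof -
  define Z where "Z n w = (\<Sum>k<n. (G (shiftn k w) - \<delta>))" for n w
  define X where "X w = Max ((\<lambda>n. Z n w) ` {..N})" for w
  define E where "E = {w. \<exists>n\<in>{1..N}. Z n w > 0}"
  have Zm[measurable]: "Z n \<in> borel_measurable S" for n unfolding Z_def by measurable
  have Xm[measurable]: "X \<in> borel_measurable S" unfolding X_def by (rule borel_measurable_Max) auto
  have Em[measurable]: "E \<in> sets S"
  proof -
    have "E = {w \<in> space S. \<exists>n\<in>{1..N}. Z n w > 0}" by (simp add: E_def space_S)
    then show ?thesis by simp
  qed
  have B0: "B \<ge> 0" using G order_trans by blast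
  have ZB: "\<bar>Z n w\<bar> \<le> real N * (B + \<delta>)" if "n \<le> N" for n w
  proof -
    have "\<bar>Z n w\<bar> \<le> (\<Sum>k<n. B + \<delta>)"
      unfolding Z_def
    proof (rule order_trans[OF sum_abs], rule sum_mono)
      fix k show "\<bar>G (shiftn k w) - \<delta>\<bar> \<le> B + \<delta>" using G[of "shiftn k w"] \<delta> by (simp add: abs_if)
    qed
    also have "\<dots> \<le> real N * (B + \<delta>)" using that B0 \<delta> by (simp add: mult_right_mono)
    finally show ?thesis .
  qed
  have Xin: "X w \<in> (\<lambda>n. Z n w) ` {..N}" for w unfolding X_def by (rule Max_in) auto
  have Xge: "Z n w \<le> X w" if "n \<le> N" for n w unfolding X_def by (rule Max_ge) (use that in auto)
  have XB: "\<bar>X w\<bar> \<le> real N * (B + \<delta>)" for w using Xin[of w] ZB by auto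
  have X0: "X w \<ge> 0" for w using Xge[of 0 w] by (simp add: Z_def)
  have iX: "integrable S X" by (rule P.integrable_const_bound[where B = "real N * (B + \<delta>)"]) (use XB in auto)
  have iXs: "integrable S (\<lambda>w. X (shiftn 1 w))" by (rule P.integrable_const_bound[where B = "real N * (B + \<delta>)"]) (use XB in auto)
  have iG: "integrable S G" by (rule P.integrable_const_bound[where B = B]) (use G in auto)
  have iE: "integrable S (\<lambda>w. indicator E w * (G w - \<delta>))"
    by (rule Bochner_Integration.integrable_bound[where f = "\<lambda>w. G w - \<delta>"]) (use iG in \<open>auto simp: indicator_def\<close>)
  have iI: "integrable S (indicat_real E)" by (rule P.integrable_const_bound[where B = 1]) auto
  have step: "Z (Suc n) w = (G w - \<delta>) + Z n (shiftn 1 w)" for n w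
    unfolding Z_def by (simp add: sum.lessThan_Suc_shift shiftn_shiftn del: sum.lessThan_Suc)
  have pt: "X w - X (shiftn 1 w) \<le> indicator E w * (G w - \<delta>)" for w
  proof (cases "w \<in> E")
    case True
    then obtain n0 where "n0 \<in> {1..N}" "Z n0 w > 0" by (auto simp: E_def)
    then have "X w > 0" using Xge[of n0 w] by simp
    moreover obtain n where n: "n \<le> N" "X w = Z n w" using Xin[of w] by auto
    ultimately obtain n' where n': "n = Suc n'" by (cases n) (auto simp: Z_def)
    have "X w = (G w - \<delta>) + Z n' (shiftn 1 w)" using n n' step by simp
    also have "\<dots> \<le> (G w - \<delta>) + X (shiftn 1 w)" using Xge[of n' "shiftn 1 w"] n n' by simp
    finally show ?thesis using True by simp
  next
    case False
    obtain n where n: "n \<le> N" "X w = Z n w" using Xin[of w] by auto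
    then have "X w \<le> 0" using False by (cases "n = 0") (auto simp: E_def Z_def not_less)
    then show ?thesis using False X0[of "shiftn 1 w"] by simp
  qed
  have "0 = (\<integral>w. X w - X (shiftn 1 w) \<partial>S)"
    using iX iXs integral_shift[OF Xm XB, of 1] by simp
  also have "\<dots> \<le> (\<integral>w. indicator E w * (G w - \<delta>) \<partial>S)"
    using iX iXs iE pt by (intro integral_mono) auto
  also have "\<dots> \<le> (\<integral>w. G w - \<delta> * indicator E w \<partial>S)"
  proof (rule integral_mono[OF iE])
    show "integrable S (\<lambda>w. G w - \<delta> * indicator E w)" using iG iI by simp
    show "indicator E w * (G w - \<delta>) \<le> G w - \<delta> * indicator E w" for w
      using G by (simp add: indicator_def)
  qed
  also have "\<dots> = (\<integral>w. G w \<partial>S) - \<delta> * measure S E"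
    using iG iI by (simp add: space_S)
  finally have "\<delta> * measure S E \<le> (\<integral>w. G w \<partial>S)" by simp
  then have "measure S E \<le> (\<integral>w. G w \<partial>S) / \<delta>" using \<delta> by (simp add: field_simps)
  moreover have "{w \<in> space S. \<exists>n\<in>{1..N}. (\<Sum>k<n. G (shiftn k w)) > \<delta> * real n} = E"
    by (auto simp: E_def Z_def space_S sum_subtractf mult.commute)
  ultimately show ?thesis by simp
qed

text \<open>
The sums over pairs of times are split at distance \<open>L\<close>. For pairs with earlier time \<open>0\<close>,
\<open>near_sum\<close> is the contribution up to this distance and \<open>far_sum\<close> bounds the rest, up to distance \<open>N\<close>.
Composing with \<open>shiftn k\<close> moves the earlier time to \<open>k\<close>.
\<close>

definition near_sum :: "(int \<Rightarrow> real) \<Rightarrow> nat \<Rightarrow> (nat \<Rightarrow> int) \<Rightarrow> real" where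
  "near_sum c L w = (\<Sum>d\<in>{0<..L}. c (W d w))"

definition far_sum :: "(int \<Rightarrow> real) \<Rightarrow> nat \<Rightarrow> nat \<Rightarrow> (nat \<Rightarrow> int) \<Rightarrow> real" where
  "far_sum c L N w = (\<Sum>d\<in>{L<..N}. \<bar>c (W d w)\<bar>)"

lemma cW_measurable[measurable]: "(\<lambda>w. (c (W d w) :: real)) \<in> borel_measurable S"
  by (rule measurable_compose[OF W_measurable]) simp

lemma near_sum_measurable[measurable]: "near_sum c L \<in> borel_measurable S"
  unfolding near_sum_def by measurable

lemma far_sum_measurable[measurable]: "far_sum c L N \<in> borel_measurable S"
  unfolding far_sum_def by measurable

text \<open>
For an even \<open>c\<close> the pairs above and below the diagonal contribute equally.
\<close>

lemma double_sum_symmetric: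
  fixes c :: "int \<Rightarrow> real"
  assumes sym: "\<And>y. c (- y) = c y"
  shows "(\<Sum>k<m. \<Sum>l<m. c (s l - s k)) = real m * c 0 + 2 * (\<Sum>k<m. \<Sum>l\<in>{k<..<m}. c (s l - s k))"
proof (induction m)
  case (Suc m)
  have sw: "(\<Sum>l<m. c (s l - s m)) = (\<Sum>l<m. c (s m - s l))"
    by (intro sum.cong refl) (metis sym minus_diff_eq)
  have "(\<Sum>k<Suc m. \<Sum>l\<in>{k<..<Suc m}. c (s l - s k)) = (\<Sum>k<m. (\<Sum>l\<in>{k<..<m}. c (s l - s k)) + c (s m - s k))"
  proof -
    have "(\<Sum>l\<in>{k<..<Suc m}. c (s l - s k)) = (\<Sum>l\<in>{k<..<m}. c (s l - s k)) + c (s m - s k)" if "k < m" for k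
    proof -
      have "{k<..<Suc m} = insert m {k<..<m}" using that by auto
      then show ?thesis by simp
    qed
    moreover have "{m<..<Suc m} = {}" by auto
    ultimately show ?thesis by simp
  qed
  then show ?case using Suc sw by (simp add: sum.distrib algebra_simps)
qed simp

text \<open>
Two errors: pairs at distance more than \<open>L\<close>, and for the last \<open>L\<close> starting times the pairs reaching
beyond time \<open>m\<close>.
\<close>

lemma pair_sum_near_sum_diff:
  fixes c :: "int \<Rightarrow> real"
  assumes Bc: "\<And>y. \<bar>c y\<bar> \<le> Bc"
  shows "\<bar>(\<Sum>k<m. \<Sum>l\<in>{k<..<m}. c (W l w - W k w)) - (\<Sum>k<m. near_sum c L (shiftn k w))\<bar>
     \<le> (\<Sum>k<m. far_sum c L m (shiftn k w)) + real L * (real L * Bc)"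
proof -
  have Bc0: "Bc \<ge> 0" using Bc[of 0] by simp
  have one: "\<bar>(\<Sum>l\<in>{k<..<m}. c (W l w - W k w)) - near_sum c L (shiftn k w)\<bar>
      \<le> far_sum c L m (shiftn k w) + (if m \<le> k + L then real L * Bc else 0)" if "k < m" for k
  proof -
    let ?c = "\<lambda>d. c (W d (shiftn k w))"
    have "(\<Sum>l\<in>{k<..<m}. c (W l w - W k w)) = (\<Sum>d\<in>{0<..m - 1 - k}. ?c d)"
      by (rule sum.reindex_bij_witness[of _ "\<lambda>d. k + d" "\<lambda>l. l - k"]) (auto simp: W_shift)
    moreover have "\<bar>(\<Sum>d\<in>{0<..m - 1 - k}. ?c d) - (\<Sum>d\<in>{0<..L}. ?c d)\<bar>
       \<le> far_sum c L m (shiftn k w) + (if m \<le> k + L then real L * Bc else 0)"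
    proof (cases "m \<le> k + L")
      case True
      have "(\<Sum>d\<in>{0<..L}. ?c d) = (\<Sum>d\<in>{0<..m - 1 - k}. ?c d) + (\<Sum>d\<in>{m - 1 - k<..L}. ?c d)"
        using True that by (subst sum.union_disjoint[symmetric]) (auto intro!: sum.cong)
      then have "\<bar>(\<Sum>d\<in>{0<..m - 1 - k}. ?c d) - (\<Sum>d\<in>{0<..L}. ?c d)\<bar> = \<bar>\<Sum>d\<in>{m - 1 - k<..L}. ?c d\<bar>" by simp
      also have "\<dots> \<le> (\<Sum>d\<in>{m - 1 - k<..L}. Bc)"
        using Bc by (intro order_trans[OF sum_abs] sum_mono) auto
      also have "\<dots> \<le> real L * Bc" using Bc0 by (simp add: mult_right_mono)
      also have "\<dots> \<le> far_sum c L m (shiftn k w) + real L * Bc" by (simp add: far_sum_def sum_nonneg)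
      finally show ?thesis using True by simp
    next
      case False
      have "(\<Sum>d\<in>{0<..m - 1 - k}. ?c d) = (\<Sum>d\<in>{0<..L}. ?c d) + (\<Sum>d\<in>{L<..m - 1 - k}. ?c d)"
        using False that by (subst sum.union_disjoint[symmetric]) (auto intro!: sum.cong)
      then have "\<bar>(\<Sum>d\<in>{0<..m - 1 - k}. ?c d) - (\<Sum>d\<in>{0<..L}. ?c d)\<bar> = \<bar>\<Sum>d\<in>{L<..m - 1 - k}. ?c d\<bar>" by simp
      also have "\<dots> \<le> (\<Sum>d\<in>{L<..m - 1 - k}. \<bar>?c d\<bar>)" by (rule sum_abs)
      also have "\<dots> \<le> far_sum c L m (shiftn k w)" unfolding far_sum_def by (intro sum_mono2) auto
      finally show ?thesis using False by simp
    qed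
    ultimately show ?thesis by (simp add: near_sum_def)
  qed
  have "\<bar>(\<Sum>k<m. \<Sum>l\<in>{k<..<m}. c (W l w - W k w)) - (\<Sum>k<m. near_sum c L (shiftn k w))\<bar>
     \<le> (\<Sum>k<m. far_sum c L m (shiftn k w) + (if m \<le> k + L then real L * Bc else 0))"
    unfolding sum_subtractf[symmetric] by (intro order_trans[OF sum_abs] sum_mono one) simp
  also have "\<dots> = (\<Sum>k<m. far_sum c L m (shiftn k w)) + real (card ({..<m} \<inter> {k. m \<le> k + L})) * (real L * Bc)"
    by (simp add: sum.distrib sum.If_cases)
  also have "\<dots> \<le> (\<Sum>k<m. far_sum c L m (shiftn k w)) + real L * (real L * Bc)"
  proof -
    have "card ({..<m} \<inter> {k. m \<le> k + L}) \<le> card {m - L..<m}" by (rule card_mono) auto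
    then have "card ({..<m} \<inter> {k. m \<le> k + L}) \<le> L" by simp
    then show ?thesis using Bc0 by (intro add_left_mono mult_right_mono) auto
  qed
  finally show ?thesis .
qed

text \<open>
\<open>near_sum c L\<close> depends on the first \<open>L\<close> increments only, so shifts by at least \<open>L\<close> are independent.
\<close>

lemma AE_near_sum_average:
  fixes c :: "int \<Rightarrow> real"
  assumes Bc: "\<And>y. \<bar>c y\<bar> \<le> Bc"
  shows "AE w in S. (\<lambda>n. (\<Sum>k<n. near_sum c L (shiftn k w)) / real n) \<longlonglongrightarrow> (\<integral>w. near_sum c L w \<partial>S)"
proof -
  define \<mu> where "\<mu> = (\<integral>w. near_sum c L w \<partial>S)"
  define h where "h w = near_sum c L w - \<mu>" for w
  have lB: "\<bar>near_sum c L w\<bar> \<le> real L * Bc" for w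
    unfolding near_sum_def using sum_bounded_above[of "{0<..L}" "\<lambda>d. \<bar>c (W d w)\<bar>" Bc] Bc
    by (intro order_trans[OF sum_abs]) auto
  have il: "integrable S (near_sum c L)" by (rule P.integrable_const_bound[where B = "real L * Bc"]) (use lB in auto)
  have hm[measurable]: "h \<in> borel_measurable S" unfolding h_def by measurable
  define B where "B = real L * Bc + \<bar>\<mu>\<bar>"
  have hB: "\<bar>h w\<bar> \<le> B" for w using lB[of w] unfolding h_def B_def by linarith
  have h0: "(\<integral>w. h w \<partial>S) = 0" unfolding h_def using il by (simp add: \<mu>_def P.prob_space)
  have orth: "(\<integral>w. h (shiftn i w) * h (shiftn j w) \<partial>S) = 0" if "i + L \<le> j" for i j
  proof -
    have "(\<integral>w. h (shiftn i w) * h (shiftn j w) \<partial>S) = (\<integral>w. (\<lambda>w. h w * h (shiftn (j - i) w)) (shiftn i w) \<partial>S)"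
      using that by (simp add: shiftn_shiftn)
    also have "\<dots> = (\<integral>w. h w * h (shiftn (j - i) w) \<partial>S)"
    proof (rule integral_shift)
      show "\<bar>h w * h (shiftn (j - i) w)\<bar> \<le> B * B" for w
        unfolding abs_mult using hB order_trans[OF abs_ge_zero hB] by (intro mult_mono) auto
    qed measurable
    also have "\<dots> = (\<integral>w. h w \<partial>S) * (\<integral>w. h w \<partial>S)"
    proof (rule integral_split[OF hm hm hB hB])
      fix w w' :: "nat \<Rightarrow> int" assume eq: "\<And>d. d < j - i \<Longrightarrow> w d = w' d"
      have "W d w = W d w'" if "d \<le> j - i" for d by (rule W_cong[OF eq that])
      then show "h w = h w'" using that unfolding h_def near_sum_def by (auto intro!: sum.cong)
    qed
    finally show ?thesis using h0 by simp
  qed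
  have "AE w in S. (\<lambda>n. (\<Sum>k<n. h (shiftn k w)) / real n) \<longlonglongrightarrow> 0"
    by (rule P.strong_law_bounded_finite_range[where L = L and B = B]) (use hB orth in auto)
  then show ?thesis
  proof (rule AE_mp, intro AE_I2 impI)
    fix w assume "(\<lambda>n. (\<Sum>k<n. h (shiftn k w)) / real n) \<longlonglongrightarrow> 0"
    then have "(\<lambda>n. (\<Sum>k<n. h (shiftn k w)) / real n + \<mu>) \<longlonglongrightarrow> 0 + \<mu>" by (intro tendsto_add tendsto_const)
    then have lim: "(\<lambda>n. (\<Sum>k<n. h (shiftn k w)) / real n + \<mu>) \<longlonglongrightarrow> \<mu>" by simp
    have "\<forall>\<^sub>F n in sequentially. (\<Sum>k<n. h (shiftn k w)) / real n + \<mu> = (\<Sum>k<n. near_sum c L (shiftn k w)) / real n"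
      using eventually_gt_at_top[of 0]
      by eventually_elim (simp add: h_def sum_subtractf diff_divide_distrib)
    with lim show "(\<lambda>n. (\<Sum>k<n. near_sum c L (shiftn k w)) / real n) \<longlonglongrightarrow> (\<integral>w. near_sum c L w \<partial>S)"
      unfolding \<mu>_def[symmetric] by (rule Lim_transform_eventually)
  qed
qed

text \<open>
By the maximal inequality, the event that the bound fails for a given \<open>L\<close> has probability at most
\<open>T L / \<delta>\<close>, with \<open>T L\<close> the tail of a convergent series; failure for every \<open>L \<ge> L0\<close>
therefore has probability zero.
\<close>

lemma AE_far_sum_small:
  fixes c :: "int \<Rightarrow> real"
  assumes Bc: "\<And>y. \<bar>c y\<bar> \<le> Bc" and sm: "summable (\<lambda>l. \<integral>w. \<bar>c (W l w)\<bar> \<partial>S)" and \<delta>: "\<delta> > 0"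
  shows "AE w in S. \<exists>L\<ge>L0. \<forall>N. \<forall>n\<in>{1..N}. (\<Sum>k<n. far_sum c L N (shiftn k w)) \<le> \<delta> * real n"
proof -
  define e where "e l = (\<integral>w. \<bar>c (W l w)\<bar> \<partial>S)" for l
  have e0: "e l \<ge> 0" for l by (simp add: e_def)
  have sme: "summable e" using sm by (simp add: e_def[abs_def])
  define T where "T L = (\<Sum>l. e (l + Suc L))" for L
  have T0: "T \<longlonglongrightarrow> 0"
  proof -
    have "(\<lambda>L. (\<Sum>l. e l) - (\<Sum>l<Suc L. e l)) \<longlonglongrightarrow> (\<Sum>l. e l) - (\<Sum>l. e l)"
      by (intro tendsto_diff tendsto_const LIMSEQ_Suc[OF summable_LIMSEQ[OF sme]])
    then show ?thesis unfolding T_def suminf_minus_initial_segment[OF sme] by simp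
  qed
  have ic: "integrable S (\<lambda>w. \<bar>c (W l w)\<bar>)" for l
    by (rule P.integrable_const_bound[where B = Bc]) (use Bc in auto)
  define U where "U L N = {w \<in> space S. \<exists>n\<in>{1..N}. (\<Sum>k<n. far_sum c L N (shiftn k w)) > \<delta> * real n}" for L N
  have Um[measurable]: "U L N \<in> sets S" for L N unfolding U_def by measurable
  have PU: "measure S (U L N) \<le> T L / \<delta>" for L N
  proof -
    have "measure S (U L N) \<le> (\<integral>w. far_sum c L N w \<partial>S) / \<delta>"
      unfolding U_def
    proof (rule maximal_ergodic[OF _ _ _ \<delta>])
      show "far_sum c L N w \<le> real N * Bc" for w
      proof -
        have "far_sum c L N w \<le> (\<Sum>d\<in>{L<..N}. Bc)" unfolding far_sum_def by (intro sum_mono Bc)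
        also have "\<dots> \<le> real N * Bc" using Bc[of 0] by (simp add: mult_right_mono)
        finally show ?thesis .
      qed
    qed (auto simp: far_sum_def sum_nonneg)
    also have "(\<integral>w. far_sum c L N w \<partial>S) = (\<Sum>d\<in>{L<..N}. e d)"
      unfolding far_sum_def e_def using ic by (intro Bochner_Integration.integral_sum) auto
    also have "\<dots> = (\<Sum>l<N - L. e (l + Suc L))"
      by (rule sum.reindex_bij_witness[of _ "\<lambda>l. l + Suc L" "\<lambda>d. d - Suc L"]) auto
    also have "\<dots> \<le> T L" unfolding T_def using sme e0
      by (intro sum_le_suminf) (auto simp only: summable_iff_shift)
    finally show ?thesis using \<delta> by (simp add: divide_right_mono)
  qed
  define V where "V L = (\<Union>N. U L N)" for L
  have PV: "measure S (V L) \<le> T L / \<delta>" for L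
  proof -
    have inc: "incseq (U L)"
    proof (rule incseq_SucI, rule subsetI)
      fix N :: nat and w assume "w \<in> U L N"
      then obtain n where n: "n \<in> {1..N}" "(\<Sum>k<n. far_sum c L N (shiftn k w)) > \<delta> * real n" and w: "w \<in> space S"
        by (auto simp: U_def)
      have "(\<Sum>k<n. far_sum c L N (shiftn k w)) \<le> (\<Sum>k<n. far_sum c L (Suc N) (shiftn k w))"
        unfolding far_sum_def by (intro sum_mono sum_mono2) auto
      then show "w \<in> U L (Suc N)" using n w by (auto simp: U_def intro!: bexI[of _ n])
    qed
    have "(\<lambda>N. measure S (U L N)) \<longlonglongrightarrow> measure S (V L)"
      unfolding V_def by (rule P.finite_Lim_measure_incseq[OF _ inc]) auto
    then show ?thesis by (rule LIMSEQ_le_const2) (use PU in auto)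
  qed
  define Z where "Z = (\<Inter>L\<in>{L0..}. V L)"
  have Zm: "Z \<in> sets S" unfolding Z_def V_def by measurable
  have "measure S Z \<le> T L / \<delta>" if "L \<ge> L0" for L
    by (rule order_trans[OF P.finite_measure_mono PV[of L]]) (use that in \<open>auto simp: Z_def V_def\<close>)
  moreover have "(\<lambda>L. T L / \<delta>) \<longlonglongrightarrow> 0 / \<delta>" by (intro tendsto_divide T0 tendsto_const) (use \<delta> in auto)
  ultimately have "measure S Z \<le> 0 / \<delta>" by (intro LIMSEQ_le_const[of "\<lambda>L. T L / \<delta>"]) auto
  then have "Z \<in> null_sets S" using Zm by (intro null_setsI) (auto simp: P.emeasure_eq_measure measure_le_0_iff)
  then show ?thesis
  proof (rule AE_mp[OF AE_not_in], intro AE_I2 impI)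
    fix w assume "w \<notin> Z" "w \<in> space S"
    then obtain L where "L \<ge> L0" and nU: "w \<notin> U L N" for N by (auto simp: Z_def V_def)
    moreover have "\<forall>N. \<forall>n\<in>{1..N}. (\<Sum>k<n. far_sum c L N (shiftn k w)) \<le> \<delta> * real n"
    proof (intro allI ballI)
      fix N n :: nat assume "n \<in> {1..N}"
      then show "(\<Sum>k<n. far_sum c L N (shiftn k w)) \<le> \<delta> * real n"
        using nU[of N] \<open>w \<in> space S\<close> unfolding U_def by (simp add: not_less)
    qed
    ultimately show "\<exists>L\<ge>L0. \<forall>N. \<forall>n\<in>{1..N}. (\<Sum>k<n. far_sum c L N (shiftn k w)) \<le> \<delta> * real n" by blast
  qed
qed

text \<open>
The limit is \<open>c 0\<close>, from the diagonal, plus twice the sum over \<open>l \<ge> 1\<close> of the expectations of \<open>c (W l)\<close>; adding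
and subtracting the term \<open>l = 0\<close> gives the stated form.
\<close>

theorem AE_pair_average:
  fixes c :: "int \<Rightarrow> real"
  assumes Bc: "\<And>y. \<bar>c y\<bar> \<le> Bc" and sym: "\<And>y. c (- y) = c y"
    and sm: "summable (\<lambda>l. \<integral>w. \<bar>c (W l w)\<bar> \<partial>S)"
  shows "AE w in S. (\<lambda>m. (\<Sum>k<m. \<Sum>l<m. c (W l w - W k w)) / real m)
           \<longlonglongrightarrow> 2 * (\<Sum>l. \<integral>w. c (W l w) \<partial>S) - c 0"
proof -
  define f where "f l = (\<integral>w. c (W l w) \<partial>S)" for l
  have ic: "integrable S (\<lambda>w. c (W l w))" for l
    by (rule P.integrable_const_bound[where B = Bc]) (use Bc in auto)
  have smf: "summable f"
    by (rule summable_comparison_test'[OF sm]) (auto simp: f_def intro: integral_abs_bound)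
  have f0: "f 0 = c 0" by (simp add: f_def P.prob_space)
  define D where "D = (\<Sum>l. f (Suc l))"
  have D: "(\<Sum>l. f l) = c 0 + D" unfolding D_def using suminf_split_head[OF smf] f0 by simp
  have locf: "(\<integral>w. near_sum c L w \<partial>S) = (\<Sum>l<L. f (Suc l))" for L
  proof -
    have "(\<integral>w. near_sum c L w \<partial>S) = (\<Sum>d\<in>{0<..L}. f d)"
      unfolding near_sum_def f_def using ic by (intro Bochner_Integration.integral_sum) auto
    also have "\<dots> = (\<Sum>l<L. f (Suc l))"
      by (rule sum.reindex_bij_witness[of _ Suc "\<lambda>d. d - 1"]) auto
    finally show ?thesis .
  qed
  have locD: "(\<lambda>L. \<integral>w. near_sum c L w \<partial>S) \<longlonglongrightarrow> D"
    unfolding locf D_def using smf by (intro summable_LIMSEQ) (simp only: summable_Suc_iff)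
  have "\<exists>L0. \<forall>L\<ge>L0. \<bar>(\<integral>w. near_sum c L w \<partial>S) - D\<bar> < 1 / real (Suc i)" for i
    using LIMSEQ_D[OF locD, of "1 / real (Suc i)"] by auto
  then obtain L0 where L0: "\<And>i L. L \<ge> L0 i \<Longrightarrow> \<bar>(\<integral>w. near_sum c L w \<partial>S) - D\<bar> < 1 / real (Suc i)" by metis
  have "AE w in S. \<forall>i. \<exists>L\<ge>L0 i. \<forall>N. \<forall>n\<in>{1..N}. (\<Sum>k<n. far_sum c L N (shiftn k w)) \<le> 1 / real (Suc i) * real n"
    unfolding AE_all_countable by (intro allI AE_far_sum_small[OF Bc sm]) simp
  moreover have "AE w in S. \<forall>L. (\<lambda>n. (\<Sum>k<n. near_sum c L (shiftn k w)) / real n) \<longlonglongrightarrow> (\<integral>w. near_sum c L w \<partial>S)"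
    unfolding AE_all_countable by (intro allI AE_near_sum_average[OF Bc])
  ultimately show ?thesis
  proof eventually_elim
    case (elim w)
    define a where "a m = (\<Sum>k<m. \<Sum>l\<in>{k<..<m}. c (W l w - W k w))" for m
    have "(\<lambda>m. a m / real m) \<longlonglongrightarrow> D"
    proof (rule LIMSEQ_I)
      fix \<epsilon> :: real assume \<epsilon>: "\<epsilon> > 0"
      obtain i where i: "1 / real (Suc i) < \<epsilon> / 4" using nat_approx_posE[of "\<epsilon> / 4"] \<epsilon> by auto
      obtain L where L: "L \<ge> L0 i" and t: "\<And>N n. n \<in> {1..N} \<Longrightarrow> (\<Sum>k<n. far_sum c L N (shiftn k w)) \<le> 1 / real (Suc i) * real n"
        using elim(1) by blast
      have "(\<lambda>m. (real L * (real L * Bc)) / real m) \<longlonglongrightarrow> 0" by (rule lim_const_over_n)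
      from LIMSEQ_D[OF this, of "\<epsilon> / 4"] obtain m1 where m1: "\<And>m. m \<ge> m1 \<Longrightarrow> \<bar>(real L * (real L * Bc)) / real m\<bar> < \<epsilon> / 4"
        using \<epsilon> by auto
      have "(\<lambda>n. (\<Sum>k<n. near_sum c L (shiftn k w)) / real n) \<longlonglongrightarrow> (\<integral>w. near_sum c L w \<partial>S)" using elim(2) by blast
      from LIMSEQ_D[OF this, of "\<epsilon> / 4"] obtain m2
        where m2: "\<And>m. m \<ge> m2 \<Longrightarrow> \<bar>(\<Sum>k<m. near_sum c L (shiftn k w)) / real m - (\<integral>w. near_sum c L w \<partial>S)\<bar> < \<epsilon> / 4"
        using \<epsilon> by auto
      show "\<exists>m0. \<forall>m\<ge>m0. norm (a m / real m - D) < \<epsilon>"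
      proof (intro exI allI impI)
        fix m assume m: "m \<ge> max 1 (max m1 m2)"
        have "\<bar>a m - (\<Sum>k<m. near_sum c L (shiftn k w))\<bar> \<le> 1 / real (Suc i) * real m + real L * (real L * Bc)"
          using pair_sum_near_sum_diff[where m = m and w = w and L = L and c = c and Bc = Bc, OF Bc] t[of m m] m unfolding a_def by simp
        then have "\<bar>a m - (\<Sum>k<m. near_sum c L (shiftn k w))\<bar> / real m \<le> (1 / real (Suc i) * real m + real L * (real L * Bc)) / real m"
          by (rule divide_right_mono) simp
        also have "\<dots> = 1 / real (Suc i) + (real L * (real L * Bc)) / real m"
          using m by (simp add: add_divide_distrib)
        finally have "\<bar>a m / real m - (\<Sum>k<m. near_sum c L (shiftn k w)) / real m\<bar> \<le> 1 / real (Suc i) + (real L * (real L * Bc)) / real m"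
          by (simp add: diff_divide_distrib[symmetric] abs_divide)
        moreover have "\<bar>(real L * (real L * Bc)) / real m\<bar> < \<epsilon> / 4" using m1 m by simp
        moreover have "\<bar>(\<Sum>k<m. near_sum c L (shiftn k w)) / real m - (\<integral>w. near_sum c L w \<partial>S)\<bar> < \<epsilon> / 4" using m2 m by simp
        moreover have "\<bar>(\<integral>w. near_sum c L w \<partial>S) - D\<bar> < 1 / real (Suc i)" using L0 L by simp
        ultimately show "norm (a m / real m - D) < \<epsilon>" using i unfolding real_norm_def by linarith
      qed
    qed
    then have "(\<lambda>m. c 0 + 2 * (a m / real m)) \<longlonglongrightarrow> c 0 + 2 * D" by (intro tendsto_intros)
    moreover have "\<forall>\<^sub>F m in sequentially. c 0 + 2 * (a m / real m) = (\<Sum>k<m. \<Sum>l<m. c (W l w - W k w)) / real m"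
      using eventually_gt_at_top[of 0]
      by eventually_elim (simp add: double_sum_symmetric[where c = c, OF sym] a_def add_divide_distrib)
    ultimately have "(\<lambda>m. (\<Sum>k<m. \<Sum>l<m. c (W l w - W k w)) / real m) \<longlonglongrightarrow> c 0 + 2 * D"
      by (rule Lim_transform_eventually)
    then show ?case using D unfolding f_def by simp
  qed
qed

end

section \<open>Green function and i.i.d. increments\<close>

context int_walk
begin

lemma distr_W: "distr S (count_space UNIV) (W l) = density (count_space UNIV) (\<lambda>x. ennreal (\<P>(w in S. W l w = x)))"
proof (rule measure_eqI_countable[where A = UNIV])
  fix x :: int
  have "emeasure (distr S (count_space UNIV) (W l)) {x} = emeasure S {w \<in> space S. W l w = x}"
    by (subst emeasure_distr) (auto intro!: arg_cong[where f = "emeasure S"])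
  also have "\<dots> = ennreal (\<P>(w in S. W l w = x))" by (simp add: P.emeasure_eq_measure)
  also have "\<dots> = emeasure (density (count_space UNIV) (\<lambda>x. ennreal (\<P>(w in S. W l w = x)))) {x}"
    by (subst emeasure_density) (auto simp: nn_integral_indicator_singleton)
  finally show "emeasure (distr S (count_space UNIV) (W l)) {x}
     = emeasure (density (count_space UNIV) (\<lambda>x. ennreal (\<P>(w in S. W l w = x)))) {x}" .
qed auto

lemma integral_W:
  fixes c :: "int \<Rightarrow> real"
  shows "(\<integral>w. c (W l w) \<partial>S) = (\<integral>x. \<P>(w in S. W l w = x) * c x \<partial>count_space UNIV)"
    and "integrable S (\<lambda>w. c (W l w)) \<longleftrightarrow> integrable (count_space UNIV) (\<lambda>x. \<P>(w in S. W l w = x) * c x)"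
proof -
  have "(\<integral>w. c (W l w) \<partial>S) = integral\<^sup>L (distr S (count_space UNIV) (W l)) c"
    by (subst integral_distr) auto
  also have "\<dots> = (\<integral>x. \<P>(w in S. W l w = x) * c x \<partial>count_space UNIV)"
    unfolding distr_W by (subst integral_density) auto
  finally show "(\<integral>w. c (W l w) \<partial>S) = (\<integral>x. \<P>(w in S. W l w = x) * c x \<partial>count_space UNIV)" .
  have "integrable S (\<lambda>w. c (W l w)) \<longleftrightarrow> integrable (distr S (count_space UNIV) (W l)) c"
    by (subst integrable_distr_eq) auto
  also have "\<dots> \<longleftrightarrow> integrable (count_space UNIV) (\<lambda>x. \<P>(w in S. W l w = x) * c x)"
    unfolding distr_W by (subst integrable_density) auto
  finally show "integrable S (\<lambda>w. c (W l w)) \<longleftrightarrow> integrable (count_space UNIV) (\<lambda>x. \<P>(w in S. W l w = x) * c x)" .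
qed

definition G :: "int \<Rightarrow> ennreal" where "G x = (\<Sum>l. ennreal (\<P>(w in S. W l w = x)))"

text \<open>
Exchange of the sums over times and sites. A Bochner integral against the counting measure represents the sum over sites.
\<close>

lemma green_sums:
  fixes c :: "int \<Rightarrow> real"
  assumes Bc: "\<And>y. \<bar>c y\<bar> \<le> Bc" and fin: "\<And>x. G x < \<infinity>"
    and sm: "(\<lambda>x. enn2real (G x) * c x) summable_on UNIV"
  shows "summable (\<lambda>l. \<integral>w. \<bar>c (W l w)\<bar> \<partial>S)"
    and "(\<Sum>l. \<integral>w. c (W l w) \<partial>S) = (\<Sum>\<^sub>\<infinity>x\<in>UNIV. enn2real (G x) * c x)"
proof -
  define p where "p l x = \<P>(w in S. W l w = x)" for l x
  have p0: "p l x \<ge> 0" for l x by (simp add: p_def)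
  have smp: "summable (\<lambda>l. p l x)" for x
    using fin[of x] by (intro summable_suminf_not_top) (auto simp: G_def p_def)
  have Gp: "G x = ennreal (\<Sum>l. p l x)" for x
    unfolding G_def p_def[symmetric] by (rule suminf_ennreal2[OF p0 smp])
  have Gr: "enn2real (G x) = (\<Sum>l. p l x)" for x
    unfolding Gp by (simp add: suminf_nonneg[OF smp] p0)
  have ic: "integrable S (\<lambda>w. c (W l w))" "integrable S (\<lambda>w. \<bar>c (W l w)\<bar>)" for l
    by (rule P.integrable_const_bound[where B = Bc]; use Bc in \<open>auto intro: measurable_compose[OF W_measurable]\<close>)+
  have ip: "integrable (count_space UNIV) (\<lambda>x. p l x * c x)" "integrable (count_space UNIV) (\<lambda>x. p l x * \<bar>c x\<bar>)" for l
    unfolding p_def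
    by (rule iffD1[OF integral_W(2)[where c = c] ic(1)], rule iffD1[OF integral_W(2)[where c = "\<lambda>x. \<bar>c x\<bar>"] ic(2)])
  have abs: "Infinite_Set_Sum.abs_summable_on (\<lambda>x. enn2real (G x) * c x) UNIV"
    by (rule iffD1[OF abs_summable_equivalent iffD1[OF summable_on_iff_abs_summable_on_real sm]])
  then have iG: "integrable (count_space UNIV) (\<lambda>x. enn2real (G x) * c x)"
    unfolding Infinite_Set_Sum.abs_summable_on_def .
  have e: "(\<integral>w. \<bar>c (W l w)\<bar> \<partial>S) = (\<integral>x. p l x * \<bar>c x\<bar> \<partial>count_space UNIV)" for l
    unfolding p_def by (rule integral_W(1))
  show sml: "summable (\<lambda>l. \<integral>w. \<bar>c (W l w)\<bar> \<partial>S)"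
  proof (rule summable_suminf_not_top)
    have "(\<Sum>l. ennreal (\<integral>w. \<bar>c (W l w)\<bar> \<partial>S)) = (\<Sum>l. \<integral>\<^sup>+x. ennreal (p l x * \<bar>c x\<bar>) \<partial>count_space UNIV)"
      unfolding e by (intro suminf_cong nn_integral_eq_integral[symmetric] ip) (auto simp: p0)
    also have "\<dots> = (\<integral>\<^sup>+x. (\<Sum>l. ennreal (p l x * \<bar>c x\<bar>)) \<partial>count_space UNIV)"
      by (rule nn_integral_suminf[symmetric]) simp
    also have "\<dots> = (\<integral>\<^sup>+x. ennreal (norm (enn2real (G x) * c x)) \<partial>count_space UNIV)"
    proof (intro nn_integral_cong)
      fix x
      have "(\<Sum>l. ennreal (p l x * \<bar>c x\<bar>)) = ennreal (\<Sum>l. p l x * \<bar>c x\<bar>)"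
        by (rule suminf_ennreal2) (auto simp: p0 intro: summable_mult2 smp)
      also have "(\<Sum>l. p l x * \<bar>c x\<bar>) = norm (enn2real (G x) * c x)"
        unfolding Gr by (simp add: suminf_mult2[OF smp, symmetric] abs_mult suminf_nonneg[OF smp] p0)
      finally show "(\<Sum>l. ennreal (p l x * \<bar>c x\<bar>)) = ennreal (norm (enn2real (G x) * c x))" .
    qed
    also have "\<dots> < \<infinity>" using iG unfolding integrable_iff_bounded by simp
    finally show "(\<Sum>l. ennreal (\<integral>w. \<bar>c (W l w)\<bar> \<partial>S)) \<noteq> top" by simp
  qed simp
  have "(\<Sum>l. \<integral>w. c (W l w) \<partial>S) = (\<Sum>l. \<integral>x. p l x * c x \<partial>count_space UNIV)"
    unfolding p_def by (intro suminf_cong integral_W(1))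
  also have "\<dots> = (\<integral>x. (\<Sum>l. p l x * c x) \<partial>count_space UNIV)"
  proof (rule integral_suminf[symmetric, OF ip(1)])
    show "AE x in count_space UNIV. summable (\<lambda>l. norm (p l x * c x))"
      by (intro AE_I2) (auto simp: abs_mult p0 intro: summable_mult2 smp)
    show "summable (\<lambda>l. \<integral>x. norm (p l x * c x) \<partial>count_space UNIV)"
      using sml unfolding e by (simp add: abs_mult p0)
  qed
  also have "\<dots> = (\<integral>x. enn2real (G x) * c x \<partial>count_space UNIV)"
    unfolding Gr by (intro Bochner_Integration.integral_cong refl suminf_mult2[OF smp, symmetric])
  also have "\<dots> = infsetsum (\<lambda>x. enn2real (G x) * c x) UNIV" by (simp add: infsetsum_def)
  also have "\<dots> = (\<Sum>\<^sub>\<infinity>x\<in>UNIV. enn2real (G x) * c x)" by (rule infsetsum_infsum[OF abs])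
  finally show "(\<Sum>l. \<integral>w. c (W l w) \<partial>S) = (\<Sum>\<^sub>\<infinity>x\<in>UNIV. enn2real (G x) * c x)" .
qed

end

text \<open>
Independence says that the increments from index \<open>1\<close> on have a product law; renumbering them from \<open>0\<close>
gives the law on sequence space.
\<close>

lemma iid_to_int_walk:
  fixes X :: "nat \<Rightarrow> 'w \<Rightarrow> int"
  assumes "prob_space P" and iid: "iid_increments P X"
  defines "D \<equiv> distr P (count_space UNIV) (X 1)" and "\<Phi> \<equiv> \<lambda>\<omega> i. X (Suc i) \<omega>"
  shows "int_walk D" and "\<Phi> \<in> measurable P (\<Pi>\<^sub>M i\<in>UNIV. D)" and "distr P (\<Pi>\<^sub>M i\<in>UNIV. D) \<Phi> = (\<Pi>\<^sub>M i\<in>UNIV. D)"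
proof -
  interpret prob_space P by fact
  have ind: "indep_vars (\<lambda>_. count_space UNIV) X {1..}" and same: "\<And>i. i \<ge> 1 \<Longrightarrow> distr P (count_space UNIV) (X i) = D"
    using iid unfolding iid_increments_def D_def by blast+
  have rv: "X i \<in> measurable P (count_space UNIV)" if "i \<ge> 1" for i
    using ind that unfolding indep_vars_def by auto
  interpret D: prob_space D unfolding D_def by (rule prob_space_distr) (use rv[of 1] in simp)
  have sD: "sets D = sets (count_space UNIV)" by (simp add: D_def)
  show "int_walk D" by unfold_locales (simp add: D_def)
  have "(\<lambda>\<omega>. X (Suc i) \<omega>) \<in> measurable P D" for i
    using rv[of "Suc i"] by (simp add: measurable_cong_sets[OF refl sD])
  then show \<Phi>m: "\<Phi> \<in> measurable P (\<Pi>\<^sub>M i\<in>UNIV. D)"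
    unfolding \<Phi>_def by (rule measurable_abs_UNIV)
  let ?C = "count_space UNIV :: int measure"
  have sets1: "sets (\<Pi>\<^sub>M i\<in>{1::nat..}. D) = sets (\<Pi>\<^sub>M i\<in>{1::nat..}. ?C)"
    by (rule sets_PiM_cong) (auto simp: sD)
  have sets2: "sets (\<Pi>\<^sub>M i\<in>(UNIV::nat set). D) = sets (\<Pi>\<^sub>M i\<in>UNIV. ?C)"
    by (rule sets_PiM_cong) (auto simp: sD)
  have "distr P (\<Pi>\<^sub>M i\<in>{1..}. ?C) (\<lambda>\<omega>. \<lambda>i\<in>{1..}. X i \<omega>) = (\<Pi>\<^sub>M i\<in>{1..}. distr P ?C (X i))"
    by (rule iffD1[OF indep_vars_iff_distr_eq_PiM' ind]) (auto intro: rv)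
  also have "\<dots> = (\<Pi>\<^sub>M i\<in>{1..}. D)" by (intro PiM_cong refl) (auto intro: same)
  finally have d1: "distr P (\<Pi>\<^sub>M i\<in>{1..}. ?C) (\<lambda>\<omega>. \<lambda>i\<in>{1..}. X i \<omega>) = (\<Pi>\<^sub>M i\<in>{1..}. D)" .
  have m1: "(\<lambda>\<omega>. \<lambda>i\<in>{1..}. X i \<omega>) \<in> measurable P (\<Pi>\<^sub>M i\<in>{1..}. ?C)"
    by (rule measurable_restrict) (auto intro: rv)
  have m2: "(\<lambda>w. \<lambda>n\<in>UNIV. w (Suc n)) \<in> measurable (\<Pi>\<^sub>M i\<in>{1::nat..}. ?C) (\<Pi>\<^sub>M i\<in>(UNIV::nat set). D)"
    unfolding measurable_cong_sets[OF refl sets2]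
    by (rule measurable_restrict) (auto intro!: measurable_component_singleton)
  have "(\<Pi>\<^sub>M i\<in>UNIV. D) = distr (\<Pi>\<^sub>M i\<in>{1..}. D) (\<Pi>\<^sub>M i\<in>UNIV. D) (\<lambda>w. \<lambda>n\<in>UNIV. w (Suc n))"
    by (rule distr_PiM_reindex[symmetric, where f = Suc and M = "\<lambda>_. D"]) (auto intro: D.prob_space_axioms)
  also have "\<dots> = distr (distr P (\<Pi>\<^sub>M i\<in>{1..}. ?C) (\<lambda>\<omega>. \<lambda>i\<in>{1..}. X i \<omega>)) (\<Pi>\<^sub>M i\<in>UNIV. D) (\<lambda>w. \<lambda>n\<in>UNIV. w (Suc n))"
    by (simp only: d1)
  also have "\<dots> = distr P (\<Pi>\<^sub>M i\<in>UNIV. D) ((\<lambda>w. \<lambda>n\<in>UNIV. w (Suc n)) \<circ> (\<lambda>\<omega>. \<lambda>i\<in>{1..}. X i \<omega>))"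
    by (rule distr_distr[OF m2 m1])
  also have "(\<lambda>w. \<lambda>n\<in>UNIV. w (Suc n)) \<circ> (\<lambda>\<omega>. \<lambda>i\<in>{1..}. X i \<omega>) = \<Phi>"
    by (auto simp: \<Phi>_def fun_eq_iff)
  finally show "distr P (\<Pi>\<^sub>M i\<in>UNIV. D) \<Phi> = (\<Pi>\<^sub>M i\<in>UNIV. D)" by simp
qed

section \<open>The stationary sequence of an invertible transformation\<close>

context
  fixes M :: "'a measure" and T :: "'a \<Rightarrow> 'a"
  assumes T: "invertible_mpt M T"
begin

lemma T_measurable: "T \<in> measurable M M" and T_distr: "distr M M T = M"
  and Tinv_measurable: "inv_into (space M) T \<in> measurable M M"
  and T_bij: "bij_betw T (space M) (space M)"
  using T by (auto simp: invertible_mpt_def)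

lemma funpow_measurable: "h \<in> measurable M M \<Longrightarrow> h ^^ n \<in> measurable M M"
  by (induction n) (auto simp: comp_def intro: measurable_compose)

lemma iter_int_measurable: "iter_int M T x \<in> measurable M M"
  unfolding iter_int_def using funpow_measurable T_measurable Tinv_measurable by auto

lemma iter_int_space: "y \<in> space M \<Longrightarrow> iter_int M T x y \<in> space M"
  using measurable_space[OF iter_int_measurable] .

text \<open>
For negative \<open>x\<close> this is \<open>T \<circ> T\<^bsup>-1\<^esup> = id\<close>, which only holds on the space.
\<close>

lemma iter_int_Suc:
  assumes y: "y \<in> space M"
  shows "iter_int M T (x + 1) y = T (iter_int M T x y)"
proof (cases "x \<ge> 0")
  case True
  then show ?thesis by (simp add: iter_int_def nat_add_distrib)
next
  case False
  define k where "k = nat (- x - 1)"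
  have x: "x = - int (Suc k)" using False by (simp add: k_def)
  let ?S = "inv_into (space M) T"
  have "(?S ^^ k) y \<in> space M" by (rule measurable_space[OF funpow_measurable[OF Tinv_measurable] y])
  then have "T (?S ((?S ^^ k) y)) = (?S ^^ k) y"
    using T_bij by (intro f_inv_into_f) (auto simp: bij_betw_def)
  moreover have "iter_int M T x y = ?S ((?S ^^ k) y)" by (simp add: x iter_int_def nat_add_distrib)
  moreover have "iter_int M T (x + 1) y = (?S ^^ k) y"
    by (cases k) (auto simp: x iter_int_def nat_add_distrib)
  ultimately show ?thesis by simp
qed

lemma iter_int_add:
  assumes y: "y \<in> space M"
  shows "iter_int M T (x + z) y = iter_int M T z (iter_int M T x y)"
proof (induction z rule: int_induct[where k = 0])
  case base
  then show ?case by (simp add: iter_int_def)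
next
  case (step1 z)
  have "iter_int M T (x + (z + 1)) y = T (iter_int M T (x + z) y)"
    using iter_int_Suc[OF y, of "x + z"] by (simp add: add.assoc)
  then show ?case using step1 iter_int_Suc[OF iter_int_space[OF y, of x], of z] by simp
next
  case (step2 z)
  have inj: "inj_on T (space M)" using T_bij by (simp add: bij_betw_def)
  have "T (iter_int M T (x + (z - 1)) y) = iter_int M T (x + z) y"
    using iter_int_Suc[OF y, of "x + (z - 1)"] by simp
  also have "\<dots> = T (iter_int M T (z - 1) (iter_int M T x y))"
    using step2 iter_int_Suc[OF iter_int_space[OF y, of x], of "z - 1"] by simp
  finally show ?case
    by (rule inj_onD[OF inj]) (intro iter_int_space y)+
qed

lemma distr_funpow:
  assumes "h \<in> measurable M M" "distr M M h = M" shows "distr M M (h ^^ n) = M"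
proof (induction n)
  case 0
  then show ?case by (simp add: id_def distr_id)
next
  case (Suc n)
  have "distr M M (h ^^ Suc n) = distr (distr M M (h ^^ n)) M h"
    using funpow_measurable[OF assms(1)] assms(1) by (subst distr_distr) (auto simp: comp_def)
  then show ?case using Suc assms by (simp add: comp_def)
qed

lemma Tinv_distr: "distr M M (inv_into (space M) T) = M"
proof -
  let ?S = "inv_into (space M) T"
  have "distr M M ?S = distr (distr M M T) M ?S" by (simp add: T_distr)
  also have "\<dots> = distr M M (?S \<circ> T)" by (rule distr_distr[OF Tinv_measurable T_measurable])
  also have "\<dots> = distr M M (\<lambda>x. x)"
    using T_bij by (intro distr_cong) (auto simp: bij_betw_def)
  finally show ?thesis by (simp add: distr_id)
qed

lemma iter_int_distr: "distr M M (iter_int M T x) = M"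
  unfolding iter_int_def using distr_funpow[OF T_measurable T_distr] distr_funpow[OF Tinv_measurable Tinv_distr] by auto

lemma iter_int_stationary:
  fixes f :: "'a \<Rightarrow> real"
  assumes f[measurable]: "f \<in> borel_measurable M"
  shows "(\<integral>y. f (iter_int M T x y) * f (iter_int M T z y) \<partial>M) = (\<integral>y. f y * f (iter_int M T (z - x) y) \<partial>M)"
proof -
  note [measurable] = iter_int_measurable
  have "(\<integral>y. f y * f (iter_int M T (z - x) y) \<partial>M)
      = (\<integral>y. f y * f (iter_int M T (z - x) y) \<partial>distr M M (iter_int M T x))"
    by (simp add: iter_int_distr)
  also have "\<dots> = (\<integral>y. f (iter_int M T x y) * f (iter_int M T (z - x) (iter_int M T x y)) \<partial>M)"
    by (rule integral_distr) measurable
  also have "\<dots> = (\<integral>y. f (iter_int M T x y) * f (iter_int M T z y) \<partial>M)"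
    by (intro Bochner_Integration.integral_cong refl) (simp add: iter_int_add[symmetric])
  finally show ?thesis by simp
qed

end

section \<open>Random walk in a random scenery\<close>

text \<open>
Compare \<open>x\<^bsup>3/2\<^esup> g(x)\<close> at \<open>n\<close> with its value at \<open>1\<close>.
\<close>

lemma theta_decaying_of_antimono_bound:
  fixes f :: "'a \<Rightarrow> real" and g :: "real \<Rightarrow> real"
  assumes "prob_space M" and T: "invertible_mpt M T"
    and f[measurable]: "f \<in> borel_measurable M" and f2: "integrable M (\<lambda>y. (f y)\<^sup>2)"
    and g: "g 1 \<ge> 0"
    and \<theta>: "\<And>n::nat. n \<ge> 1 \<Longrightarrow> theta2_coeff M (\<lambda>x y. f (iter_int M T x y)) n \<le> ennreal (g (real n))"
    and anti: "antimono_on {0<..} (\<lambda>x. x powr (3/2) * g x)"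
  shows "theta_decaying M (\<lambda>x y. f (iter_int M T x y)) (g 1)"
proof -
  interpret prob_space M by fact
  note [measurable] = iter_int_measurable[OF T]
  have i0: "iter_int M T 0 = id" by (simp add: iter_int_def)
  show ?thesis
  proof (unfold_locales)
    show "(\<lambda>y. f (iter_int M T x y)) \<in> borel_measurable M" for x by measurable
    have "distr M borel (\<lambda>y. f (iter_int M T x y)) = distr (distr M M (iter_int M T x)) borel f" for x
      by (subst distr_distr) (auto simp: comp_def)
    then show "distr M borel (\<lambda>y. f (iter_int M T x y)) = distr M borel (\<lambda>y. f (iter_int M T 0 y))" for x
      by (simp add: iter_int_distr[OF T])
    show "integrable M (\<lambda>\<omega>. (f (iter_int M T 0 \<omega>))\<^sup>2)" using f2 by (simp add: i0)
    show "0 \<le> g 1" by fact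
    fix n :: nat assume n: "1 \<le> n"
    have "real n powr (3/2) * g (real n) \<le> 1 powr (3/2) * g 1"
      using monotone_onD[OF anti, of 1 "real n"] n by simp
    then have "g (real n) \<le> g 1 * real n powr (-3/2)"
      using n by (simp add: powr_minus field_simps)
    then show "theta2_coeff M (\<lambda>x y. f (iter_int M T x y)) n \<le> ennreal (g 1 * real n powr (-3/2))"
      using \<theta>[OF n] by (meson ennreal_leI order_trans)
  qed
qed

theorem theorem4p1:
  fixes M :: "'a measure" and T :: "'a \<Rightarrow> 'a"
    and P :: "'w measure" and X :: "nat \<Rightarrow> 'w \<Rightarrow> int"
    and f :: "'a \<Rightarrow> real" and g :: "real \<Rightarrow> real"
  assumes "prob_space M" and "invertible_mpt M T"
    and "prob_space P" and "iid_increments P X"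
    and "transient_walk P X" and "\<And>x. green P X x < \<infinity>"
    and "f \<in> borel_measurable M" and "integrable M (\<lambda>y. (f y)\<^sup>2)"
    and "(\<integral>y. f y \<partial>M) = 0"
    and "\<And>x. x > 0 \<Longrightarrow> g x \<ge> 0"
    and "\<And>n::nat. n \<ge> 1 \<Longrightarrow>
           theta2_coeff M (\<lambda>x y. f (iter_int M T x y)) n \<le> ennreal (g (real n))"
    and "antimono_on {0<..} (\<lambda>x. x powr (3/2) * g x)"
    and "\<exists>\<epsilon>. 0 < \<epsilon> \<and> \<epsilon> < 1 \<and>
           summable (\<lambda>i::nat. 2 powr (3 * real i / 2) * g (2 powr (real i * \<epsilon>)))"
    and "variance_term M T P X f summable_on UNIV"
    and "sigma2 M T P X f > 0"
  shows "AE \<omega> in P.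
           weak_conv_m
             (\<lambda>n. distr M borel
                (\<lambda>y. (1 / sqrt (real n)) * (\<Sum>k=0..n. f (iter_int M T (walk X k \<omega>) y))))
             (density lborel (\<lambda>t. ennreal (normal_density 0 (sqrt (sigma2 M T P X f)) t)))"
proof -
  define \<xi> where "\<xi> x y = f (iter_int M T x y)" for x y
  define c where "c z = (\<integral>y. f y * f (iter_int M T z y) \<partial>M)" for z
  have i0: "iter_int M T 0 = id" by (simp add: iter_int_def)
  interpret \<xi>: theta_decaying M \<xi> "g 1"
    unfolding \<xi>_def by (rule theta_decaying_of_antimono_bound) (use assms in auto)
  have "\<xi> 0 = f" by (rule ext) (simp add: \<xi>_def i0)
  then have E0: "\<xi>.expectation (\<xi> 0) = 0" using assms(9) by simp
  have stat: "\<xi>.expectation (\<lambda>y. \<xi> x y * \<xi> z y) = c (z - x)" for x z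
    unfolding \<xi>_def c_def by (rule iter_int_stationary[OF assms(2,7)])
  have sym: "c (- z) = c z" for z
    using stat[of 0 z] stat[of z 0] by (simp add: mult.commute)
  have cB: "\<bar>c z\<bar> \<le> \<xi>.expectation (\<lambda>y. (\<xi> 0 y)\<^sup>2)" for z
  proof -
    have "\<bar>\<xi>.expectation (\<lambda>y. \<xi> 0 y * \<xi> z y)\<bar> \<le> \<xi>.l2norm (\<xi> 0) * \<xi>.l2norm (\<xi> z)"
      by (rule \<xi>.L2_cauchy_schwarz[OF \<xi>.L2_\<xi> \<xi>.L2_\<xi>])
    also have "\<xi>.expectation (\<lambda>y. (\<xi> z y)\<^sup>2) = \<xi>.expectation (\<lambda>y. (\<xi> 0 y)\<^sup>2)"
      by (rule \<xi>.expectation_\<xi>) simp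
    finally show ?thesis using stat[of 0 z] by simp
  qed
  define D where "D = distr P (count_space UNIV) (X 1)"
  define \<Phi> where "\<Phi> \<omega> i = X (Suc i) \<omega>" for \<omega> i
  note iid = iid_to_int_walk[OF assms(3,4), folded D_def \<Phi>_def[abs_def]]
  interpret w: int_walk D by (rule iid(1))
  interpret P: prob_space P by fact
  have walk: "walk X n \<omega> = w.W n (\<Phi> \<omega>)" for n \<omega>
    unfolding walk_def w.W_def \<Phi>_def by (rule sum.reindex_bij_witness[of _ Suc "\<lambda>i. i - 1"]) auto
  have prob: "measure P {\<omega> \<in> space P. Q (\<Phi> \<omega>)} = \<P>(w in w.S. Q w)" if "Measurable.pred w.S Q" for Q
  proof -
    have "\<P>(w in w.S. Q w) = measure (distr P w.S \<Phi>) {w \<in> space w.S. Q w}" by (simp add: iid(3))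
    also have "\<dots> = measure P (\<Phi> -` {w \<in> space w.S. Q w} \<inter> space P)"
      using that iid(2) by (intro measure_distr) auto
    also have "\<Phi> -` {w \<in> space w.S. Q w} \<inter> space P = {\<omega> \<in> space P. Q (\<Phi> \<omega>)}"
      by (auto simp: w.space_S)
    finally show ?thesis by simp
  qed
  have \<rho>: "w.\<rho> < 1"
    using assms(5) prob[of "\<lambda>w. \<exists>n\<ge>1. w.W n w = 0"] by (simp add: transient_walk_def w.\<rho>_def walk)
  have green: "green P X x = w.G x" for x
    unfolding green_def w.G_def walk by (subst prob) auto
  have G: "w.G x < \<infinity>" for x using assms(6)[of x] by (simp add: green)
  have vt: "variance_term M T P X f x = enn2real (w.G x) * c x" for x
    by (simp add: variance_term_def green c_def)
  have "(\<lambda>x. enn2real (w.G x) * c x) summable_on UNIV" using assms(14) by (simp add: vt[abs_def])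
  note gc = w.green_sums[OF cB G this]
  have d1: "\<bar>if y = 0 then 1 else (0::real)\<bar> \<le> 1" for y :: int by simp
  have dsym: "(if - y = 0 then 1 else (0::real)) = (if y = 0 then 1 else 0)" for y :: int by simp
  have "(\<lambda>x. enn2real (w.G x) * (if x = 0 then 1 else 0)) summable_on UNIV"
  proof -
    have "(\<lambda>x. enn2real (w.G x) * (if x = 0 then 1 else 0)) summable_on {0}" by simp
    then show ?thesis by (rule summable_on_cong_neutral[THEN iffD1, rotated -1]) auto
  qed
  \<comment> \<open>With the indicator of \<open>0\<close> the averages are the sums of squared occupation numbers.\<close>
  note gd = w.green_sums[OF d1 G this]
  have var: "sigma2 M T P X f = 2 * (\<Sum>l. \<integral>w. c (w.W l w) \<partial>w.S) - c 0"
    unfolding sigma2_def gc(2) vt by (simp add: c_def i0 power2_eq_square)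
  have "AE w in w.S. weak_conv_m (\<lambda>n. distr M borel (\<lambda>y. (1 / sqrt (real n)) * (\<Sum>k=0..n. \<xi> (w.W k w) y)))
      (density lborel (\<lambda>t. ennreal (normal_density 0 (sqrt (sigma2 M T P X f)) t)))"
    using w.AE_visits_le[OF \<rho>] w.AE_pair_average[OF cB sym gc(1)] w.AE_pair_average[OF d1 dsym gd(1)]
  proof eventually_elim
    case (elim w)
    show ?case
    proof (rule \<xi>.sampled_clt[OF E0 stat])
      show "\<forall>\<^sub>F n in sequentially. \<forall>x. real (occ (\<lambda>k. w.W k w) n x) \<le> real n powr (1/100)"
        using elim(1) by (simp add: occ_def)
      show "(\<lambda>m. (\<Sum>k<m. \<Sum>l<m. c (w.W l w - w.W k w)) / real m) \<longlonglongrightarrow> sigma2 M T P X f"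
        using elim(2) by (simp add: var)
      show "(\<lambda>m. (\<Sum>k<m. \<Sum>l<m. if w.W l w - w.W k w = 0 then 1 else 0) / real m) \<longlonglongrightarrow>
        2 * (\<Sum>l. \<integral>w. (if w.W l w = 0 then 1 else 0) \<partial>w.S) - (if (0::int) = 0 then 1 else 0)"
        using elim(3) by simp
    qed fact
  qed
  then have "AE w in distr P w.S \<Phi>. weak_conv_m (\<lambda>n. distr M borel (\<lambda>y. (1 / sqrt (real n)) * (\<Sum>k=0..n. \<xi> (w.W k w) y)))
      (density lborel (\<lambda>t. ennreal (normal_density 0 (sqrt (sigma2 M T P X f)) t)))"
    unfolding iid(3) .
  from AE_distrD[OF iid(2) this] show ?thesis by (simp only: walk \<xi>_def)
qed

end
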